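(* (a) For every fixed integer $r\ge 2$ and every $\beta\in\{\operatorname{tw},\operatorname{la},\operatorname{pw},\operatorname{ppw}\}$, \[\lim_{n\to\infty}\frac{\beta(r;n)}{n}=r.\] (b) For every fixed integer $r\ge 2$ and every $\beta\in\{\eta,\mu,\nu,\xi\}$, $\beta(r;n)=\Theta(n)$ as $n\to\infty$. Specifically, for $n\ge 3$, as $n\to\infty$, \[\frac{r}{\left\lceil \sqrt{2r+\frac14}-\frac12\right\rceil}-o(1)\le \frac{\beta(r;n)}{n}\le \sqrt r+o(1).\]
   Context: All graphs are finite, simple and undirected. An $r$-decomposition of the complete graph $K_n=([n],E)$ is a partition of $E$ into edge sets $E_1,\dots,E_r$ (possibly empty) of spanning subgraphs $G_i=([n],E_i)$. For a nonnegative integer valued graph parameter $\beta$, $\beta(r;n):=\max\{\beta(G_1)+\dots+\beta(G_r)\}$, the maximum over all $r$-decompositions $G_1,\dots,G_r$ of $K_n$. Tree-width and variants. For a graph with no edges, $\operatorname{tw},\operatorname{la},\operatorname{pw},\operatorname{ppw}$ are all $0$. For $G$ with an edge and positive integers $k$: a $k$-tree is built by starting with $K_{k+1}$ and repeatedly adding a new vertex joined to all vertices of an existing $k$-clique. A facet of a maximal clique (order $k+1$) of a $k$-tree is one of its $k$-clique subgraphs. A linear $k$-tree starts with $K_{k+1}$ and each new vertex is joined to a facet that includes the vertex added in the previous step. A $k$-caterpillar starts with $K_{k+1}$ and each new vertex is joined to the $k$ vertices of some facet of the maximal clique added in the previous step. A two-sided $k$-tree starts with $K_{k+1}$ and each new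 vertex is joined to the vertices of an existing $K_k$ that either includes a vertex of degree $k$ or is the same $K_k$ to which some previous vertex was connected. Then the tree-width $\operatorname{tw}(G)$, largeur d'arborescence $\operatorname{la}(G)$, path-width $\operatorname{pw}(G)$, proper path-width $\operatorname{ppw}(G)$ is the minimum $k$ such that $G$ is a subgraph of a $k$-tree, two-sided $k$-tree, $k$-caterpillar, linear $k$-tree, respectively. Hadwiger number: $\eta(G)$ is the maximum order of a clique minor of $G$. Colin de Verdière type parameters. For a graph $G$ on $[n]$, $\mathcal S(G)$ is the set of real symmetric $n\times n$ matrices $A=[a_{ij}]$ such that for $i\ne j$, $a_{ij}\neq 0$ iff $ij$ is an edge of $G$ (diagonal unrestricted). $A$ satisfies the Strong Arnold Property if there is no nonzero real symmetric $X$ with $AX=O$, $A\circ X=O$, $I\circ X=O$ ($\circ$ the entrywise product). $\xi(G)$ is the maximum nullity of $A\in\mathcal S(G)$ satisfying the Strong Arnold Property; $\nu(G)$ is the maximum nullity of positive semidefinite $A\in\mathcal S(G)$ satisfying the Strong Arnold Property; $\mu(G)$ is the maximum nullity of $A\in\mathcal S(G)$ satisfying the Strong Arnold Property, having exactly one negative eigenvalue, and with $a_{ij}\le 0$ for all $i\neq j$. Here $r$ and $\beta$ are fixed, and $o(1)$ denotes a function of $n$ tending to $0$ as $n\to\infty$; $f=\Theta(g)$ means there are positive constants $c,C,N$ with $c|g(n)|\le|f(n)|\le C|g(n)|$ for all $n\ge N$. *)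

theory Defs
  imports
    Complex_Main
    "HOL-Library.Ramsey"
    "HOL-Library.Disjoint_Sets"
    "HOL-Library.Landau_Symbols"
    "Jordan_Normal_Form.Matrix_Kernel"
    "Jordan_Normal_Form.Char_Poly"
begin

text \<open>
  A simple graph is given by its vertex set \<open>V\<close> and its edge set \<open>E\<close>, a set of two-element
  subsets of \<open>V\<close>. The complete graph on \<open>V\<close> has edge set \<open>nsets V 2\<close>. The vertex set \<open>[n]\<close> is
  represented by \<open>{..<n}\<close>, so that vertices are also the row and column indices of
  \<open>n \<times> n\<close> matrices. A graph parameter \<open>\<beta>\<close> maps \<open>n\<close> and \<open>E\<close> to its value at the graph
  \<open>({..<n}, E)\<close>.
\<close>

type_synonym graph_param = "nat \<Rightarrow> nat set set \<Rightarrow> nat"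

definition decomposition :: "nat \<Rightarrow> nat \<Rightarrow> (nat \<Rightarrow> nat set set) \<Rightarrow> bool" where
  "decomposition r n Es \<longleftrightarrow>
     disjoint_family_on Es {..<r} \<and> (\<Union>i<r. Es i) = nsets {..<n} 2"

definition decomp_max :: "graph_param \<Rightarrow> nat \<Rightarrow> nat \<Rightarrow> nat" where
  "decomp_max \<beta> r n = Max {\<Sum>i<r. \<beta> n (Es i) | Es. decomposition r n Es}"


section \<open>Tree-width and variants\<close>

definition is_clique :: "'a set \<Rightarrow> 'a set set \<Rightarrow> 'a set \<Rightarrow> bool" where
  "is_clique V E C \<longleftrightarrow> C \<subseteq> V \<and> nsets C 2 \<subseteq> E"

definition maximal_clique :: "'a set \<Rightarrow> 'a set set \<Rightarrow> 'a set \<Rightarrow> bool" where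
  "maximal_clique V E K \<longleftrightarrow>
     is_clique V E K \<and> (\<forall>K'. is_clique V E K' \<and> K \<subseteq> K' \<longrightarrow> K' = K)"

definition facet_of :: "nat \<Rightarrow> 'a set \<Rightarrow> 'a set \<Rightarrow> bool" where
  "facet_of k K C \<longleftrightarrow> C \<subseteq> K \<and> card C = k"

definition join_vertex :: "'a \<Rightarrow> 'a set \<Rightarrow> 'a set set \<Rightarrow> 'a set set" where
  "join_vertex v C E = E \<union> {{v, u} | u. u \<in> C}"

definition vertex_degree :: "'a set set \<Rightarrow> 'a \<Rightarrow> nat" where
  "vertex_degree E v = card {e \<in> E. v \<in> e}"

inductive k_tree :: "nat \<Rightarrow> nat set \<Rightarrow> nat set set \<Rightarrow> bool" for k where
  start: "card V = k + 1 \<Longrightarrow> k_tree k V (nsets V 2)"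
| step: "k_tree k V E \<Longrightarrow> is_clique V E C \<Longrightarrow> card C = k \<Longrightarrow> v \<notin> V
    \<Longrightarrow> k_tree k (insert v V) (join_vertex v C E)"

text \<open>
  The last argument is the vertex added in the previous step; it is \<open>None\<close> for the initial
  clique, so that the first new vertex may be joined to any facet.
\<close>

inductive linear_k_tree_last :: "nat \<Rightarrow> nat set \<Rightarrow> nat set set \<Rightarrow> nat option \<Rightarrow> bool" for k where
  start: "card V = k + 1 \<Longrightarrow> linear_k_tree_last k V (nsets V 2) None"
| step: "linear_k_tree_last k V E l \<Longrightarrow> maximal_clique V E K \<Longrightarrow> card K = k + 1
    \<Longrightarrow> facet_of k K C \<Longrightarrow> set_option l \<subseteq> C \<Longrightarrow> v \<notin> V
    \<Longrightarrow> linear_k_tree_last k (insert v V) (join_vertex v C E) (Some v)"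

definition linear_k_tree :: "nat \<Rightarrow> nat set \<Rightarrow> nat set set \<Rightarrow> bool" where
  "linear_k_tree k V E \<longleftrightarrow> (\<exists>l. linear_k_tree_last k V E l)"

text \<open>The last argument is the maximal clique added in the previous step.\<close>

inductive k_caterpillar_last :: "nat \<Rightarrow> nat set \<Rightarrow> nat set set \<Rightarrow> nat set \<Rightarrow> bool" for k where
  start: "card V = k + 1 \<Longrightarrow> k_caterpillar_last k V (nsets V 2) V"
| step: "k_caterpillar_last k V E K \<Longrightarrow> facet_of k K C \<Longrightarrow> v \<notin> V
    \<Longrightarrow> k_caterpillar_last k (insert v V) (join_vertex v C E) (insert v C)"

definition k_caterpillar :: "nat \<Rightarrow> nat set \<Rightarrow> nat set set \<Rightarrow> bool" where
  "k_caterpillar k V E \<longleftrightarrow> (\<exists>K. k_caterpillar_last k V E K)"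

text \<open>The last argument collects the \<open>k\<close>-cliques to which previous vertices were joined.\<close>

inductive two_sided_k_tree_used :: "nat \<Rightarrow> nat set \<Rightarrow> nat set set \<Rightarrow> nat set set \<Rightarrow> bool" for k where
  start: "card V = k + 1 \<Longrightarrow> two_sided_k_tree_used k V (nsets V 2) {}"
| step: "two_sided_k_tree_used k V E S \<Longrightarrow> is_clique V E C \<Longrightarrow> card C = k
    \<Longrightarrow> (\<exists>u\<in>C. vertex_degree E u = k) \<or> C \<in> S \<Longrightarrow> v \<notin> V
    \<Longrightarrow> two_sided_k_tree_used k (insert v V) (join_vertex v C E) (insert C S)"

definition two_sided_k_tree :: "nat \<Rightarrow> nat set \<Rightarrow> nat set set \<Rightarrow> bool" where
  "two_sided_k_tree k V E \<longleftrightarrow> (\<exists>S. two_sided_k_tree_used k V E S)"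

text \<open>
  The host graph may use arbitrary natural numbers as vertices. Each of the four classes is
  closed under relabelling, so containing \<open>({..<n}, E)\<close> literally is the same as containing
  an isomorphic copy of it.
\<close>

definition least_width :: "(nat \<Rightarrow> nat set \<Rightarrow> nat set set \<Rightarrow> bool) \<Rightarrow> graph_param" where
  "least_width P n E =
     (if E = {} then 0
      else LEAST k. k \<ge> 1 \<and> (\<exists>V F. P k V F \<and> {..<n} \<subseteq> V \<and> E \<subseteq> F))"

definition tree_width :: graph_param where
  "tree_width = least_width k_tree"

definition largeur_arborescence :: graph_param where
  "largeur_arborescence = least_width two_sided_k_tree"

definition path_width :: graph_param where
  "path_width = least_width k_caterpillar"

definition proper_path_width :: graph_param where
  "proper_path_width = least_width linear_k_tree"


section \<open>Hadwiger number\<close>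

text \<open>
  \<open>minor V E V' E'\<close>: the graph \<open>(V', E')\<close> arises from \<open>(V, E)\<close> by deleting edges, deleting
  vertices and contracting edges. Contracting \<open>{x, y}\<close> names the new vertex \<open>x\<close>;
  parallel edges are merged since edges form a set.
\<close>

inductive minor :: "'a set \<Rightarrow> 'a set set \<Rightarrow> 'a set \<Rightarrow> 'a set set \<Rightarrow> bool" for V E where
  refl: "minor V E V E"
| delete_edge: "minor V E V' E' \<Longrightarrow> e \<in> E' \<Longrightarrow> minor V E V' (E' - {e})"
| delete_vertex: "minor V E V' E' \<Longrightarrow> x \<in> V' \<Longrightarrow> minor V E (V' - {x}) {e \<in> E'. x \<notin> e}"
| contract_edge: "minor V E V' E' \<Longrightarrow> x \<noteq> y \<Longrightarrow> {x, y} \<in> E'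
    \<Longrightarrow> minor V E (V' - {y}) ((\<lambda>e. id(y := x) ` e) ` (E' - {{x, y}}))"

definition hadwiger_number :: graph_param where
  "hadwiger_number n E = Max {card W | W. minor {..<n} E W (nsets W 2)}"


section \<open>Colin de Verdiere type parameters\<close>

definition sym_mats :: "nat \<Rightarrow> nat set set \<Rightarrow> real mat set" where
  "sym_mats n E = {A \<in> carrier_mat n n. transpose_mat A = A \<and>
     (\<forall>i<n. \<forall>j<n. i \<noteq> j \<longrightarrow> (A $$ (i, j) \<noteq> 0 \<longleftrightarrow> {i, j} \<in> E))}"

definition hadamard_mult :: "real mat \<Rightarrow> real mat \<Rightarrow> real mat" where
  "hadamard_mult A B = mat (dim_row A) (dim_col A) (\<lambda>ij. A $$ ij * B $$ ij)"

definition strong_arnold :: "nat \<Rightarrow> real mat \<Rightarrow> bool" where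
  "strong_arnold n A \<longleftrightarrow>
     \<not> (\<exists>X \<in> carrier_mat n n. transpose_mat X = X \<and> X \<noteq> 0\<^sub>m n n \<and>
          A * X = 0\<^sub>m n n \<and> hadamard_mult A X = 0\<^sub>m n n \<and> hadamard_mult (1\<^sub>m n) X = 0\<^sub>m n n)"

definition pos_semidef :: "nat \<Rightarrow> real mat \<Rightarrow> bool" where
  "pos_semidef n A \<longleftrightarrow> (\<forall>v \<in> carrier_vec n. 0 \<le> v \<bullet> (A *\<^sub>v v))"

text \<open>
  Eigenvalues are counted with multiplicity, so having exactly one negative eigenvalue
  includes that it is simple.
\<close>

definition num_neg_eigenvalues :: "real mat \<Rightarrow> nat" where
  "num_neg_eigenvalues A = (\<Sum>a | eigenvalue A a \<and> a < 0. Polynomial.order a (char_poly A))"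

definition cdv_xi :: graph_param where
  "cdv_xi n E = Max {kernel_dim A | A. A \<in> sym_mats n E \<and> strong_arnold n A}"

definition cdv_nu :: graph_param where
  "cdv_nu n E =
     Max {kernel_dim A | A. A \<in> sym_mats n E \<and> strong_arnold n A \<and> pos_semidef n A}"

definition cdv_mu :: graph_param where
  "cdv_mu n E =
     Max {kernel_dim A | A. A \<in> sym_mats n E \<and> strong_arnold n A \<and>
       num_neg_eigenvalues A = 1 \<and> (\<forall>i<n. \<forall>j<n. i \<noteq> j \<longrightarrow> A $$ (i, j) \<le> 0)}"

end

theory Submission
  imports Defs "HOL-Real_Asymp.Real_Asymp"
begin

text \<open>
  For the four width parameters, only the lower bound \<open>r - o(1)\<close> needs an argument: a graph on
  \<open>n\<close> vertices with an edge is a subgraph of \<open>K\<^sub>n\<close>, which is itself a \<open>k\<close>-tree of each of the four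
  kinds with \<open>k = n - 1\<close>, and tree-width is the smallest of the four. Colour the edges
  of \<open>K\<^sub>n\<close> at random with \<open>r\<close> colours. With positive probability every colour class meets every
  pair of disjoint \<open>t\<close>-sets of vertices, where \<open>t\<close> is of order \<open>sqrt n\<close>
  (\<open>exists_hole_free_decomposition\<close>). A graph with that property has tree-width at least \<open>n - 3t\<close>:
  its connected vertex sets with at least \<open>t\<close> elements form a bramble, in a \<open>k\<close>-tree every bramble
  is covered by at most \<open>k + 1\<close> vertices (\<open>k_tree_bramble_cover\<close>), and once \<open>3t\<close> vertices are left
  uncovered, they contain a connected set with at least \<open>t\<close> elements.

  For the other four parameters the upper bound comes from an edge count. If \<open>q\<close> is the
  Hadwiger number of a graph with \<open>m\<close> edges, then \<open>q(q - 1) \<le> 2m\<close>. For the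
  three spectral parameters, the symmetric \<open>X\<close> with \<open>A X = 0\<close> form a space of dimension
  \<open>q(q + 1)/2\<close>, where \<open>q\<close> is the nullity of \<open>A\<close>; the Strong Arnold Property says that such an \<open>X\<close> is
  determined by its entries on the diagonal and on the edges, so \<open>q(q + 1)/2 \<le> n + m\<close>
  (\<open>strong_arnold_nullity_bound\<close>). Summing over the \<open>r\<close> graphs of a decomposition, whose edges
  number \<open>n(n - 1)/2\<close> in total, the Cauchy-Schwarz inequality gives \<open>sqrt r * n + O(1)\<close>.

  For the lower bound, let \<open>k\<close> be the denominator in the statement. It is the least number with
  \<open>r \<le> k(k + 1)/2\<close>, the number of unordered pairs, with repetition, of residue
  classes modulo \<open>k\<close>. Sorting the edges by the residue classes of their two ends, and merging the
  \<open>d = k(k + 1)/2 - r < k\<close> surplus pairs \<open>{a, a}\<close> into the pairs \<open>{a, a + 1}\<close>, decomposes \<open>K\<^sub>n\<close> into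
  exactly \<open>r\<close> graphs. Each of them is, up to isolated vertices, complete bipartite or the join of an
  independent set and a clique, with about \<open>n/k\<close> vertices in the relevant part \<open>Y\<close>. Contracting a
  matching exhibits a clique minor with \<open>|Y|\<close> vertices. For the spectral parameters, an
  explicit block matrix with blocks \<open>I\<close>, \<open>Q\<close>, \<open>Q\<^sup>T\<close>, \<open>Q\<^sup>T Q - c J\<close>
  has nullity at least \<open>|Y| - 1\<close> (locale \<open>schur_form\<close>). It is positive semidefinite if \<open>c = 0\<close>
  and has exactly one negative eigenvalue if \<open>c > 0\<close>. Altogether each graph contributes at least
  \<open>n/k - O(1)\<close>.
\<close>

section \<open>Decompositions\<close>

lemma decomposition_subset:
  "decomposition r n Es \<Longrightarrow> i < r \<Longrightarrow> Es i \<subseteq> nsets {..<n} 2"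
  unfolding decomposition_def by blast

lemma finite_decomposition_sums:
  fixes \<beta> :: graph_param
  shows "finite {\<Sum>i<r. \<beta> n (Es i) | Es. decomposition r n Es}"
proof -
  let ?V = "\<beta> n ` Pow (nsets {..<n} 2)"
  have fin: "finite ?V" by (simp add: finite_imp_finite_nsets)
  have "(\<Sum>i<r. \<beta> n (Es i)) \<le> r * Max ?V" if "decomposition r n Es" for Es
  proof -
    have "(\<Sum>i<r. \<beta> n (Es i)) \<le> (\<Sum>i<r. Max ?V)"
      using decomposition_subset[OF that] fin by (intro sum_mono Max_ge) auto
    then show ?thesis by simp
  qed
  then have "{\<Sum>i<r. \<beta> n (Es i) | Es. decomposition r n Es} \<subseteq> {..r * Max ?V}" by auto
  then show ?thesis by (rule finite_subset) simp
qed

lemma decomp_max_ge: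
  "decomposition r n Es \<Longrightarrow> (\<Sum>i<r. \<beta> n (Es i)) \<le> decomp_max \<beta> r n"
  unfolding decomp_max_def using finite_decomposition_sums by (intro Max_ge) auto

lemma decomp_max_attained:
  assumes "r \<ge> 1"
  obtains Es where "decomposition r n Es" "decomp_max \<beta> r n = (\<Sum>i<r. \<beta> n (Es i))"
proof -
  let ?S = "{\<Sum>i<r. \<beta> n (Es i) | Es. decomposition r n Es}"
  have "decomposition r n (\<lambda>i. if i = 0 then nsets {..<n} 2 else {})"
    using assms unfolding decomposition_def disjoint_family_on_def by auto
  then have "?S \<noteq> {}" by blast
  then have "Max ?S \<in> ?S" using finite_decomposition_sums by (rule Max_in[rotated])
  then show ?thesis using that unfolding decomp_max_def by auto
qed

section \<open>Brambles in k-trees\<close>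

text \<open>
  Connectedness of the subgraph induced on a vertex set, phrased through bipartitions, a form that
  suits the deletion of a vertex in the induction over \<open>k\<close>-trees.
\<close>

definition connected_in :: "'a set set \<Rightarrow> 'a set \<Rightarrow> bool" where
  "connected_in F b \<longleftrightarrow> b \<noteq> {} \<and>
     (\<forall>X Y. X \<union> Y = b \<and> X \<inter> Y = {} \<and> X \<noteq> {} \<and> Y \<noteq> {} \<longrightarrow> (\<exists>x\<in>X. \<exists>y\<in>Y. {x, y} \<in> F))"

definition touching :: "'a set set \<Rightarrow> 'a set \<Rightarrow> 'a set \<Rightarrow> bool" where
  "touching F b c \<longleftrightarrow> b \<inter> c \<noteq> {} \<or> (\<exists>x\<in>b. \<exists>y\<in>c. {x, y} \<in> F)"

lemma connected_inD:
  assumes "connected_in F b" "X \<union> Y = b" "X \<inter> Y = {}" "X \<noteq> {}" "Y \<noteq> {}"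
  obtains x y where "x \<in> X" "y \<in> Y" "{x, y} \<in> F"
  using assms unfolding connected_in_def by blast

lemma join_vertex_edges_subset:
  assumes "F \<subseteq> nsets V 2" "C \<subseteq> V" "v \<notin> V"
  shows "join_vertex v C F \<subseteq> nsets (insert v V) 2"
proof -
  have "nsets V 2 \<subseteq> nsets (insert v V) 2" by (rule nsets_mono) auto
  then show ?thesis using assms unfolding join_vertex_def by auto
qed

lemma k_tree_edges_subset:
  assumes "k_tree k V F"
  shows "finite V \<and> F \<subseteq> nsets V 2"
  using assms
proof (induction rule: k_tree.induct)
  case (start V)
  then show ?case using card.infinite by fastforce
next
  case (step V E C v)
  then show ?case using join_vertex_edges_subset[of E V C v] by (auto simp: is_clique_def)
qed

text \<open>
  The covering half of the duality between tree-width and brambles. Let \<open>v\<close> be the last vertex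
  of the \<open>k\<close>-tree, joined to the \<open>k\<close>-clique \<open>C\<close>. If \<open>{v}\<close> is a member of the bramble, all members
  touch it and hence meet \<open>C\<close> together with \<open>v\<close>. Otherwise \<open>v\<close> can be deleted from all members:
  whatever was connected or touching by way of \<open>v\<close> still is so, because the neighbours of \<open>v\<close> are
  pairwise adjacent.
\<close>

lemma k_tree_bramble_cover:
  assumes "k_tree k V F"
    and "\<And>b. b \<in> B \<Longrightarrow> b \<subseteq> V \<and> connected_in F b"
    and "\<And>b c. b \<in> B \<Longrightarrow> c \<in> B \<Longrightarrow> touching F b c"
  shows "\<exists>K \<subseteq> V. card K \<le> k + 1 \<and> (\<forall>b\<in>B. b \<inter> K \<noteq> {})"
  using assms
proof (induction arbitrary: B rule: k_tree.induct)
  case (start V)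
  then show ?case by (intro exI[of _ V]) (fastforce simp: connected_in_def)
next
  case (step V F C v)
  let ?F = "join_vertex v C F"
  have fin: "finite V" and FV: "F \<subseteq> nsets V 2"
    using k_tree_edges_subset[OF step.hyps(1)] by auto
  have CV: "C \<subseteq> V" and Ccl: "nsets C 2 \<subseteq> F"
    using step.hyps(2) by (auto simp: is_clique_def)
  have old: "{x, y} \<in> F" if "{x, y} \<in> ?F" "x \<noteq> v" "y \<noteq> v" for x y
    using that unfolding join_vertex_def by (auto simp: doubleton_eq_iff)
  have new: "y \<in> C" if "{v, y} \<in> ?F" for y
    using that FV \<open>v \<notin> V\<close> CV unfolding join_vertex_def
    by (auto simp: doubleton_eq_iff)
  have new': "y \<in> C" if "{y, v} \<in> ?F" for y
    using that new by (simp add: insert_commute)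
  show ?case
  proof (cases "{v} \<in> B")
    case True
    have "b \<inter> insert v C \<noteq> {}" if "b \<in> B" for b
      using step.prems(2)[OF True that] new unfolding touching_def by auto
    moreover have "card (insert v C) \<le> k + 1"
      using step.hyps(3) CV fin \<open>v \<notin> V\<close> finite_subset[OF CV fin] by (simp add: card_insert_if)
    ultimately show ?thesis using CV by (intro exI[of _ "insert v C"]) auto
  next
    case False
    define B' where "B' = (\<lambda>b. b - {v}) ` B"
    have ne: "b - {v} \<noteq> {}" if "b \<in> B" for b
    proof
      assume "b - {v} = {}"
      moreover have "b \<noteq> {}" using step.prems(1)[OF that] unfolding connected_in_def by auto
      ultimately have "b = {v}" by auto
      then show False using False that by simp
    qed
    \<comment> \<open>A member that contains \<open>v\<close> is connected and larger than \<open>{v}\<close>, so it also contains a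
    neighbour of \<open>v\<close>.\<close>
    have meets: "\<exists>y\<in>b - {v}. y \<in> C" if b: "b \<in> B" and v: "v \<in> b" for b
    proof -
      obtain x y where "x \<in> {v}" "y \<in> b - {v}" "{x, y} \<in> ?F"
        using connected_inD[of ?F b "{v}" "b - {v}"] step.prems(1)[OF b] ne[OF b] v by blast
      then show ?thesis using new by auto
    qed
    have adj: "y = z \<or> {y, z} \<in> F" if "y \<in> C" "z \<in> C" for y z
    proof (cases "y = z")
      case False
      then have "{y, z} \<in> nsets C 2" using that by simp
      then show ?thesis using Ccl by blast
    qed simp
    have "\<exists>K\<subseteq>V. card K \<le> k + 1 \<and> (\<forall>b\<in>B'. b \<inter> K \<noteq> {})"
    proof (rule step.IH)
      fix b' assume "b' \<in> B'"
      then obtain b where b: "b \<in> B" and b': "b' = b - {v}" unfolding B'_def by auto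
      have con: "connected_in ?F b" and sub: "b \<subseteq> insert v V" using step.prems(1)[OF b] by auto
      have "connected_in F b'" unfolding connected_in_def
      proof (intro conjI allI impI)
        show "b' \<noteq> {}" using ne[OF b] b' by simp
        fix X Y assume XY: "X \<union> Y = b' \<and> X \<inter> Y = {} \<and> X \<noteq> {} \<and> Y \<noteq> {}"
        then have nv: "v \<notin> X" "v \<notin> Y" using b' by auto
        show "\<exists>x\<in>X. \<exists>y\<in>Y. {x, y} \<in> F"
        proof (cases "v \<in> b")
          case True
          obtain x y where xy: "x \<in> insert v X" "y \<in> Y" "{x, y} \<in> ?F"
            using connected_inD[OF con, of "insert v X" Y] XY nv b' True by auto
          obtain x' y' where xy': "x' \<in> X" "y' \<in> insert v Y" "{x', y'} \<in> ?F"
            using connected_inD[OF con, of X "insert v Y"] XY nv b' True by auto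
          show ?thesis
          \<comment> \<open>The two edges come from putting \<open>v\<close> on either side of the bipartition. If both of them use
          \<open>v\<close>, their other ends lie in the clique \<open>C\<close>.\<close>
          proof (cases "x = v \<and> y' = v")
            case True
            then have "y \<in> C" "x' \<in> C" using xy xy' new new' by auto
            then show ?thesis using adj[of x' y] XY xy(2) xy'(1) by auto
          next
            case False
            then show ?thesis using old xy xy' nv by (metis insertE)
          qed
        next
          case False
          then obtain x y where "x \<in> X" "y \<in> Y" "{x, y} \<in> ?F"
            using connected_inD[OF con, of X Y] XY b' by auto
          then show ?thesis using old nv by metis
        qed
      qed
      then show "b' \<subseteq> V \<and> connected_in F b'" using sub b' by auto
    next
      fix b' c' assume "b' \<in> B'" "c' \<in> B'"
      then obtain b c where b: "b \<in> B" "b' = b - {v}" and c: "c \<in> B" "c' = c - {v}"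
        unfolding B'_def by auto
      show "touching F b' c'"
      proof (cases "v \<in> b \<and> v \<in> c")
        case True
        then obtain y z where "y \<in> b'" "y \<in> C" "z \<in> c'" "z \<in> C" using meets b c by metis
        then show ?thesis using adj[of y z] unfolding touching_def by auto
      next
        case False
        from step.prems(2)[OF b(1) c(1)] show ?thesis unfolding touching_def
        proof (elim disjE bexE)
          assume "b \<inter> c \<noteq> {}"
          then show "b' \<inter> c' \<noteq> {} \<or> (\<exists>x\<in>b'. \<exists>y\<in>c'. {x, y} \<in> F)" using False b c by auto
        next
          fix x y assume xy: "x \<in> b" "y \<in> c" "{x, y} \<in> ?F"
          consider "x \<noteq> v" "y \<noteq> v" | "x = v" "y \<noteq> v" | "x \<noteq> v" "y = v" using xy False by auto
          then show "b' \<inter> c' \<noteq> {} \<or> (\<exists>x\<in>b'. \<exists>y\<in>c'. {x, y} \<in> F)"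
          proof cases
            case 1 then show ?thesis using old xy b c by auto
          next
            case 2
            then obtain z where "z \<in> b'" "z \<in> C" using meets[of b] b xy by auto
            moreover have "y \<in> C" "y \<in> c'" using new xy 2 c by auto
            ultimately show ?thesis using adj[of z y] by auto
          next
            case 3
            then obtain z where "z \<in> c'" "z \<in> C" using meets[of c] c xy by auto
            moreover have "x \<in> C" "x \<in> b'" using new' xy 3 b by auto
            ultimately show ?thesis using adj[of x z] by auto
          qed
        qed
      qed
    qed
    then obtain K where "K \<subseteq> V" "card K \<le> k + 1" "\<forall>b\<in>B'. b \<inter> K \<noteq> {}" by auto
    moreover have "b \<inter> K \<noteq> {}" if "b \<in> B" for b
    proof -
      have "(b - {v}) \<inter> K \<noteq> {}"
        using \<open>\<forall>b\<in>B'. b \<inter> K \<noteq> {}\<close> that unfolding B'_def by simp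
      then show ?thesis by auto
    qed
    ultimately show ?thesis by (intro exI[of _ K]) auto
  qed
qed

text \<open>
  The connected subsets of \<open>W\<close> with at least \<open>t\<close> elements touch pairwise, since disjoint ones are
  joined by an edge. A cover of this bramble with \<open>k + 1\<close> vertices leaves a set \<open>U\<close> without
  connected subsets of size \<open>t\<close>. If \<open>U\<close> had \<open>3t\<close> elements, a union of its components would have
  between \<open>t\<close> and \<open>2t\<close> elements, with no edge to the at least \<open>t\<close> remaining ones.
\<close>

lemma k_tree_width_bihole:
  assumes tree: "k_tree k V F" and WV: "W \<subseteq> V" and t: "t \<ge> 1"
    and dense: "\<And>A B. A \<subseteq> W \<Longrightarrow> B \<subseteq> W \<Longrightarrow> A \<inter> B = {} \<Longrightarrow> t \<le> card A \<Longrightarrow> t \<le> card B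
      \<Longrightarrow> \<exists>x\<in>A. \<exists>y\<in>B. {x, y} \<in> F"
  shows "card W < 3 * t + k + 1"
proof (rule ccontr)
  assume big: "\<not> card W < 3 * t + k + 1"
  have finW: "finite W" using k_tree_edges_subset[OF tree] WV finite_subset by auto
  define B where "B = {b. b \<subseteq> W \<and> connected_in F b \<and> t \<le> card b}"
  have "\<exists>K \<subseteq> V. card K \<le> k + 1 \<and> (\<forall>b\<in>B. b \<inter> K \<noteq> {})"
  proof (rule k_tree_bramble_cover[OF tree])
    show "b \<subseteq> V \<and> connected_in F b" if "b \<in> B" for b using that WV unfolding B_def by auto
    show "touching F b c" if "b \<in> B" "c \<in> B" for b c
      using that dense[of b c] unfolding B_def touching_def by auto
  qed
  then obtain K where K: "K \<subseteq> V" "card K \<le> k + 1" "\<And>b. b \<in> B \<Longrightarrow> b \<inter> K \<noteq> {}" by auto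
  define U where "U = W - K"
  have finK: "finite K" using k_tree_edges_subset[OF tree] K(1) finite_subset by auto
  have U3: "3 * t \<le> card U"
    using big K(2) diff_card_le_card_Diff[OF finK, of W] unfolding U_def by linarith
  \<comment> \<open>A smallest union of components of \<open>U\<close> with at least \<open>t\<close> elements takes the place of adding
  up components greedily: it splits into two smaller unions, both below \<open>t\<close>.\<close>
  define sep where "sep A \<longleftrightarrow> A \<subseteq> U \<and> t \<le> card A \<and> (\<forall>x\<in>A. \<forall>y\<in>U - A. {x, y} \<notin> F)" for A
  have "sep U" using U3 t unfolding sep_def by auto
  then obtain A where A: "sep A" and min: "\<And>A'. sep A' \<Longrightarrow> card A \<le> card A'"
    using arg_min_nat_lemma[of sep U card] by metis
  have finA: "finite A" using A finW finite_subset unfolding sep_def U_def by blast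
  have "\<not> connected_in F A"
    using K(3)[of A] A unfolding B_def sep_def U_def by auto
  moreover have "A \<noteq> {}" using A t unfolding sep_def by auto
  ultimately obtain X Y where XY: "X \<union> Y = A" "X \<inter> Y = {}" "X \<noteq> {}" "Y \<noteq> {}"
    and no: "\<And>x y. x \<in> X \<Longrightarrow> y \<in> Y \<Longrightarrow> {x, y} \<notin> F"
    unfolding connected_in_def by blast
  have fin: "finite X" "finite Y" using finA XY by (auto intro: finite_subset)
  have cA: "card A = card X + card Y" using card_Un_disjoint[of X Y] fin XY by simp
  have pos: "card X > 0" "card Y > 0" using fin XY by (auto simp: card_gt_0_iff)
  have sX: "card X < t"
  proof (rule ccontr)
    assume c: "\<not> card X < t"
    have "\<forall>x\<in>X. \<forall>y\<in>U - X. {x, y} \<notin> F"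
      using A XY(1) no unfolding sep_def by blast
    then have "sep X" using c A XY unfolding sep_def by auto
    then show False using min[of X] cA pos by simp
  qed
  have sY: "card Y < t"
  proof (rule ccontr)
    assume c: "\<not> card Y < t"
    have no': "{y, x} \<notin> F" if "x \<in> X" "y \<in> Y" for x y
      using no that by (simp add: insert_commute)
    have "\<forall>x\<in>Y. \<forall>y\<in>U - Y. {x, y} \<notin> F"
      using A XY(1) no' unfolding sep_def by blast
    then have "sep Y" using c A XY unfolding sep_def by auto
    then show False using min[of Y] cA pos by simp
  qed
  have "card (U - A) = card U - card A"
    using A finA card_Diff_subset unfolding sep_def by blast
  then have "t \<le> card (U - A)" using U3 cA sX sY by linarith
  moreover have "A \<subseteq> W" "U - A \<subseteq> W" using A unfolding sep_def U_def by auto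
  ultimately have "\<exists>x\<in>A. \<exists>y\<in>U - A. {x, y} \<in> F"
    using A by (intro dense) (auto simp: sep_def)
  then show False using A unfolding sep_def by auto
qed

lemma two_sided_k_tree_imp_k_tree: "two_sided_k_tree k V E \<Longrightarrow> k_tree k V E"
proof -
  have "two_sided_k_tree_used k V E S \<Longrightarrow> k_tree k V E" for S
    by (induction rule: two_sided_k_tree_used.induct) (auto intro: k_tree.intros)
  then show "two_sided_k_tree k V E \<Longrightarrow> k_tree k V E" unfolding two_sided_k_tree_def by auto
qed

lemma is_clique_subset: "is_clique V E K \<Longrightarrow> C \<subseteq> K \<Longrightarrow> is_clique V E C"
  unfolding is_clique_def using nsets_mono[of C K 2] by blast

lemma linear_k_tree_imp_k_tree: "linear_k_tree k V E \<Longrightarrow> k_tree k V E"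
proof -
  have "linear_k_tree_last k V E l \<Longrightarrow> k_tree k V E" for l
  proof (induction rule: linear_k_tree_last.induct)
    case (step V E l K C v)
    then show ?case using is_clique_subset[of V E K C]
      by (intro k_tree.step) (auto simp: maximal_clique_def facet_of_def)
  qed (rule k_tree.start)
  then show "linear_k_tree k V E \<Longrightarrow> k_tree k V E" unfolding linear_k_tree_def by auto
qed

lemma k_caterpillar_imp_k_tree: "k_caterpillar k V E \<Longrightarrow> k_tree k V E"
proof -
  have "k_caterpillar_last k V E K \<Longrightarrow> k_tree k V E \<and> is_clique V E K" for K
  proof (induction rule: k_caterpillar_last.induct)
    case (start V)
    then show ?case by (auto intro: k_tree.start simp: is_clique_def)
  next
    case (step V E K C v)
    have C: "is_clique V E C" "card C = k"
      using step is_clique_subset[of V E K C] by (auto simp: facet_of_def)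
    have "{x, y} \<in> join_vertex v C E" if "x \<in> insert v C" "y \<in> insert v C" "x \<noteq> y" for x y
    proof -
      have "{x, y} \<in> E" if "x \<in> C" "y \<in> C"
      proof -
        have "{x, y} \<in> nsets C 2" using that \<open>x \<noteq> y\<close> by simp
        then show ?thesis using C(1) unfolding is_clique_def by blast
      qed
      then show ?thesis using that unfolding join_vertex_def by (auto simp: insert_commute)
    qed
    then have "nsets (insert v C) 2 \<subseteq> join_vertex v C E" by (auto elim!: nsets2_E)
    then show ?case using C step by (auto intro: k_tree.step simp: is_clique_def)
  qed
  then show "k_caterpillar k V E \<Longrightarrow> k_tree k V E" unfolding k_caterpillar_def by auto
qed

section \<open>Random colourings have no large bipartite holes\<close>

definition hole_free :: "nat \<Rightarrow> nat \<Rightarrow> nat set set \<Rightarrow> bool" where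
  "hole_free n t E \<longleftrightarrow> (\<forall>A B. A \<subseteq> {..<n} \<longrightarrow> B \<subseteq> {..<n} \<longrightarrow> A \<inter> B = {} \<longrightarrow> t \<le> card A \<longrightarrow> t \<le> card B
     \<longrightarrow> (\<exists>x\<in>A. \<exists>y\<in>B. {x, y} \<in> E))"

text \<open>
  Colourings that avoid a colour on all edges between two sets are counted edge by edge, so
  distinct pairs of ends have to give distinct edges.
\<close>

lemma card_cut:
  assumes "A \<inter> B = {}"
  shows "card ((\<lambda>(x, y). {x, y}) ` (A \<times> B)) = card A * card B"
proof -
  have "inj_on (\<lambda>(x, y). {x, y}) (A \<times> B)"
    using assms unfolding inj_on_def by (auto simp: doubleton_eq_iff)
  then show ?thesis by (simp add: card_image card_cartesian_product)
qed

text \<open>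
  The union bound: there are at most \<open>r 4\<^sup>n\<close> triples of a colour and two disjoint \<open>t\<close>-sets, and the
  proportion of colourings that avoid the colour between the two sets is \<open>((r - 1)/r)\<close> to the power
  \<open>t\<^sup>2\<close>.
\<close>

lemma exists_hole_free_decomposition:
  assumes r: "r > 0" and few: "r * 4 ^ n * (r - 1) ^ (t\<^sup>2) < r ^ (t\<^sup>2)"
  shows "\<exists>Es. decomposition r n Es \<and> (\<forall>i<r. hole_free n t (Es i))"
proof -
  define T where "T = nsets {..<n} 2"
  define cut where "cut A B = (\<lambda>(x, y). {x, y}) ` (A \<times> B)" for A B :: "nat set"
  define P where "P = {..<r} \<times> {(A, B). A \<subseteq> {..<n} \<and> B \<subseteq> {..<n} \<and> A \<inter> B = {} \<and> card A = t \<and> card B = t}"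
  define bad where "bad = (\<lambda>(i, A, B). PiE T (\<lambda>e. if e \<in> cut A B then {..<r} - {i} else {..<r}))"
  have finT: "finite T" unfolding T_def by (simp add: finite_imp_finite_nsets)
  have Psub: "P \<subseteq> {..<r} \<times> (Pow {..<n} \<times> Pow {..<n})" unfolding P_def by auto
  have finP: "finite P" using Psub by (rule finite_subset) simp
  have "card P \<le> card ({..<r} \<times> (Pow {..<n} \<times> Pow {..<n}))" using Psub by (intro card_mono) auto
  also have "\<dots> = r * 4 ^ n"
    by (simp add: card_cartesian_product card_Pow power_mult_distrib[symmetric])
  finally have cP: "card P \<le> r * 4 ^ n" .
  have cutT: "cut A B \<subseteq> T \<and> card (cut A B) = t\<^sup>2" if "(i, A, B) \<in> P" for i A B
    using that card_cut[of A B] unfolding P_def cut_def T_def by (auto simp: power2_eq_square)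
  have cbad: "card (bad p) = (r - 1) ^ (t\<^sup>2) * r ^ (card T - t\<^sup>2)" if p: "p \<in> P" for p
  proof -
    obtain i A B where pe: "p = (i, A, B)" by (cases p) auto
    have i: "i < r" using p pe unfolding P_def by auto
    note c = cutT[OF p[unfolded pe]]
    let ?w = "\<lambda>e. card (if e \<in> cut A B then {..<r} - {i} else {..<r})"
    have "card (bad p) = (\<Prod>e\<in>T. ?w e)" unfolding pe bad_def by (simp add: card_PiE[OF finT])
    also have "\<dots> = (\<Prod>e\<in>T - cut A B. ?w e) * (\<Prod>e\<in>cut A B. ?w e)"
      using c finT by (intro prod.subset_diff) auto
    also have "(\<Prod>e\<in>T - cut A B. ?w e) = r ^ (card T - t\<^sup>2)"
      using c finite_subset[OF conjunct1[OF c] finT] by (simp add: card_Diff_subset)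
    also have "(\<Prod>e\<in>cut A B. ?w e) = (r - 1) ^ (t\<^sup>2)" using c i by simp
    finally show ?thesis by simp
  qed
  have "\<not> PiE T (\<lambda>_. {..<r}) \<subseteq> (\<Union>p\<in>P. bad p)"
  proof
    assume sub: "PiE T (\<lambda>_. {..<r}) \<subseteq> (\<Union>p\<in>P. bad p)"
    have finbad: "finite (bad p)" for p
      unfolding bad_def by (auto intro!: finite_PiE finT split: prod.splits)
    have "r ^ card T = card (PiE T (\<lambda>_. {..<r}))" by (simp add: card_PiE[OF finT])
    also have "\<dots> \<le> card (\<Union>p\<in>P. bad p)" using finP finbad sub by (intro card_mono) auto
    also have "\<dots> \<le> (\<Sum>p\<in>P. card (bad p))" by (rule card_UN_le[OF finP])
    also have "\<dots> = card P * ((r - 1) ^ (t\<^sup>2) * r ^ (card T - t\<^sup>2))" using cbad by simp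
    finally have le: "r ^ card T \<le> card P * ((r - 1) ^ (t\<^sup>2) * r ^ (card T - t\<^sup>2))" .
    then have "card P \<noteq> 0" using r by (cases "card P = 0") auto
    then obtain i A B where "(i, A, B) \<in> P" by (metis card.empty ex_in_conv prod_cases3)
    then have "t\<^sup>2 \<le> card T" using cutT card_mono[OF finT] by metis
    then have "r ^ card T = r ^ (t\<^sup>2) * r ^ (card T - t\<^sup>2)" by (simp flip: power_add)
    then have "r ^ (t\<^sup>2) * r ^ (card T - t\<^sup>2) \<le> (card P * (r - 1) ^ (t\<^sup>2)) * r ^ (card T - t\<^sup>2)"
      using le by (simp add: mult.assoc)
    then have "r ^ (t\<^sup>2) \<le> card P * (r - 1) ^ (t\<^sup>2)" using r by simp
    also have "\<dots> \<le> r * 4 ^ n * (r - 1) ^ (t\<^sup>2)" using cP by (rule mult_right_mono) simp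
    finally show False using few by simp
  qed
  then obtain f where f: "f \<in> PiE T (\<lambda>_. {..<r})" and nb: "\<And>p. p \<in> P \<Longrightarrow> f \<notin> bad p" by auto
  define Es where "Es i = {e \<in> T. f e = i}" for i
  have "decomposition r n Es"
    using f unfolding decomposition_def disjoint_family_on_def Es_def T_def by (fastforce simp: PiE_iff)
  moreover have "hole_free n t (Es i)" if i: "i < r" for i
    unfolding hole_free_def
  proof (intro allI impI)
    fix A B assume *: "A \<subseteq> {..<n}" "B \<subseteq> {..<n}" "A \<inter> B = {}" "t \<le> card A" "t \<le> card B"
    obtain A' B' where A': "A' \<subseteq> A" "card A' = t" and B': "B' \<subseteq> B" "card B' = t"
      using obtain_subset_with_card_n[OF *(4)] obtain_subset_with_card_n[OF *(5)] by metis
    have "(i, A', B') \<in> P" using i * A' B' unfolding P_def by auto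
    then have "f \<notin> bad (i, A', B')" and "cut A' B' \<subseteq> T" using nb cutT by auto
    then obtain e where "e \<in> cut A' B'" "e \<in> T" "f e = i"
      using f unfolding bad_def by (auto simp: PiE_iff split: if_splits)
    then show "\<exists>x\<in>A. \<exists>y\<in>B. {x, y} \<in> Es i" using A' B' unfolding cut_def Es_def by auto
  qed
  ultimately show ?thesis by auto
qed

lemma exists_sqrt_hole_free_decomposition:
  assumes r: "r \<ge> 2"
  shows "\<exists>c. \<forall>n\<ge>r. \<exists>Es. decomposition r n Es \<and>
     (\<forall>i<r. hole_free n (nat \<lceil>sqrt (real (c * n))\<rceil>) (Es i))"
proof -
  define q where "q = (real r - 1) / real r"
  have q: "0 \<le> q" "q < 1" using r unfolding q_def by auto
  \<comment> \<open>The factor \<open>1/8\<close> beats the \<open>4\<^sup>n\<close> pairs of sets with a factor \<open>2\<^sup>n > r\<close> to spare.\<close>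
  obtain c where c: "q ^ c < 1 / 8" using real_arch_pow_inv[of "1/8" q] q by auto
  have "\<exists>Es. decomposition r n Es \<and> (\<forall>i<r. hole_free n (nat \<lceil>sqrt (real (c * n))\<rceil>) (Es i))"
    if n: "n \<ge> r" for n
  proof (rule exists_hole_free_decomposition)
    define t where "t = nat \<lceil>sqrt (real (c * n))\<rceil>"
    show "r > 0" using r by simp
    have "sqrt (real (c * n)) \<le> real t" unfolding t_def by (rule real_nat_ceiling_ge)
    then have "real (c * n) \<le> (real t)\<^sup>2" using sqrt_le_D by blast
    then have "c * n \<le> t\<^sup>2" by (metis of_nat_le_iff of_nat_power)
    then have "q ^ (t\<^sup>2) \<le> q ^ (c * n)" using q by (intro power_decreasing) auto
    also have "\<dots> \<le> (1 / 8) ^ n" unfolding power_mult using c q by (intro power_mono) auto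
    finally have "real r * 4 ^ n * q ^ (t\<^sup>2) \<le> real r * 4 ^ n * (1 / 8) ^ n"
      using r by (intro mult_left_mono) auto
    also have "\<dots> = real r * (4 * (1 / 8)) ^ n" unfolding power_mult_distrib by simp
    also have "\<dots> = real r / 2 ^ n" by (simp add: power_divide)
    also have "\<dots> < 1"
    proof -
      have "r < 2 ^ n" using n less_exp[of n] by linarith
      then have "real r < 2 ^ n" by (metis of_nat_less_iff of_nat_numeral of_nat_power)
      then show ?thesis by simp
    qed
    finally have "real r * 4 ^ n * q ^ (t\<^sup>2) < 1" .
    moreover have "q ^ (t\<^sup>2) = (real r - 1) ^ (t\<^sup>2) / real r ^ (t\<^sup>2)"
      unfolding q_def by (simp add: power_divide)
    ultimately have "real r * 4 ^ n * (real r - 1) ^ (t\<^sup>2) < real r ^ (t\<^sup>2)"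
      using r by (simp add: field_simps)
    moreover have "real r - 1 = real (r - 1)" using r by simp
    ultimately have "real (r * 4 ^ n * (r - 1) ^ (t\<^sup>2)) < real (r ^ (t\<^sup>2))"
      by (simp only: of_nat_mult of_nat_power of_nat_numeral)
    then show "r * 4 ^ n * (r - 1) ^ (nat \<lceil>sqrt (real (c * n))\<rceil>)\<^sup>2
      < r ^ (nat \<lceil>sqrt (real (c * n))\<rceil>)\<^sup>2"
      unfolding t_def[symmetric] by (rule of_nat_less_imp_less)
  qed
  then show ?thesis by blast
qed

section \<open>The width parameters\<close>

lemma least_width_le:
  assumes start: "\<And>k V. card V = k + 1 \<Longrightarrow> P k V (nsets V 2)"
    and E: "E \<subseteq> nsets {..<n} 2"
  shows "least_width P n E \<le> n"
proof (cases "E = {}")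
  case False
  then have "n \<ge> 2" using E nsets_eq_empty[of "{..<n}" 2] by (cases "n < 2") auto
  then have "P (n - 1) {..<n} (nsets {..<n} 2)" by (intro start) simp
  then have "(LEAST k. k \<ge> 1 \<and> (\<exists>V F. P k V F \<and> {..<n} \<subseteq> V \<and> E \<subseteq> F)) \<le> n - 1"
    using E \<open>n \<ge> 2\<close> by (intro Least_le) auto
  then show ?thesis using False unfolding least_width_def by simp
qed (simp add: least_width_def)

lemma least_width_ge:
  assumes start: "\<And>k V. card V = k + 1 \<Longrightarrow> P k V (nsets V 2)"
    and tree: "\<And>k V F. P k V F \<Longrightarrow> k_tree k V F"
    and E: "E \<subseteq> nsets {..<n} 2" and hole: "hole_free n t E"
  shows "n \<le> least_width P n E + 3 * t"
proof -
  have t: "t \<ge> 1"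
  proof (rule ccontr)
    assume "\<not> t \<ge> 1"
    then show False using hole[unfolded hole_free_def, rule_format, of "{}" "{}"] by simp
  qed
  show ?thesis
  proof (cases "E = {}")
    case True
    have "n < 2 * t"
    proof (rule ccontr)
      assume "\<not> n < 2 * t"
      then have "\<exists>x\<in>{..<t}. \<exists>y\<in>{t..<2*t}. {x, y} \<in> E"
        by (intro hole[unfolded hole_free_def, rule_format]) auto
      then show False using True by simp
    qed
    then show ?thesis by simp
  next
    case False
    then have "n \<ge> 2" using E nsets_eq_empty[of "{..<n}" 2] by (cases "n < 2") auto
    let ?Q = "\<lambda>k. k \<ge> 1 \<and> (\<exists>V F. P k V F \<and> {..<n} \<subseteq> V \<and> E \<subseteq> F)"
    have "P (n - 1) {..<n} (nsets {..<n} 2)" using \<open>n \<ge> 2\<close> by (intro start) simp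
    then have "?Q (n - 1)" using E \<open>n \<ge> 2\<close> by auto
    then have "?Q (LEAST k. ?Q k)" by (rule LeastI)
    then obtain V F where VF: "k_tree (LEAST k. ?Q k) V F" "{..<n} \<subseteq> V" "E \<subseteq> F" using tree by blast
    have "card {..<n} < 3 * t + (LEAST k. ?Q k) + 1"
    proof (rule k_tree_width_bihole[OF VF(1,2) t])
      fix A B assume *: "A \<subseteq> {..<n}" "B \<subseteq> {..<n}" "A \<inter> B = {}" "t \<le> card A" "t \<le> card B"
      show "\<exists>x\<in>A. \<exists>y\<in>B. {x, y} \<in> F"
        using hole[unfolded hole_free_def, rule_format, OF *] VF(3) by blast
    qed
    then show ?thesis using False unfolding least_width_def by simp
  qed
qed

text \<open>
  The hypotheses are all that the four width parameters share: cliques belong to the class of host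
  graphs, and the host graphs are \<open>k\<close>-trees.
\<close>

theorem width_decomp_max_limit:
  assumes start: "\<And>k V. card V = k + 1 \<Longrightarrow> P k V (nsets V 2)"
    and tree: "\<And>k V F. P k V F \<Longrightarrow> k_tree k V F"
    and r: "r \<ge> 2"
  shows "(\<lambda>n. real (decomp_max (least_width P) r n) / real n) \<longlonglongrightarrow> real r"
proof -
  obtain c where c: "\<And>n. n \<ge> r \<Longrightarrow> \<exists>Es. decomposition r n Es \<and>
     (\<forall>i<r. hole_free n (nat \<lceil>sqrt (real (c * n))\<rceil>) (Es i))"
    using exists_sqrt_hole_free_decomposition[OF r] by blast
  let ?a = "\<lambda>n. real (decomp_max (least_width P) r n) / real n"
  have upper: "?a n \<le> real r" if n: "n \<ge> r" for n
  proof -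
    obtain Es where Es: "decomposition r n Es"
      and eq: "decomp_max (least_width P) r n = (\<Sum>i<r. least_width P n (Es i))"
      using decomp_max_attained[of r n "least_width P"] r by auto
    have "(\<Sum>i<r. least_width P n (Es i)) \<le> (\<Sum>i<r. n)"
      using decomposition_subset[OF Es] by (intro sum_mono least_width_le start) auto
    then have "real (decomp_max (least_width P) r n) \<le> real (r * n)" unfolding eq of_nat_le_iff by simp
    then show ?thesis using n r by (simp add: divide_le_eq)
  qed
  have lower: "real r - 3 * real r * sqrt (real c) * (sqrt (real n) / real n) - 3 * real r / real n \<le> ?a n"
    if n: "n \<ge> r" for n
  proof -
    define t where "t = nat \<lceil>sqrt (real (c * n))\<rceil>"
    obtain Es where Es: "decomposition r n Es" "\<And>i. i < r \<Longrightarrow> hole_free n t (Es i)"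
      using c[OF n] unfolding t_def by blast
    have "r * n = (\<Sum>i<r. n)" by simp
    also have "\<dots> \<le> (\<Sum>i<r. least_width P n (Es i) + 3 * t)"
      using decomposition_subset[OF Es(1)] Es(2) by (intro sum_mono least_width_ge start tree) auto
    also have "\<dots> = (\<Sum>i<r. least_width P n (Es i)) + r * (3 * t)" by (simp add: sum.distrib)
    also have "\<dots> \<le> decomp_max (least_width P) r n + r * (3 * t)"
      using decomp_max_ge[OF Es(1)] by simp
    finally have "real (r * n) \<le> real (decomp_max (least_width P) r n + r * (3 * t))"
      unfolding of_nat_le_iff .
    then have "real r * real n \<le> real (decomp_max (least_width P) r n) + 3 * real r * real t" by simp
    moreover have "real t \<le> sqrt (real c) * sqrt (real n) + 1"
    proof -
      have "0 \<le> sqrt (real c) * sqrt (real n)" by simp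
      then have "real t = of_int \<lceil>sqrt (real c) * sqrt (real n)\<rceil>"
        unfolding t_def of_nat_mult real_sqrt_mult by (intro of_nat_nat) linarith
      then show ?thesis using of_int_ceiling_le_add_one by metis
    qed
    then have "3 * real r * real t \<le> 3 * real r * (sqrt (real c) * sqrt (real n) + 1)"
      by (intro mult_left_mono) auto
    ultimately have *: "real r * real n - 3 * real r * (sqrt (real c) * sqrt (real n) + 1)
      \<le> real (decomp_max (least_width P) r n)" by linarith
    have n0: "real n > 0" using n r by simp
    have "(real r - 3 * real r * sqrt (real c) * (sqrt (real n) / real n) - 3 * real r / real n) * real n
      = real r * real n - 3 * real r * (sqrt (real c) * sqrt (real n) + 1)"
      using n0 by (simp add: algebra_simps)
    then show ?thesis using * n0 by (simp add: pos_le_divide_eq)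
  qed
  show ?thesis
  proof (rule tendsto_sandwich[OF _ _ _ tendsto_const])
    show "\<forall>\<^sub>F n in sequentially. real r - 3 * real r * sqrt (real c) * (sqrt (real n) / real n)
      - 3 * real r / real n \<le> ?a n"
      unfolding eventually_at_top_linorder using lower by blast
    show "\<forall>\<^sub>F n in sequentially. ?a n \<le> real r"
      unfolding eventually_at_top_linorder using upper by blast
    have "(\<lambda>n::nat. sqrt (real n) / real n) \<longlonglongrightarrow> 0" by real_asymp
    moreover have "(\<lambda>n::nat. 3 * real r / real n) \<longlonglongrightarrow> 0" by real_asymp
    ultimately have "(\<lambda>n. real r - 3 * real r * sqrt (real c) * (sqrt (real n) / real n)
      - 3 * real r / real n) \<longlonglongrightarrow> real r - 3 * real r * sqrt (real c) * 0 - 0"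
      by (intro tendsto_intros)
    then show "(\<lambda>n. real r - 3 * real r * sqrt (real c) * (sqrt (real n) / real n)
      - 3 * real r / real n) \<longlonglongrightarrow> real r" by simp
  qed
qed

section \<open>Kernels of matrices\<close>

text \<open>
  Stated for arbitrary finite index sets, as it is applied to systems whose equations are indexed by
  vertices, edges and pairs.
\<close>

lemma homogeneous_system_nontrivial_solution:
  fixes f :: "'i \<Rightarrow> 'j \<Rightarrow> 'a :: field"
  assumes "finite I" "finite J" "card I < card J"
  shows "\<exists>c. (\<exists>j\<in>J. c j \<noteq> 0) \<and> (\<forall>i\<in>I. (\<Sum>j\<in>J. f i j * c j) = 0)"
  using assms
proof (induction I arbitrary: J f rule: finite_induct)
  case empty
  then have "J \<noteq> {}" by auto
  then show ?case by (intro exI[of _ "\<lambda>_. 1"]) auto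
next
  case (insert i I)
  show ?case
  proof (cases "\<forall>j\<in>J. f i j = 0")
    case True
    obtain c where "\<exists>j\<in>J. c j \<noteq> 0" "\<forall>i\<in>I. (\<Sum>j\<in>J. f i j * c j) = 0"
      using insert.IH[of J f] insert.prems insert.hyps by auto
    then show ?thesis using True by (intro exI[of _ c]) auto
  next
    case False
    then obtain p where p: "p \<in> J" "f i p \<noteq> 0" by auto
    \<comment> \<open>Gaussian elimination of the unknown \<open>p\<close> by means of equation \<open>i\<close>.\<close>
    define g where "g i' j = f i' j - f i' p * f i j / f i p" for i' j
    have "card I < card (J - {p})" using insert.prems insert.hyps p by simp
    then obtain c where c: "\<exists>j\<in>J - {p}. c j \<noteq> 0"
      and z: "\<forall>i'\<in>I. (\<Sum>j\<in>J - {p}. g i' j * c j) = 0"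
      using insert.IH[of "J - {p}" g] insert.prems by auto
    define s where "s = (\<Sum>j\<in>J - {p}. f i j * c j)"
    define d where "d = c(p := - s / f i p)"
    have split: "(\<Sum>j\<in>J. h j * d j) = (\<Sum>j\<in>J - {p}. h j * c j) - h p * s / f i p" for h
    proof -
      have "(\<Sum>j\<in>J. h j * d j) = h p * d p + (\<Sum>j\<in>J - {p}. h j * d j)"
        using insert.prems p by (intro sum.remove) auto
      also have "(\<Sum>j\<in>J - {p}. h j * d j) = (\<Sum>j\<in>J - {p}. h j * c j)"
        by (intro sum.cong) (auto simp: d_def)
      finally show ?thesis by (simp add: d_def)
    qed
    have "(\<Sum>j\<in>J. f i j * d j) = 0" unfolding split using p by (simp add: s_def)
    moreover have "(\<Sum>j\<in>J. f i' j * d j) = 0" if "i' \<in> I" for i'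
    proof -
      have "(\<Sum>j\<in>J - {p}. g i' j * c j)
        = (\<Sum>j\<in>J - {p}. f i' j * c j - f i' p / f i p * (f i j * c j))"
        unfolding g_def by (intro sum.cong) (auto simp: algebra_simps)
      also have "\<dots> = (\<Sum>j\<in>J - {p}. f i' j * c j) - f i' p / f i p * s"
        unfolding s_def by (simp add: sum_subtractf sum_distrib_left)
      finally show ?thesis unfolding split using z that by simp
    qed
    moreover have "\<exists>j\<in>J. d j \<noteq> 0" using c unfolding d_def by auto
    ultimately show ?thesis by auto
  qed
qed

lemma mult_mat_vec_index:
  assumes "A \<in> carrier_mat n n" "i < n"
  shows "(A *\<^sub>v vec n f) $ i = (\<Sum>j<n. A $$ (i, j) * f j)"
  using assms by (auto simp: scalar_prod_def row_def atLeast0LessThan intro!: sum.cong)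

text \<open>
  A basis of the kernel as a family of functions. Sums over index ranges replace
  linear combinations of sets of vectors from here on.
\<close>

lemma kernel_family_exists:
  fixes A :: "real mat"
  assumes A: "A \<in> carrier_mat n n"
  obtains b :: "nat \<Rightarrow> nat \<Rightarrow> real"
    where "\<And>a i. a < kernel_dim A \<Longrightarrow> i < n \<Longrightarrow> (\<Sum>j<n. A $$ (i, j) * b a j) = 0"
      and "\<And>c a. \<forall>i<n. (\<Sum>a<kernel_dim A. c a * b a i) = 0 \<Longrightarrow> a < kernel_dim A \<Longrightarrow> c a = 0"
proof -
  interpret kernel n n A by unfold_locales (rule A)
  obtain B where B: "finite B" "basis B" using kernel_basis_exists[OF A] by auto
  have dim: "kernel_dim A = card B" using Ker.dim_basis[OF B] by simp
  have BK: "B \<subseteq> mat_kernel A" and li: "lin_indpt B" using B(2) unfolding Ker.basis_def by auto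
  obtain h where h: "bij_betw h {..<card B} B"
    using ex_bij_betw_nat_finite[OF B(1)] atLeast0LessThan by metis
  define b where "b a j = h a $ j" for a j
  have vec: "vec n (b a) = h a" "A *\<^sub>v h a = 0\<^sub>v n" if "a < card B" for a
  proof -
    have "h a \<in> mat_kernel A" using h BK that unfolding bij_betw_def by auto
    from mat_kernelD[OF A this] show "vec n (b a) = h a" "A *\<^sub>v h a = 0\<^sub>v n"
      unfolding b_def by auto
  qed
  have ker: "(\<Sum>j<n. A $$ (i, j) * b a j) = 0" if "a < card B" "i < n" for a i
    using mult_mat_vec_index[OF A that(2), of "b a"] vec[OF that(1)] that by simp
  have ind: "c a = 0"
    if z: "\<forall>i<n. (\<Sum>a<card B. c a * b a i) = 0" and a: "a < card B" for c a
  proof (rule ccontr)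
    assume ca: "c a \<noteq> 0"
    define g where "g v = c (the_inv_into {..<card B} h v)" for v
    have gh: "g (h a) = c a" if "a < card B" for a
      unfolding g_def using h that by (simp add: bij_betw_def the_inv_into_f_f)
    have "lincomb g B = 0\<^sub>v n"
    proof (rule eq_vecI)
      have "lincomb g B \<in> mat_kernel A" using Ker.lincomb_closed[OF BK] by simp
      then show "dim_vec (lincomb g B) = dim_vec (0\<^sub>v n)" using mat_kernelD(1)[OF A] by auto
      fix i assume "i < dim_vec (0\<^sub>v n :: real vec)"
      then have i: "i < n" by simp
      have "lincomb g B $ i = (\<Sum>v\<in>B. g v * v $ i)" by (rule lincomb_index[OF i BK])
      also have "\<dots> = (\<Sum>a<card B. g (h a) * h a $ i)"
        by (rule sum.reindex_bij_betw[OF h, symmetric])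
      also have "\<dots> = (\<Sum>a<card B. c a * b a i)" unfolding b_def by (intro sum.cong) (auto simp: gh)
      finally show "lincomb g B $ i = 0\<^sub>v n $ i" using z i by simp
    qed
    moreover have "h a \<in> B" using h a unfolding bij_betw_def by auto
    moreover have "g (h a) \<noteq> 0" using ca gh[OF a] by simp
    ultimately have "lin_dep B" unfolding Ker.lin_dep_def using B(1)
      by (intro exI[of _ B] exI[of _ g] exI[of _ "h a"]) simp
    then show False using li by simp
  qed
  show ?thesis using ker ind unfolding dim[symmetric] by (rule that[of b])
qed

lemma kernel_dim_ge:
  fixes A :: "real mat"
  assumes A: "A \<in> carrier_mat n n"
    and ker: "\<And>a i. a < q \<Longrightarrow> i < n \<Longrightarrow> (\<Sum>j<n. A $$ (i, j) * b a j) = 0"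
    and ind: "\<And>c a. (\<And>i. i < n \<Longrightarrow> (\<Sum>a<q. c a * b a i) = 0) \<Longrightarrow> a < q \<Longrightarrow> c a = 0"
  shows "q \<le> kernel_dim A"
proof -
  interpret kernel n n A by unfold_locales (rule A)
  define h where "h a = vec n (b a)" for a
  have inj: "inj_on h {..<q}"
  proof (rule inj_onI, rule ccontr)
    fix x y assume xy: "x \<in> {..<q}" "y \<in> {..<q}" "h x = h y" "x \<noteq> y"
    define c where "c a = (if a = x then 1 else if a = y then -1 else 0 :: real)" for a
    have "c x = 0"
    proof (rule ind)
      fix i assume i: "i < n"
      have "b x i = b y i" using arg_cong[OF xy(3), of "\<lambda>v. v $ i"] i unfolding h_def by simp
      have "(\<Sum>a<q. c a * b a i) = (\<Sum>a\<in>{x, y}. c a * b a i)"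
        using xy by (intro sum.mono_neutral_right) (auto simp: c_def)
      then show "(\<Sum>a<q. c a * b a i) = 0" using xy \<open>b x i = b y i\<close> by (simp add: c_def)
    qed (use xy in auto)
    then show False by (simp add: c_def)
  qed
  have HK: "h ` {..<q} \<subseteq> mat_kernel A"
  proof
    fix v assume "v \<in> h ` {..<q}"
    then obtain a where a: "a < q" "v = h a" by auto
    have "A *\<^sub>v h a = 0\<^sub>v n"
      using A ker[OF a(1)] mult_mat_vec_index[OF A] unfolding h_def by (intro eq_vecI) auto
    then show "v \<in> mat_kernel A" using a by (intro mat_kernelI[OF A]) (auto simp: h_def)
  qed
  have "lin_indpt (h ` {..<q})"
  proof (rule Ker.finite_lin_indpt2)
    fix g assume z: "lincomb g (h ` {..<q}) = 0\<^sub>v n"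
    have "(\<Sum>a<q. g (h a) * b a i) = 0" if i: "i < n" for i
    proof -
      have "(\<Sum>a<q. g (h a) * b a i) = (\<Sum>a<q. g (h a) * h a $ i)" using i by (simp add: h_def)
      also have "\<dots> = (\<Sum>v\<in>h ` {..<q}. g v * v $ i)" by (simp add: sum.reindex[OF inj])
      also have "\<dots> = lincomb g (h ` {..<q}) $ i" by (rule lincomb_index[OF i HK, symmetric])
      finally show ?thesis using z i by simp
    qed
    then have "g (h a) = 0" if "a < q" for a using ind[of "\<lambda>a. g (h a)"] that by blast
    then show "\<forall>v\<in>h ` {..<q}. g v = 0" by auto
  qed (use HK in auto)
  moreover have "Ker.fin_dim"
  proof -
    obtain B where "finite B" "basis B" using kernel_basis_exists[OF A] by auto
    then show ?thesis unfolding Ker.fin_dim_def Ker.basis_def by auto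
  qed
  ultimately have "card (h ` {..<q}) \<le> dim" using Ker.li_le_dim(2) HK by blast
  then show ?thesis by (simp add: card_image[OF inj])
qed

lemma kernel_dim_le:
  fixes A :: "real mat"
  assumes A: "A \<in> carrier_mat n n"
  shows "kernel_dim A \<le> n"
proof (rule ccontr)
  assume "\<not> kernel_dim A \<le> n"
  then have big: "card {..<n} < card {..<kernel_dim A}" by simp
  obtain b :: "nat \<Rightarrow> nat \<Rightarrow> real" where
    ind: "\<And>c a. \<forall>i<n. (\<Sum>a<kernel_dim A. c a * b a i) = 0 \<Longrightarrow> a < kernel_dim A \<Longrightarrow> c a = 0"
    by (rule kernel_family_exists[OF A]) blast
  obtain c where "\<exists>a\<in>{..<kernel_dim A}. c a \<noteq> 0"
    "\<forall>i\<in>{..<n}. (\<Sum>a<kernel_dim A. b a i * c a) = 0"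
    using homogeneous_system_nontrivial_solution[OF _ _ big, of "\<lambda>i a. b a i"] by auto
  moreover from this have z: "\<forall>i<n. (\<Sum>a<kernel_dim A. c a * b a i) = 0"
    by (simp add: mult.commute[of "c _"])
  ultimately show False using ind[OF z] by blast
qed

section \<open>The Strong Arnold Property bounds the nullity\<close>

lemma twice_choose_two: "2 * (q choose 2) = q * (q - 1)"
proof -
  have "even (q * (q - 1))" by (cases q) auto
  then show ?thesis unfolding choose_two by simp
qed

text \<open>
  Let \<open>b\<^sub>1, \<dots>, b\<^sub>q\<close> be a basis of the kernel. The matrices \<open>X\<close> with entries
  \<open>\<Sum>x y. c (x, y) * b x i * b y j\<close> satisfy \<open>A X = 0\<close> and vanish only for \<open>c = 0\<close>. Requiring \<open>c\<close>
  symmetric and \<open>X\<close> zero on the diagonal and on the edges amounts to \<open>q(q - 1)/2 + n + |E|\<close> equations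
  in \<open>q\<^sup>2\<close> unknowns. If \<open>q(q + 1)/2 > n + |E|\<close>, there is a nonzero solution, which violates the
  Strong Arnold Property.
\<close>

theorem strong_arnold_nullity_bound:
  assumes A: "A \<in> sym_mats n E" and SAP: "strong_arnold n A" and E: "E \<subseteq> nsets {..<n} 2"
  shows "kernel_dim A * (kernel_dim A + 1) \<le> 2 * (n + card E)"
proof (rule ccontr)
  assume "\<not> ?thesis"
  then have large: "2 * (n + card E) < kernel_dim A * (kernel_dim A + 1)" by simp
  define q where "q = kernel_dim A"
  have cA: "A \<in> carrier_mat n n" and pat: "\<And>i j. i < n \<Longrightarrow> j < n \<Longrightarrow> i \<noteq> j \<Longrightarrow> A $$ (i, j) \<noteq> 0 \<longleftrightarrow> {i, j} \<in> E"
    using A unfolding sym_mats_def by auto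
  obtain b :: "nat \<Rightarrow> nat \<Rightarrow> real" where
    ker: "\<And>a i. a < q \<Longrightarrow> i < n \<Longrightarrow> (\<Sum>j<n. A $$ (i, j) * b a j) = 0" and
    ind: "\<And>c a. \<forall>i<n. (\<Sum>a<q. c a * b a i) = 0 \<Longrightarrow> a < q \<Longrightarrow> c a = 0"
    unfolding q_def by (rule kernel_family_exists[OF cA]) blast
  define I where "I = {..<n} <+> (E <+> nsets {..<q} 2)"
  define f :: "nat + (nat set + nat set) \<Rightarrow> nat \<times> nat \<Rightarrow> real" where
    "f x p = (case x of
        Inl i \<Rightarrow> b (fst p) i * b (snd p) i
      | Inr (Inl e) \<Rightarrow> b (fst p) (Min e) * b (snd p) (Max e)
      | Inr (Inr s) \<Rightarrow> of_bool (p = (Min s, Max s)) - of_bool (p = (Max s, Min s)))" for x p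
  have finE: "finite E" using E finite_imp_finite_nsets[of "{..<n}" 2] finite_subset by auto
  have fin2: "finite (nsets {..<q} 2)" by (simp add: finite_imp_finite_nsets)
  have "card I = n + (card E + (q choose 2))"
    unfolding I_def using finE fin2 by (simp add: card_Plus)
  then have "2 * card I < 2 * (q * q)"
    using large twice_choose_two[of q] unfolding q_def[symmetric]
    by (cases q) (auto simp: algebra_simps)
  then have lt: "card I < card ({..<q} \<times> {..<q})" by simp
  have "finite I" unfolding I_def using finE fin2 by simp
  then obtain c where c0: "\<exists>p\<in>{..<q} \<times> {..<q}. c p \<noteq> 0"
    and sol: "\<And>x. x \<in> I \<Longrightarrow> (\<Sum>p\<in>{..<q} \<times> {..<q}. f x p * c p) = 0"
    using homogeneous_system_nontrivial_solution[OF _ _ lt, of f] by auto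
  have csym: "c (x, y) = c (y, x)" if "x < y" "y < q" for x y
  proof -
    have "Inr (Inr {x, y}) \<in> I" using that unfolding I_def by (intro InrI) simp
    from sol[OF this] have "(\<Sum>p\<in>{..<q} \<times> {..<q}.
      of_bool (p = (x, y)) * c p - of_bool (p = (y, x)) * c p) = 0"
      using that by (simp add: f_def algebra_simps)
    then show ?thesis using that by (simp add: sum_subtractf)
  qed
  have csym: "c (x, y) = c (y, x)" if "x < q" "y < q" for x y
    using csym[of x y] csym[of y x] that by (cases x y rule: linorder_cases) auto
  define X where "X i j = (\<Sum>x<q. \<Sum>y<q. c (x, y) * b x i * b y j)" for i j
  have Xpair: "(\<Sum>p\<in>{..<q} \<times> {..<q}. b (fst p) i * b (snd p) j * c p) = X i j" for i j
    unfolding X_def by (simp add: sum.cartesian_product case_prod_unfold mult_ac)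
  have Xsym: "X i j = X j i" for i j
  proof -
    have "X i j = (\<Sum>y<q. \<Sum>x<q. c (x, y) * b x i * b y j)" unfolding X_def by (rule sum.swap)
    also have "\<dots> = X j i" unfolding X_def using csym by (intro sum.cong) (auto simp: mult_ac)
    finally show ?thesis .
  qed
  have Xdiag: "X i i = 0" if "i < n" for i
  proof -
    have "Inl i \<in> I" using that unfolding I_def by (intro InlI) simp
    from sol[OF this] show ?thesis by (simp add: f_def Xpair)
  qed
  have Xedge: "X i j = 0" if "{i, j} \<in> E" "i < j" for i j
  proof -
    have "Inr (Inl {i, j}) \<in> I" using that unfolding I_def by (intro InrI InlI) simp
    from sol[OF this] show ?thesis using that by (simp add: f_def Xpair)
  qed
  have Xedge: "X i j = 0" if "{i, j} \<in> E" "i \<noteq> j" for i j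
    using that Xedge[of i j] Xedge[of j i] Xsym[of i j]
    by (cases i j rule: linorder_cases) (auto simp: insert_commute)
  define M where "M = mat n n (\<lambda>(i, j). X i j)"
  have cM: "M \<in> carrier_mat n n" unfolding M_def by simp
  have "transpose_mat M = M" unfolding M_def using Xsym by (intro eq_matI) auto
  moreover have "A * M = 0\<^sub>m n n"
  proof (rule eq_matI)
    fix i j assume "i < dim_row (0\<^sub>m n n :: real mat)" "j < dim_col (0\<^sub>m n n :: real mat)"
    then have ij: "i < n" "j < n" by auto
    have "(A * M) $$ (i, j) = (\<Sum>k<n. A $$ (i, k) * X k j)"
      using ij cA by (auto simp: M_def scalar_prod_def row_def col_def atLeast0LessThan intro!: sum.cong)
    also have "\<dots> = (\<Sum>k<n. \<Sum>x<q. \<Sum>y<q. c (x, y) * b y j * (A $$ (i, k) * b x k))"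
      unfolding X_def by (simp add: sum_distrib_left mult_ac)
    also have "\<dots> = (\<Sum>x<q. \<Sum>k<n. \<Sum>y<q. c (x, y) * b y j * (A $$ (i, k) * b x k))"
      by (rule sum.swap)
    also have "\<dots> = (\<Sum>x<q. \<Sum>y<q. \<Sum>k<n. c (x, y) * b y j * (A $$ (i, k) * b x k))"
      by (rule sum.cong[OF HOL.refl]) (rule sum.swap)
    also have "\<dots> = 0" using ker ij by (simp add: sum_distrib_left[symmetric])
    finally show "(A * M) $$ (i, j) = 0\<^sub>m n n $$ (i, j)" using ij by simp
  qed (use cA in \<open>auto simp: M_def\<close>)
  moreover have "hadamard_mult A M = 0\<^sub>m n n"
    using cA pat Xdiag Xedge unfolding hadamard_mult_def M_def
    by (intro eq_matI) (auto, metis)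
  moreover have "hadamard_mult (1\<^sub>m n) M = 0\<^sub>m n n"
    using Xdiag unfolding hadamard_mult_def M_def by (intro eq_matI) auto
  moreover have "M \<noteq> 0\<^sub>m n n"
  proof
    assume M0: "M = 0\<^sub>m n n"
    have X0: "X i j = 0" if "i < n" "j < n" for i j
      using arg_cong[OF M0, of "\<lambda>M. M $$ (i, j)"] that unfolding M_def by simp
    have "(\<Sum>y<q. c (x, y) * b y j) = 0" if "x < q" "j < n" for x j
    proof -
      have "\<forall>i<n. (\<Sum>x<q. (\<Sum>y<q. c (x, y) * b y j) * b x i) = 0"
        using X0[OF _ that(2)] unfolding X_def by (simp add: sum_distrib_left mult_ac)
      from ind[OF this] show ?thesis using that by simp
    qed
    then have "c (x, y) = 0" if "x < q" "y < q" for x y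
      using ind[of "\<lambda>y. c (x, y)"] that by simp
    then show False using c0 by auto
  qed
  ultimately show False using SAP cM unfolding strong_arnold_def by blast
qed

section \<open>Matrices with exactly one negative eigenvalue\<close>

text \<open>
  Sylvester's identity. The block matrix with blocks \<open>1, U, W, 1\<close> has two factorizations into block
  triangular matrices, whose determinants are the two sides.
\<close>

lemma det_one_minus_mult_commute:
  fixes U :: "'a :: idom mat"
  assumes U: "U \<in> carrier_mat n m" and W: "W \<in> carrier_mat m n"
  shows "det (1\<^sub>m n - U * W) = det (1\<^sub>m m - W * U)"
proof -
  let ?M = "four_block_mat (1\<^sub>m n) U W (1\<^sub>m m)"
  have UW: "U * W \<in> carrier_mat n n" "W * U \<in> carrier_mat m m"
    and D: "1\<^sub>m m - W * U \<in> carrier_mat m m" "1\<^sub>m n - U * W \<in> carrier_mat n n"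
    using U W by auto
  have eq1: "?M = four_block_mat (1\<^sub>m n) (0\<^sub>m n m) W (1\<^sub>m m) *
      four_block_mat (1\<^sub>m n) U (0\<^sub>m m n) (1\<^sub>m m - W * U)"
    using U W UW by (subst mult_four_block_mat[of _ n n _ m _ m _ _ n _ m]) (auto)
  have "det ?M = det (four_block_mat (1\<^sub>m n) (0\<^sub>m n m) W (1\<^sub>m m)) *
      det (four_block_mat (1\<^sub>m n) U (0\<^sub>m m n) (1\<^sub>m m - W * U))"
    unfolding eq1 by (intro det_mult[of _ "n + m"]) (use U W UW in auto)
  also have "\<dots> = det (1\<^sub>m m - W * U)"
    using U W D det_four_block_mat_upper_right_zero[of "1\<^sub>m n" n "0\<^sub>m n m" m W "1\<^sub>m m"]
      det_four_block_mat_lower_left_zero[of "1\<^sub>m n" n U m "0\<^sub>m m n" "1\<^sub>m m - W * U"] by simp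
  finally have 1: "det ?M = det (1\<^sub>m m - W * U)" .
  have eq2: "?M = four_block_mat (1\<^sub>m n - U * W) U (0\<^sub>m m n) (1\<^sub>m m) *
      four_block_mat (1\<^sub>m n) (0\<^sub>m n m) W (1\<^sub>m m)"
    using U W UW by (subst mult_four_block_mat[of _ n n _ m _ m _ _ n _ m]) (auto)
  have "det ?M = det (four_block_mat (1\<^sub>m n - U * W) U (0\<^sub>m m n) (1\<^sub>m m)) *
      det (four_block_mat (1\<^sub>m n) (0\<^sub>m n m) W (1\<^sub>m m))"
    unfolding eq2 by (intro det_mult[of _ "n + m"]) (use U W UW in auto)
  also have "\<dots> = det (1\<^sub>m n - U * W)"
    using U W D det_four_block_mat_upper_right_zero[of "1\<^sub>m n" n "0\<^sub>m n m" m W "1\<^sub>m m"]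
      det_four_block_mat_lower_left_zero[of "1\<^sub>m n - U * W" n U m "0\<^sub>m m n" "1\<^sub>m m"] by simp
  finally show ?thesis using 1 by simp
qed

lemma det_one_minus_rank_one:
  fixes v :: "nat \<Rightarrow> real"
  shows "det (mat n n (\<lambda>(i, j). of_bool (i = j) - t * v i * v j)) = 1 - t * (\<Sum>i<n. v i * v i)"
proof -
  let ?U = "mat n 1 (\<lambda>(i, j). v i)" and ?W = "mat 1 n (\<lambda>(i, j). t * v j)"
  have "mat n n (\<lambda>(i, j). of_bool (i = j) - t * v i * v j) = 1\<^sub>m n - ?U * ?W"
    by (intro eq_matI) (auto simp: scalar_prod_def row_def col_def)
  then have "det (mat n n (\<lambda>(i, j). of_bool (i = j) - t * v i * v j)) = det (1\<^sub>m 1 - ?W * ?U)"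
    using det_one_minus_mult_commute[of ?U n 1 ?W] by simp
  also have "\<dots> = 1 - t * (\<Sum>i<n. v i * v i)"
    by (subst det_single)
      (auto simp: scalar_prod_def row_def col_def sum_distrib_left atLeast0LessThan mult_ac
        intro!: sum.cong)
  finally show ?thesis .
qed

lemma eigenvalue_iff:
  fixes A :: "real mat"
  assumes A: "A \<in> carrier_mat n n"
  shows "eigenvalue A a \<longleftrightarrow>
    (\<exists>v. (\<exists>i<n. v i \<noteq> 0) \<and> (\<forall>i<n. (\<Sum>j<n. A $$ (i, j) * v j) = a * v i))"
proof
  assume "eigenvalue A a"
  then obtain v where v: "v \<in> carrier_vec n" "v \<noteq> 0\<^sub>v n" "A *\<^sub>v v = a \<cdot>\<^sub>v v"
    using A unfolding eigenvalue_def eigenvector_def by auto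
  have "vec n (($) v) = v" using v(1) by auto
  then have "\<forall>i<n. (\<Sum>j<n. A $$ (i, j) * v $ j) = a * v $ i"
    using mult_mat_vec_index[OF A, of _ "($) v"] v by simp
  moreover have "\<exists>i<n. v $ i \<noteq> 0"
  proof (rule ccontr)
    assume "\<not> ?thesis"
    then have "v = 0\<^sub>v n" using v(1) by (intro eq_vecI) auto
    then show False using v(2) by simp
  qed
  ultimately show "\<exists>v. (\<exists>i<n. v i \<noteq> 0) \<and> (\<forall>i<n. (\<Sum>j<n. A $$ (i, j) * v j) = a * v i)"
    by (intro exI[of _ "($) v"] conjI)
next
  assume "\<exists>v. (\<exists>i<n. v i \<noteq> 0) \<and> (\<forall>i<n. (\<Sum>j<n. A $$ (i, j) * v j) = a * v i)"
  then obtain v i where v: "i < n" "v i \<noteq> 0" "\<forall>i<n. (\<Sum>j<n. A $$ (i, j) * v j) = a * v i" by auto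
  have "A *\<^sub>v vec n v = a \<cdot>\<^sub>v vec n v"
    using A v(3) mult_mat_vec_index[OF A, of _ v] by (intro eq_vecI) auto
  moreover have "vec n v \<noteq> 0\<^sub>v n"
  proof
    assume "vec n v = 0\<^sub>v n"
    then show False using v(1,2) by (metis index_vec index_zero_vec(1))
  qed
  ultimately show "eigenvalue A a"
    using A unfolding eigenvalue_def eigenvector_def by (intro exI[of _ "vec n v"]) auto
qed

lemma poly_char_poly:
  fixes A :: "real mat"
  assumes A: "A \<in> carrier_mat n n"
  shows "poly (char_poly A) x = det (mat n n (\<lambda>(i, j). x * of_bool (i = j) - A $$ (i, j)))"
proof -
  have "- char_matrix A x = mat n n (\<lambda>(i, j). x * of_bool (i = j) - A $$ (i, j))"
    using A unfolding char_matrix_def by (intro eq_matI) auto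
  then show ?thesis using char_poly_matrix[OF A] by simp
qed

text \<open>
  Subtracting \<open>a/N * v v\<^sup>T\<close> moves the eigenvalue \<open>a\<close> of the eigenvector \<open>v\<close> to \<open>0\<close> and keeps all
  others with their multiplicities (Brauer). The reason is the factorization
  \<open>x I - A + a/N * v v\<^sup>T = (x I - A) (I - t v v\<^sup>T)\<close>.
\<close>

lemma char_poly_deflation:
  fixes A :: "real mat" and v :: "nat \<Rightarrow> real" and n :: nat
  defines "N \<equiv> \<Sum>i<n. v i * v i"
  assumes A: "A \<in> carrier_mat n n"
    and ev: "\<And>i. i < n \<Longrightarrow> (\<Sum>j<n. A $$ (i, j) * v j) = a * v i"
    and N: "N \<noteq> 0"
  shows "char_poly (mat n n (\<lambda>(i, j). A $$ (i, j) - a / N * v i * v j)) * [:- a, 1:]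
    = char_poly A * [:0, 1:]" (is "?l = ?r")
proof -
  define P where "P = mat n n (\<lambda>(i, j). A $$ (i, j) - a / N * v i * v j)"
  have P: "P \<in> carrier_mat n n" unfolding P_def by simp
  have pt: "poly (char_poly P * [:- a, 1:]) x = poly (char_poly A * [:0, 1:]) x" if x: "x \<noteq> a" for x
  proof -
    \<comment> \<open>Since \<open>(x I - A) v = (x - a) v\<close>, this \<open>t\<close> makes the factorization hold.\<close>
    define t where "t = - a / N / (x - a)"
    let ?R = "mat n n (\<lambda>(i, j). of_bool (i = j) - t * v i * v j)"
    let ?C = "mat n n (\<lambda>(i, j). x * of_bool (i = j) - A $$ (i, j))"
    have "mat n n (\<lambda>(i, j). x * of_bool (i = j) - P $$ (i, j)) = ?C * ?R"
    proof (rule eq_matI)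
      fix i j assume "i < dim_row (?C * ?R)" "j < dim_col (?C * ?R)"
      then have ij: "i < n" "j < n" by auto
      have "(?C * ?R) $$ (i, j)
        = (\<Sum>k<n. (x * of_bool (i = k) - A $$ (i, k)) * (of_bool (k = j) - t * v k * v j))"
        using ij by (auto simp: scalar_prod_def atLeast0LessThan intro!: sum.cong)
      also have "\<dots> = (\<Sum>k<n. (x * of_bool (i = k) - A $$ (i, k)) * of_bool (k = j))
        - t * v j * ((\<Sum>k<n. x * of_bool (i = k) * v k) - (\<Sum>k<n. A $$ (i, k) * v k))"
        by (simp add: sum_subtractf[symmetric] sum_distrib_left algebra_simps)
      also have "(\<Sum>k<n. (x * of_bool (i = k) - A $$ (i, k)) * of_bool (k = j))
        = (\<Sum>k<n. if k = j then x * of_bool (i = k) - A $$ (i, k) else 0)"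
        by (intro sum.cong) auto
      also have "(\<Sum>k<n. x * of_bool (i = k) * v k) = (\<Sum>k<n. if k = i then x * v k else 0)"
        by (intro sum.cong) auto
      also have "(\<Sum>k<n. A $$ (i, k) * v k) = a * v i" using ij ev by simp
      also have "(\<Sum>k<n. if k = j then x * of_bool (i = k) - A $$ (i, k) else 0) - t * v j *
          ((\<Sum>k<n. if k = i then x * v k else 0) - a * v i)
        = x * of_bool (i = j) - A $$ (i, j) - t * v j * (x * v i - a * v i)"
        using ij by simp
      also have "\<dots> = x * of_bool (i = j) - A $$ (i, j) - (t * (x - a)) * v i * v j"
        by (simp add: algebra_simps)
      also have "t * (x - a) = - a / N" unfolding t_def using x by simp
      finally show "mat n n (\<lambda>(i, j). x * of_bool (i = j) - P $$ (i, j)) $$ (i, j) = (?C * ?R) $$ (i, j)"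
        using ij by (simp add: P_def)
    qed auto
    then have "poly (char_poly P) x = det ?C * det ?R"
      unfolding poly_char_poly[OF P] by (simp add: det_mult[of _ n])
    also have "det ?R = 1 - t * N" unfolding N_def by (rule det_one_minus_rank_one)
    also have "\<dots> = x / (x - a)" unfolding t_def using x N by (simp add: field_simps)
    finally have "poly (char_poly P) x * (x - a) = det ?C * x" using x by simp
    then show ?thesis unfolding poly_mult poly_char_poly[OF A] by simp
  qed
  have "?l - ?r = 0"
  proof (rule ccontr)
    assume "?l - ?r \<noteq> 0"
    then have "finite {x. poly (?l - ?r) x = 0}" by (rule poly_roots_finite)
    moreover have "UNIV - {a} \<subseteq> {x. poly (?l - ?r) x = 0}" using pt unfolding P_def by auto
    ultimately have "finite (UNIV - {a})" by (rule finite_subset[rotated])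
    then show False using infinite_UNIV_char_0 by auto
  qed
  then show ?thesis by simp
qed

text \<open>
  If the form of \<open>A\<close> is nonnegative on the hyperplane orthogonal to \<open>h\<close>, two orthogonal eigenvectors
  cannot both have negative eigenvalues, as their span meets the hyperplane. Applied
  to the deflation \<open>P\<close> of \<open>A\<close>, this shows that \<open>P\<close> has no negative eigenvalue; the relation between
  the characteristic polynomials of \<open>A\<close> and \<open>P\<close> then yields the algebraic multiplicities.
\<close>

lemma num_neg_eigenvalues_eq_1:
  fixes A :: "real mat"
  assumes A: "A \<in> carrier_mat n n"
    and sym: "\<And>i j. i < n \<Longrightarrow> j < n \<Longrightarrow> A $$ (i, j) = A $$ (j, i)"
    and psd: "\<And>w. (\<Sum>i<n. h i * w i) = 0 \<Longrightarrow> 0 \<le> (\<Sum>i<n. w i * (\<Sum>j<n. A $$ (i, j) * w j))"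
    and neg: "a < 0" and "eigenvalue A a"
  shows "num_neg_eigenvalues A = 1"
proof -
  obtain v where "\<exists>i<n. v i \<noteq> 0" and v: "\<And>i. i < n \<Longrightarrow> (\<Sum>j<n. A $$ (i, j) * v j) = a * v i"
    using \<open>eigenvalue A a\<close> eigenvalue_iff[OF A] by blast
  define N where "N = (\<Sum>i<n. v i * v i)"
  have pos: "(\<Sum>i<n. w i * w i) > 0" if "\<exists>i<n. w i \<noteq> 0" for w :: "nat \<Rightarrow> real"
  proof -
    have "(\<Sum>i<n. w i * w i) \<noteq> 0" using that by (subst sum_nonneg_eq_0_iff) auto
    then show ?thesis using sum_nonneg[of "{..<n}" "\<lambda>i. w i * w i"] by force
  qed
  have N: "N > 0" unfolding N_def using \<open>\<exists>i<n. v i \<noteq> 0\<close> by (rule pos)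
  have selfadj: "(\<Sum>i<n. u i * (\<Sum>j<n. A $$ (i, j) * w j)) = (\<Sum>i<n. w i * (\<Sum>j<n. A $$ (i, j) * u j))"
    for u w
  proof -
    have "(\<Sum>i<n. u i * (\<Sum>j<n. A $$ (i, j) * w j)) = (\<Sum>i<n. \<Sum>j<n. u i * (A $$ (i, j) * w j))"
      by (simp add: sum_distrib_left)
    also have "\<dots> = (\<Sum>j<n. \<Sum>i<n. u i * (A $$ (i, j) * w j))" by (rule sum.swap)
    also have "\<dots> = (\<Sum>j<n. \<Sum>i<n. w j * (A $$ (j, i) * u i))"
    proof (rule sum.cong[OF HOL.refl], rule sum.cong[OF HOL.refl])
      fix j i assume "j \<in> {..<n}" "i \<in> {..<n}"
      then have "A $$ (i, j) = A $$ (j, i)" using sym by simp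
      then show "u i * (A $$ (i, j) * w j) = w j * (A $$ (j, i) * u i)" by simp
    qed
    finally show ?thesis by (simp add: sum_distrib_left)
  qed
  \<comment> \<open>An eigenvector \<open>w\<close> orthogonal to \<open>v\<close> with a negative eigenvalue is impossible: the
  combination \<open>u\<close> of \<open>v\<close> and \<open>w\<close> lies in the hyperplane.\<close>
  have key: False
    if b: "b < 0" and w0: "\<exists>i<n. w i \<noteq> 0" and w: "\<And>i. i < n \<Longrightarrow> (\<Sum>j<n. A $$ (i, j) * w j) = b * w i"
      and orth: "(\<Sum>i<n. v i * w i) = 0" for b w
  proof -
    define p where "p = (\<Sum>i<n. h i * w i)"
    define m where "m = - (\<Sum>i<n. h i * v i)"
    define u where "u i = p * v i + m * w i" for i
    have "(\<Sum>i<n. h i * u i) = p * (\<Sum>i<n. h i * v i) + m * (\<Sum>i<n. h i * w i)"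
      unfolding u_def by (simp add: sum.distrib sum_distrib_left algebra_simps)
    also have "\<dots> = 0" unfolding p_def m_def by simp
    finally have "0 \<le> (\<Sum>i<n. u i * (\<Sum>j<n. A $$ (i, j) * u j))" by (rule psd)
    also have "\<dots> = (\<Sum>i<n. u i * (p * (a * v i) + m * (b * w i)))"
    proof (intro sum.cong HOL.refl)
      fix i assume "i \<in> {..<n}"
      then have "(\<Sum>j<n. A $$ (i, j) * u j) = p * (\<Sum>j<n. A $$ (i, j) * v j) + m * (\<Sum>j<n. A $$ (i, j) * w j)"
        unfolding u_def by (simp add: sum.distrib sum_distrib_left algebra_simps)
      then show "u i * (\<Sum>j<n. A $$ (i, j) * u j) = u i * (p * (a * v i) + m * (b * w i))"
        using v w \<open>i \<in> {..<n}\<close> by simp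
    qed
    also have "\<dots> = p\<^sup>2 * a * N + m\<^sup>2 * b * (\<Sum>i<n. w i * w i) + p * m * (a + b) * (\<Sum>i<n. v i * w i)"
      unfolding u_def N_def by (simp add: sum.distrib sum_distrib_left algebra_simps power2_eq_square)
    finally have ge: "0 \<le> p\<^sup>2 * a * N + m\<^sup>2 * b * (\<Sum>i<n. w i * w i)" using orth by simp
    have "p\<^sup>2 * a * N \<le> 0" "m\<^sup>2 * b * (\<Sum>i<n. w i * w i) \<le> 0"
      using neg b N pos[OF w0] by (auto simp: mult_le_0_iff zero_le_mult_iff)
    then have "p\<^sup>2 * a * N = 0" using ge by linarith
    then have "p = 0" using neg N by simp
    then have "0 \<le> (\<Sum>i<n. w i * (\<Sum>j<n. A $$ (i, j) * w j))" unfolding p_def by (rule psd)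
    also have "\<dots> = b * (\<Sum>i<n. w i * w i)" using w by (simp add: sum_distrib_left mult_ac)
    finally show False using b pos[OF w0] by (simp add: zero_le_mult_iff)
  qed
  define P where "P = mat n n (\<lambda>(i, j). A $$ (i, j) - a / N * v i * v j)"
  have P: "P \<in> carrier_mat n n" unfolding P_def by simp
  have char: "char_poly P * [:- a, 1:] = char_poly A * [:0, 1:]"
    unfolding P_def N_def by (rule char_poly_deflation[OF A v]) (use N in \<open>auto simp: N_def\<close>)
  have noneg: "\<not> eigenvalue P b" if b: "b < 0" for b
  proof
    assume "eigenvalue P b"
    then obtain w where w0: "\<exists>i<n. w i \<noteq> 0" and w: "\<And>i. i < n \<Longrightarrow> (\<Sum>j<n. P $$ (i, j) * w j) = b * w i"
      using eigenvalue_iff[OF P] by blast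
    have Pw: "(\<Sum>j<n. P $$ (i, j) * u j) = (\<Sum>j<n. A $$ (i, j) * u j) - a / N * v i * (\<Sum>j<n. v j * u j)"
      if "i < n" for i u
      using that unfolding P_def by (simp add: sum_subtractf sum_distrib_left algebra_simps)
    have "b * (\<Sum>i<n. v i * w i) = (\<Sum>i<n. v i * (\<Sum>j<n. P $$ (i, j) * w j))"
      using w by (simp add: sum_distrib_left mult_ac)
    also have "\<dots> = (\<Sum>i<n. v i * (\<Sum>j<n. A $$ (i, j) * w j) - a / N * (\<Sum>j<n. v j * w j) * (v i * v i))"
    proof (rule sum.cong[OF HOL.refl])
      fix i assume "i \<in> {..<n}"
      then have "(\<Sum>j<n. P $$ (i, j) * w j) = (\<Sum>j<n. A $$ (i, j) * w j) - a / N * v i * (\<Sum>j<n. v j * w j)"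
        using Pw by simp
      then show "v i * (\<Sum>j<n. P $$ (i, j) * w j)
        = v i * (\<Sum>j<n. A $$ (i, j) * w j) - a / N * (\<Sum>j<n. v j * w j) * (v i * v i)"
        by (simp only: right_diff_distrib mult_ac)
    qed
    also have "\<dots> = (\<Sum>i<n. v i * (\<Sum>j<n. A $$ (i, j) * w j)) - a / N * (\<Sum>j<n. v j * w j) * N"
      unfolding N_def by (simp add: sum_subtractf sum_distrib_left)
    also have "(\<Sum>i<n. v i * (\<Sum>j<n. A $$ (i, j) * w j)) = (\<Sum>i<n. w i * (a * v i))"
      unfolding selfadj[of v w] using v by simp
    also have "\<dots> = a * (\<Sum>j<n. v j * w j)" by (simp add: sum_distrib_left mult_ac)
    finally have orth: "(\<Sum>i<n. v i * w i) = 0" using b N by simp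
    show False by (rule key[OF b w0 _ orth]) (use w Pw orth in simp)
  qed
  have cA0: "char_poly A \<noteq> 0" using degree_monic_char_poly[OF A] by auto
  have cP0: "char_poly P \<noteq> 0" using degree_monic_char_poly[OF P] by auto
  have ordb: "Polynomial.order b (char_poly A) = of_bool (b = a)" if b: "b < 0" for b
  proof -
    have "Polynomial.order b (char_poly P) = 0"
      using noneg[OF b] eigenvalue_root_char_poly[OF P] by (simp add: order_0I)
    moreover have "Polynomial.order b (char_poly P * [:- a, 1:])
      = Polynomial.order b (char_poly P) + Polynomial.order b [:- a, 1:]"
      using cP0 by (intro order_mult) (simp only: mult_eq_0_iff, simp)
    moreover have "Polynomial.order b (char_poly A * [:0, 1:])
      = Polynomial.order b (char_poly A) + Polynomial.order b [:0, 1:]"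
      using cA0 by (intro order_mult) (simp only: mult_eq_0_iff, simp)
    moreover have "Polynomial.order b [:0, 1:] = 0" using b by (intro order_0I) auto
    moreover have "Polynomial.order b [:- a, 1:] = of_bool (b = a)"
      using order_power_n_n[of a 1] by (cases "b = a") (auto intro!: order_0I)
    ultimately show ?thesis using char by simp
  qed
  have "{b. eigenvalue A b \<and> b < 0} = {a}"
  proof -
    have "b = a" if "eigenvalue A b" "b < 0" for b
    proof (rule ccontr)
      assume "b \<noteq> a"
      then have "Polynomial.order b (char_poly A) = 0" using ordb[OF that(2)] by simp
      then have "poly (char_poly A) b \<noteq> 0" using cA0 order_root by blast
      then show False using that eigenvalue_root_char_poly[OF A] by simp
    qed
    then show ?thesis using \<open>eigenvalue A a\<close> neg by blast
  qed
  then show ?thesis unfolding num_neg_eigenvalues_def using ordb[OF neg] by simp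
qed

section \<open>Bounds on the spectral parameters\<close>

lemma strong_arnold_if_det_nonzero:
  fixes A :: "real mat"
  assumes A: "A \<in> carrier_mat n n" and det: "det A \<noteq> 0"
  shows "strong_arnold n A"
  unfolding strong_arnold_def
proof
  assume "\<exists>X\<in>carrier_mat n n. transpose_mat X = X \<and> X \<noteq> 0\<^sub>m n n \<and> A * X = 0\<^sub>m n n \<and>
    hadamard_mult A X = 0\<^sub>m n n \<and> hadamard_mult (1\<^sub>m n) X = 0\<^sub>m n n"
  then obtain X where X: "X \<in> carrier_mat n n" "X \<noteq> 0\<^sub>m n n" "A * X = 0\<^sub>m n n" by auto
  have "col X j = 0\<^sub>v n" if j: "j < n" for j
  proof -
    have "A *\<^sub>v col X j = col (A * X) j" using A X(1) j by auto
    then have "A *\<^sub>v col X j = 0\<^sub>v n" using X(3) j by simp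
    moreover have "col X j \<in> carrier_vec n" using X(1) by auto
    ultimately show ?thesis using det det_0_iff_vec_prod_zero[OF A] by auto
  qed
  then have "X $$ (i, j) = 0" if "i < n" "j < n" for i j
    using that X(1) by (metis index_col carrier_matD index_zero_vec(1))
  then have "X = 0\<^sub>m n n" using X(1) by (intro eq_matI) auto
  then show False using X(2) by simp
qed

text \<open>
  From \<open>2 |w i * w j| \<le> (w i)\<^sup>2 + (w j)\<^sup>2\<close> in each off-diagonal term.
\<close>

lemma qform_diag_dominant:
  fixes A :: "real mat"
  assumes off: "\<And>i j. i < n \<Longrightarrow> j < n \<Longrightarrow> i \<noteq> j \<Longrightarrow> \<bar>A $$ (i, j)\<bar> \<le> \<epsilon>" and e: "\<epsilon> \<ge> 0"
  shows "(\<Sum>i<n. (A $$ (i, i) - \<epsilon> * real n) * (w i)\<^sup>2) \<le> (\<Sum>i<n. w i * (\<Sum>j<n. A $$ (i, j) * w j))"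
proof -
  have "(\<Sum>i<n. \<Sum>j<n. of_bool (i = j) * (A $$ (i, i) * (w i)\<^sup>2) - \<epsilon> * (((w i)\<^sup>2 + (w j)\<^sup>2) / 2))
     \<le> (\<Sum>i<n. \<Sum>j<n. w i * (A $$ (i, j) * w j))"
  proof (intro sum_mono)
    fix i j assume "i \<in> {..<n}" "j \<in> {..<n}"
    show "of_bool (i = j) * (A $$ (i, i) * (w i)\<^sup>2) - \<epsilon> * (((w i)\<^sup>2 + (w j)\<^sup>2) / 2) \<le> w i * (A $$ (i, j) * w j)"
    proof (cases "i = j")
      case True
      then show ?thesis using e by (simp add: power2_eq_square)
    next
      case False
      have "\<bar>w i * w j\<bar> \<le> ((w i)\<^sup>2 + (w j)\<^sup>2) / 2"
        using sum_squares_bound[of "\<bar>w i\<bar>" "\<bar>w j\<bar>"] by (simp add: abs_mult)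
      moreover have "\<bar>A $$ (i, j)\<bar> \<le> \<epsilon>" using off \<open>i \<in> _\<close> \<open>j \<in> _\<close> False by auto
      ultimately have "\<bar>A $$ (i, j)\<bar> * \<bar>w i * w j\<bar> \<le> \<epsilon> * (((w i)\<^sup>2 + (w j)\<^sup>2) / 2)"
        using e by (intro mult_mono) auto
      then have "\<bar>w i * (A $$ (i, j) * w j)\<bar> \<le> \<epsilon> * (((w i)\<^sup>2 + (w j)\<^sup>2) / 2)"
        by (simp add: abs_mult mult_ac)
      then show ?thesis using False by (simp add: abs_le_iff)
    qed
  qed
  also have "\<dots> = (\<Sum>i<n. w i * (\<Sum>j<n. A $$ (i, j) * w j))" by (simp add: sum_distrib_left)
  also have "(\<Sum>i<n. \<Sum>j<n. of_bool (i = j) * (A $$ (i, i) * (w i)\<^sup>2) - \<epsilon> * (((w i)\<^sup>2 + (w j)\<^sup>2) / 2))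
    = (\<Sum>i<n. A $$ (i, i) * (w i)\<^sup>2) - \<epsilon> * real n * (\<Sum>i<n. (w i)\<^sup>2)"
  proof -
    have 1: "(\<Sum>j<n. of_bool (i = j) * (A $$ (i, i) * (w i)\<^sup>2)) = A $$ (i, i) * (w i)\<^sup>2" if "i < n" for i
    proof -
      have "(\<Sum>j<n. of_bool (i = j) * (A $$ (i, i) * (w i)\<^sup>2)) = (\<Sum>j<n. if j = i then A $$ (i, i) * (w i)\<^sup>2 else 0)"
        by (intro sum.cong) auto
      then show ?thesis using that by simp
    qed
    have 2: "(\<Sum>i<n. \<Sum>j<n. \<epsilon> * (((w i)\<^sup>2 + (w j)\<^sup>2) / 2)) = \<epsilon> * real n * (\<Sum>i<n. (w i)\<^sup>2)"
      by (simp add: sum.distrib add_divide_distrib distrib_left flip: sum_distrib_left sum_divide_distrib)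
    show ?thesis using 1 2 by (simp add: sum_subtractf)
  qed
  also have "\<dots> = (\<Sum>i<n. (A $$ (i, i) - \<epsilon> * real n) * (w i)\<^sup>2)"
    by (simp add: left_diff_distrib sum_subtractf sum_distrib_left)
  finally show ?thesis .
qed

lemma pos_semidefI:
  assumes A: "A \<in> carrier_mat n n"
    and "\<And>w. 0 \<le> (\<Sum>i<n. w i * (\<Sum>j<n. A $$ (i, j) * w j))"
  shows "pos_semidef n A"
  unfolding pos_semidef_def
proof
  fix v :: "real vec" assume v: "v \<in> carrier_vec n"
  have "vec n (($) v) = v" using v by auto
  then have "(A *\<^sub>v v) $ i = (\<Sum>j<n. A $$ (i, j) * v $ j)" if "i < n" for i
    using mult_mat_vec_index[OF A that, of "($) v"] by simp
  then have "v \<bullet> (A *\<^sub>v v) = (\<Sum>i<n. v $ i * (\<Sum>j<n. A $$ (i, j) * v $ j))"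
    using A v by (simp add: scalar_prod_def atLeast0LessThan)
  then show "0 \<le> v \<bullet> (A *\<^sub>v v)" using assms(2)[of "($) v"] by simp
qed

text \<open>
  The maximum in the definition of \<open>\<nu>\<close> is taken over a nonempty set for every graph: a small
  multiple of the adjacency matrix subtracted from the identity is positive definite, and
  invertible matrices have the Strong Arnold Property.
\<close>

lemma nu_matrix_exists:
  "\<exists>A. A \<in> sym_mats n E \<and> strong_arnold n A \<and> pos_semidef n A"
proof -
  define e where "e = 1 / (real n + 1)"
  have e: "e > 0" "1 - e * real n > 0" unfolding e_def by (auto simp: field_simps)
  define A where "A = mat n n (\<lambda>(i, j). if i = j then 1 else if {i, j} \<in> E then - e else 0 :: real)"
  have cA: "A \<in> carrier_mat n n" unfolding A_def by simp
  have "A \<in> sym_mats n E" unfolding sym_mats_def A_def using e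
    by (auto simp: insert_commute)
  have bound: "(1 - e * real n) * (\<Sum>i<n. (w i)\<^sup>2) \<le> (\<Sum>i<n. w i * (\<Sum>j<n. A $$ (i, j) * w j))" for w
    using qform_diag_dominant[of n A e w] e by (simp add: A_def sum_distrib_left)
  have "pos_semidef n A"
  proof (rule pos_semidefI[OF cA])
    fix w show "0 \<le> (\<Sum>i<n. w i * (\<Sum>j<n. A $$ (i, j) * w j))"
      using bound[of w] e by (intro order_trans[OF _ bound]) (simp add: sum_nonneg)
  qed
  moreover have "det A \<noteq> 0"
  proof
    assume "det A = 0"
    then obtain v where v: "v \<in> carrier_vec n" "v \<noteq> 0\<^sub>v n" "A *\<^sub>v v = 0\<^sub>v n"
      using det_0_iff_vec_prod_zero[OF cA] by auto
    have "vec n (($) v) = v" using v by auto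
    then have "(\<Sum>j<n. A $$ (i, j) * v $ j) = 0" if "i < n" for i
      using mult_mat_vec_index[OF cA that, of "($) v"] v(3) that by simp
    then have "(1 - e * real n) * (\<Sum>i<n. (v $ i)\<^sup>2) \<le> 0" using bound[of "($) v"] by simp
    then have "(\<Sum>i<n. (v $ i)\<^sup>2) \<le> 0" using e by (simp add: mult_le_0_iff)
    then have "(\<Sum>i<n. (v $ i)\<^sup>2) = 0" using sum_nonneg[of "{..<n}" "\<lambda>i. (v $ i)\<^sup>2"] by simp
    then have "\<forall>i<n. v $ i = 0" by (subst (asm) sum_nonneg_eq_0_iff) auto
    then have "v = 0\<^sub>v n" using v(1) by (intro eq_vecI) auto
    then show False using v by simp
  qed
  ultimately show ?thesis using strong_arnold_if_det_nonzero[OF cA] \<open>A \<in> sym_mats n E\<close> by blast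
qed

text \<open>
  The determinant is \<open>(-1)\<^sup>n\<close> times the value of the monic characteristic polynomial at \<open>0\<close>, so the
  intermediate value theorem gives a root on the negative axis.
\<close>

lemma negative_eigenvalue_if_det_neg:
  fixes A :: "real mat"
  assumes A: "A \<in> carrier_mat n n" and det: "det A < 0"
  shows "\<exists>a<0. eigenvalue A a"
proof -
  define p where "p = Polynomial.smult ((-1) ^ n) (pcompose (char_poly A) [:0, -1:])"
  have "n \<noteq> 0" using A det by (intro notI) simp
  have mon: "degree (char_poly A) = n" "lead_coeff (char_poly A) = 1"
    using degree_monic_char_poly[OF A] by auto
  have pp: "poly p x = (-1) ^ n * poly (char_poly A) (- x)" for x
    unfolding p_def by (simp add: poly_pcompose)
  have "lead_coeff (pcompose (char_poly A) [:0, -1:]) = (-1) ^ n"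
    using lead_coeff_comp[of "[:0, -1:]" "char_poly A"] mon by simp
  then have "lead_coeff p = 1" unfolding p_def
    by (metis lead_coeff_smult minus_one_mult_self)
  then obtain K where K: "\<And>x. x \<ge> K \<Longrightarrow> 1 \<le> poly p x"
    using poly_pinfty_gt_lc[of p] by auto
  have "mat n n (\<lambda>(i, j). 0 * of_bool (i = j) - A $$ (i, j)) = (-1) \<cdot>\<^sub>m A"
    using A by (intro eq_matI) auto
  then have "poly (char_poly A) 0 = (-1) ^ n * det A"
    using poly_char_poly[OF A, of 0] A by simp
  then have "poly p 0 = det A" unfolding pp by (simp flip: mult.assoc power_add)
  then have "poly p 0 < 0" using det by simp
  moreover have "0 < poly p (max K 1)" using K[of "max K 1"] by simp
  moreover have "0 < max K 1" by (simp add: less_max_iff_disj)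
  ultimately obtain x where x: "0 < x" "poly p x = 0"
    using poly_IVT_pos[of 0 "max K 1" p] by auto
  then have "poly (char_poly A) (- x) = 0" unfolding pp by simp
  then show ?thesis using eigenvalue_root_char_poly[OF A] x(1) by (intro exI[of _ "- x"]) auto
qed

text \<open>
  The same for \<open>\<mu>\<close>, with the diagonal matrix \<open>diag(-1, 1, \<dots>, 1)\<close> in place of the identity. For a
  small multiple \<open>e\<close> of the adjacency matrix the determinant is still negative, which gives a negative
  eigenvalue, and the form is nonnegative on the vectors that vanish at the vertex \<open>0\<close>, which
  excludes a second one.
\<close>

lemma mu_matrix_exists:
  assumes n: "n \<ge> 1"
  shows "\<exists>A. A \<in> sym_mats n E \<and> strong_arnold n A \<and> num_neg_eigenvalues A = 1 \<and>
    (\<forall>i<n. \<forall>j<n. i \<noteq> j \<longrightarrow> A $$ (i, j) \<le> 0)"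
proof -
  define M where "M e = mat n n (\<lambda>(i, j). if i = j then (if i = 0 then -1 else 1)
    else if {i, j} \<in> E then - e else 0 :: real)" for e
  have cM: "M e \<in> carrier_mat n n" for e unfolding M_def by simp
  have "((\<lambda>e. det (M e)) \<longlongrightarrow> det (M 0)) (at_right 0)"
    unfolding det_def'[OF cM]
  proof (intro tendsto_intros)
    fix p i assume "p \<in> {p. p permutes {0..<n}}" "i \<in> {0..<n}"
    then have "i < n" "p i < n" using permutes_in_image[of p "{0..<n}" i] by auto
    then show "((\<lambda>e. M e $$ (i, p i)) \<longlongrightarrow> M 0 $$ (i, p i)) (at_right 0)"
      unfolding M_def by (auto intro!: tendsto_eq_intros)
  qed
  moreover have "det (M 0) = -1"
  proof -
    have "det (M 0) = prod_list (diag_mat (M 0))"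
      by (rule det_upper_triangular[OF _ cM]) (auto simp: upper_triangular_def M_def)
    also have "\<dots> = (\<Prod>i = 0..<n. if i = 0 then -1 else 1)"
      unfolding prod_list_diag_prod by (intro prod.cong) (auto simp: M_def)
    also have "\<dots> = -1" using n by simp
    finally show ?thesis .
  qed
  ultimately have "eventually (\<lambda>e. det (M e) < 0) (at_right 0)"
    by (intro order_tendstoD(2)) auto
  moreover have "eventually (\<lambda>e::real. e < 1 / (real n + 1)) (at_right 0)"
    using eventually_at_right_less[of "0::real"] by (intro eventually_at_rightI[of 0 "1 / (real n + 1)"]) auto
  moreover have "eventually (\<lambda>e::real. e > 0) (at_right 0)" by (rule eventually_at_right_less)
  ultimately have "eventually (\<lambda>e. det (M e) < 0 \<and> e < 1 / (real n + 1) \<and> e > 0) (at_right 0)"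
    by eventually_elim auto
  then obtain e where e: "det (M e) < 0" "e < 1 / (real n + 1)" "e > 0"
    using eventually_happens'[OF trivial_limit_at_right_real] by blast
  have en: "1 - e * real n > 0"
  proof -
    have "e * real n \<le> e * (real n + 1)" using e by simp
    also have "\<dots> < 1" using e(2) by (simp add: pos_less_divide_eq)
    finally show ?thesis by simp
  qed
  define A where "A = M e"
  have cA: "A \<in> carrier_mat n n" unfolding A_def by (rule cM)
  obtain a where a: "a < 0" "eigenvalue A a"
    using negative_eigenvalue_if_det_neg[OF cA] e(1) unfolding A_def by auto
  have "num_neg_eigenvalues A = 1"
  proof (rule num_neg_eigenvalues_eq_1[OF cA _ _ a])
    show "A $$ (i, j) = A $$ (j, i)" if "i < n" "j < n" for i j
      using that unfolding A_def M_def by (auto simp: insert_commute)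
    fix w :: "nat \<Rightarrow> real" assume "(\<Sum>i<n. of_bool (i = 0) * w i) = 0"
    moreover have "(\<Sum>i<n. of_bool (i = 0) * w i) = (\<Sum>i<n. if i = 0 then w i else 0)"
      by (intro sum.cong) auto
    ultimately have w0: "w 0 = 0" using n by simp
    have "0 \<le> (\<Sum>i<n. (A $$ (i, i) - e * real n) * (w i)\<^sup>2)"
      using w0 en by (intro sum_nonneg) (auto simp: A_def M_def)
    also have "\<dots> \<le> (\<Sum>i<n. w i * (\<Sum>j<n. A $$ (i, j) * w j))"
      using e by (intro qform_diag_dominant) (auto simp: A_def M_def)
    finally show "0 \<le> (\<Sum>i<n. w i * (\<Sum>j<n. A $$ (i, j) * w j))" .
  qed
  moreover have "A \<in> sym_mats n E" unfolding sym_mats_def A_def M_def using e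
    by (auto simp: insert_commute)
  moreover have "strong_arnold n A"
    using e(1) unfolding A_def by (intro strong_arnold_if_det_nonzero cM) simp
  moreover have "\<forall>i<n. \<forall>j<n. i \<noteq> j \<longrightarrow> A $$ (i, j) \<le> 0" using e unfolding A_def M_def by auto
  ultimately show ?thesis by blast
qed

text \<open>
  The three spectral parameters are maxima over sets of this shape, with different predicates \<open>Q\<close>.
\<close>

lemma finite_nullities:
  "finite {kernel_dim A | A. A \<in> sym_mats n E \<and> Q A}"
proof (rule finite_subset)
  show "{kernel_dim A | A. A \<in> sym_mats n E \<and> Q A} \<subseteq> {..n}"
    using kernel_dim_le unfolding sym_mats_def by auto
qed simp

lemma max_nullity_bound:
  assumes E: "E \<subseteq> nsets {..<n} 2" and ex: "\<exists>A. A \<in> sym_mats n E \<and> strong_arnold n A \<and> Q A"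
  defines "q \<equiv> Max {kernel_dim A | A. A \<in> sym_mats n E \<and> strong_arnold n A \<and> Q A}"
  shows "q * (q + 1) \<le> 2 * (n + card E)"
proof -
  have "q \<in> {kernel_dim A | A. A \<in> sym_mats n E \<and> strong_arnold n A \<and> Q A}"
    unfolding q_def using ex by (intro Max_in finite_nullities) auto
  then show ?thesis using strong_arnold_nullity_bound[OF _ _ E] by auto
qed

lemma cdv_bounds:
  assumes E: "E \<subseteq> nsets {..<n} 2"
  shows cdv_xi_bound: "cdv_xi n E * (cdv_xi n E + 1) \<le> 2 * (n + card E)"
    and cdv_nu_bound: "cdv_nu n E * (cdv_nu n E + 1) \<le> 2 * (n + card E)"
    and cdv_mu_bound: "n \<ge> 1 \<Longrightarrow> cdv_mu n E * (cdv_mu n E + 1) \<le> 2 * (n + card E)"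
  using max_nullity_bound[OF E, of "\<lambda>_. True"] max_nullity_bound[OF E nu_matrix_exists]
    max_nullity_bound[OF E mu_matrix_exists] nu_matrix_exists[of n E]
  unfolding cdv_xi_def cdv_nu_def cdv_mu_def by auto

lemma cdv_ge:
  assumes "A \<in> sym_mats n E" "strong_arnold n A"
  shows cdv_xi_ge: "kernel_dim A \<le> cdv_xi n E"
    and cdv_nu_ge: "pos_semidef n A \<Longrightarrow> kernel_dim A \<le> cdv_nu n E"
    and cdv_mu_ge: "num_neg_eigenvalues A = 1 \<Longrightarrow> (\<forall>i<n. \<forall>j<n. i \<noteq> j \<longrightarrow> A $$ (i, j) \<le> 0)
      \<Longrightarrow> kernel_dim A \<le> cdv_mu n E"
  unfolding cdv_xi_def cdv_nu_def cdv_mu_def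
  using assms by (auto intro!: Max_ge finite_nullities)

lemma cdv_nu_le_xi: "cdv_nu n E \<le> cdv_xi n E"
proof -
  have "cdv_nu n E \<in> {kernel_dim A | A. A \<in> sym_mats n E \<and> strong_arnold n A \<and> pos_semidef n A}"
    unfolding cdv_nu_def using nu_matrix_exists by (intro Max_in finite_nullities) auto
  then show ?thesis using cdv_xi_ge by auto
qed

section \<open>Split graphs and their matrices\<close>

text \<open>
  A complete bipartite graph or, if \<open>full\<close> holds, the join of an independent set \<open>S\<close> and
  a clique \<open>Y\<close>.
\<close>

definition split_graph :: "nat set \<Rightarrow> nat set \<Rightarrow> bool \<Rightarrow> nat set set" where
  "split_graph S Y full = {{s, y} | s y. s \<in> S \<and> y \<in> Y} \<union> (if full then nsets Y 2 else {})"

lemma split_graph_sym: "split_graph S Y False = split_graph Y S False"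
  unfolding split_graph_def by (auto simp: insert_commute)

lemma doubleton_in_split_graph:
  assumes "S \<inter> Y = {}" "u \<noteq> v"
  shows "{u, v} \<in> split_graph S Y full \<longleftrightarrow>
    u \<in> S \<and> v \<in> Y \<or> u \<in> Y \<and> v \<in> S \<or> full \<and> u \<in> Y \<and> v \<in> Y"
  using assms unfolding split_graph_def by (auto simp: doubleton_eq_iff)

lemma split_graph_subset:
  assumes "S \<subseteq> V" "Y \<subseteq> V" "S \<inter> Y = {}"
  shows "split_graph S Y full \<subseteq> nsets V 2"
proof -
  have "nsets Y 2 \<subseteq> nsets V 2" using assms(2) by (rule nsets_mono)
  then show ?thesis using assms unfolding split_graph_def by auto
qed

lemma edge_set_eqI:
  assumes "E \<subseteq> nsets V 2" "F \<subseteq> nsets V 2"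
    and "\<And>u v. u \<in> V \<Longrightarrow> v \<in> V \<Longrightarrow> u \<noteq> v \<Longrightarrow> {u, v} \<in> E \<longleftrightarrow> {u, v} \<in> F"
  shows "E = F"
proof (rule Set.set_eqI)
  fix e
  show "e \<in> E \<longleftrightarrow> e \<in> F"
  proof (cases "e \<in> nsets V 2")
    case True
    then obtain u v where "e = {u, v}" "u \<in> V" "v \<in> V" "u \<noteq> v" by (rule nsets2_E)
    then show ?thesis using assms(3) by simp
  next
    case False
    then show ?thesis using assms(1,2) by blast
  qed
qed

text \<open>
  The data of a block matrix with blocks \<open>I\<close> on \<open>S\<close>, \<open>Q\<close> between \<open>S\<close> and \<open>Y\<close>, \<open>Q\<^sup>T Q - c J\<close> on \<open>Y\<close>,
  extended by the identity on the other vertices. The Schur complement of its \<open>S\<close>-block is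
  \<open>- c J\<close>, so the vectors \<open>(- Q y, y)\<close> with \<open>\<Sum>y = 0\<close> lie in the kernel.

  The form \<open>g J + d I\<close> of \<open>Q\<^sup>T Q\<close> makes the off-diagonal entries on \<open>Y\<close> all equal to \<open>g - c\<close>, so \<open>Y\<close>
  is a clique or an independent set. The condition \<open>sep\<close> is what the Strong Arnold Property
  takes: either \<open>Y\<close> is a clique, or \<open>Q\<close> is injective.
\<close>

locale schur_form =
  fixes n :: nat and S Y :: "nat set" and Q :: "nat \<Rightarrow> nat \<Rightarrow> real" and g d c :: real
  assumes S: "S \<subseteq> {..<n}" and Y: "Y \<subseteq> {..<n}" and disj: "S \<inter> Y = {}" and Yne: "Y \<noteq> {}"
    and gram: "y \<in> Y \<Longrightarrow> y' \<in> Y \<Longrightarrow> (\<Sum>s\<in>S. Q s y * Q s y') = g + d * of_bool (y = y')"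
    and nz: "s \<in> S \<Longrightarrow> y \<in> Y \<Longrightarrow> Q s y \<noteq> 0"
    and g0: "g \<ge> 0" and d0: "d \<ge> 0" and sep: "d > 0 \<or> g \<noteq> c"
begin

lemma finS: "finite S" and finY: "finite Y"
  using S Y finite_subset by auto

text \<open>
  Row \<open>t\<close> of the block matrix \<open>(I Q)\<close>, whose Gram matrix is the positive semidefinite part of
  \<open>schur_mat\<close>.
\<close>

definition row_fun :: "nat \<Rightarrow> nat \<Rightarrow> real" where
  "row_fun t i = (if i \<in> S then of_bool (i = t) else if i \<in> Y then Q t i else 0)"

definition schur_mat :: "real mat" where
  "schur_mat = mat n n (\<lambda>(i, j). (\<Sum>t\<in>S. row_fun t i * row_fun t j)
     + of_bool (i = j \<and> i \<notin> S \<union> Y) - c * of_bool (i \<in> Y \<and> j \<in> Y))"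

lemma schur_mat_carrier: "schur_mat \<in> carrier_mat n n"
  unfolding schur_mat_def by simp

lemma schur_mat_index: "i < n \<Longrightarrow> j < n \<Longrightarrow> schur_mat $$ (i, j) = (\<Sum>t\<in>S. row_fun t i * row_fun t j)
     + of_bool (i = j \<and> i \<notin> S \<union> Y) - c * of_bool (i \<in> Y \<and> j \<in> Y)"
  unfolding schur_mat_def by simp

lemma in_S: "i \<in> S \<Longrightarrow> i < n \<and> i \<notin> Y" and in_Y: "i \<in> Y \<Longrightarrow> i < n \<and> i \<notin> S"
  using S Y disj by auto

lemma schur_mat_sym: "i < n \<Longrightarrow> j < n \<Longrightarrow> schur_mat $$ (i, j) = schur_mat $$ (j, i)"
  unfolding schur_mat_def by (auto simp: mult.commute)

lemma sum_row_fun_S: "i \<in> S \<Longrightarrow> (\<Sum>t\<in>S. row_fun t i * f t) = f i"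
proof -
  assume i: "i \<in> S"
  then have "(\<Sum>t\<in>S. row_fun t i * f t) = (\<Sum>t\<in>S. if t = i then f t else 0)"
    by (intro sum.cong) (auto simp: row_fun_def)
  then show ?thesis using i finS by simp
qed

lemma sum_row_fun_Y: "i \<in> Y \<Longrightarrow> (\<Sum>t\<in>S. row_fun t i * f t) = (\<Sum>t\<in>S. Q t i * f t)"
  using disj by (intro sum.cong) (auto simp: row_fun_def)

lemma sum_row_fun_out: "i \<notin> S \<union> Y \<Longrightarrow> (\<Sum>t\<in>S. row_fun t i * f t) = 0"
  by (simp add: row_fun_def)

lemma entry_S: "i \<in> S \<Longrightarrow> j < n \<Longrightarrow> schur_mat $$ (i, j) = row_fun i j"
  using schur_mat_index[of i j] in_S[of i] by (simp add: sum_row_fun_S)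

lemma entry_YY: "i \<in> Y \<Longrightarrow> j \<in> Y \<Longrightarrow> schur_mat $$ (i, j) = g + d * of_bool (i = j) - c"
proof -
  assume ij: "i \<in> Y" "j \<in> Y"
  then have "(\<Sum>t\<in>S. row_fun t i * row_fun t j) = (\<Sum>t\<in>S. Q t i * Q t j)"
    using disj by (intro sum.cong) (auto simp: row_fun_def)
  then show ?thesis using schur_mat_index[of i j] ij in_Y[of i] in_Y[of j] gram[OF ij] by simp
qed

lemma entry_out: "i \<notin> S \<union> Y \<Longrightarrow> i < n \<Longrightarrow> j < n \<Longrightarrow> schur_mat $$ (i, j) = of_bool (i = j)"
  by (auto simp: schur_mat_index sum_row_fun_out)

text \<open>
  The entry at \<open>t\<close> of the product of \<open>(I Q)\<close> with the vector \<open>w\<close>.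
\<close>

definition row_value :: "nat \<Rightarrow> (nat \<Rightarrow> real) \<Rightarrow> real" where
  "row_value t w = (\<Sum>j<n. row_fun t j * w j)"

lemma row_value_eq: "t \<in> S \<Longrightarrow> row_value t w = w t + (\<Sum>y\<in>Y. Q t y * w y)"
proof -
  assume t: "t \<in> S"
  have "row_value t w = (\<Sum>j\<in>S \<union> Y. row_fun t j * w j)"
    unfolding row_value_def using S Y by (intro sum.mono_neutral_right) (auto simp: row_fun_def)
  also have "\<dots> = (\<Sum>j\<in>S. row_fun t j * w j) + (\<Sum>j\<in>Y. row_fun t j * w j)"
    using finS finY disj by (rule sum.union_disjoint)
  also have "(\<Sum>j\<in>S. row_fun t j * w j) = (\<Sum>j\<in>S. if j = t then w j else 0)"
    by (intro sum.cong) (auto simp: row_fun_def)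
  also have "\<dots> = w t" using t finS by simp
  also have "(\<Sum>j\<in>Y. row_fun t j * w j) = (\<Sum>y\<in>Y. Q t y * w y)"
    using disj by (intro sum.cong) (auto simp: row_fun_def)
  finally show ?thesis .
qed

lemma schur_mat_row:
  assumes i: "i < n"
  shows "(\<Sum>j<n. schur_mat $$ (i, j) * w j) = (\<Sum>t\<in>S. row_fun t i * row_value t w)
    + of_bool (i \<notin> S \<union> Y) * w i - c * of_bool (i \<in> Y) * (\<Sum>y\<in>Y. w y)"
proof -
  have "(\<Sum>j<n. schur_mat $$ (i, j) * w j) = (\<Sum>j<n. (\<Sum>t\<in>S. row_fun t i * (row_fun t j * w j))
    + of_bool (i = j) * (of_bool (i \<notin> S \<union> Y) * w j) - c * of_bool (i \<in> Y) * (of_bool (j \<in> Y) * w j))"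
  proof (rule sum.cong[OF HOL.refl])
    fix j assume "j \<in> {..<n}"
    then have "schur_mat $$ (i, j) * w j = ((\<Sum>t\<in>S. row_fun t i * row_fun t j)
      + of_bool (i = j \<and> i \<notin> S \<union> Y) - c * of_bool (i \<in> Y \<and> j \<in> Y)) * w j"
      using i by (simp add: schur_mat_def)
    also have "\<dots> = (\<Sum>t\<in>S. row_fun t i * (row_fun t j * w j))
    + of_bool (i = j) * (of_bool (i \<notin> S \<union> Y) * w j) - c * of_bool (i \<in> Y) * (of_bool (j \<in> Y) * w j)"
      by (simp only: left_diff_distrib distrib_right sum_distrib_right of_bool_conj mult.assoc)
    finally show "schur_mat $$ (i, j) * w j = (\<Sum>t\<in>S. row_fun t i * (row_fun t j * w j))
    + of_bool (i = j) * (of_bool (i \<notin> S \<union> Y) * w j) - c * of_bool (i \<in> Y) * (of_bool (j \<in> Y) * w j)" .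
  qed
  also have "\<dots> = (\<Sum>j<n. \<Sum>t\<in>S. row_fun t i * (row_fun t j * w j))
    + (\<Sum>j<n. of_bool (i = j) * (of_bool (i \<notin> S \<union> Y) * w j))
    - c * of_bool (i \<in> Y) * (\<Sum>j<n. of_bool (j \<in> Y) * w j)"
    by (simp only: sum.distrib sum_subtractf sum_distrib_left)
  also have "(\<Sum>j<n. \<Sum>t\<in>S. row_fun t i * (row_fun t j * w j)) = (\<Sum>t\<in>S. row_fun t i * row_value t w)"
    unfolding row_value_def by (subst sum.swap) (simp add: sum_distrib_left)
  also have "(\<Sum>j<n. of_bool (i = j) * (of_bool (i \<notin> S \<union> Y) * w j))
    = (\<Sum>j<n. if j = i then of_bool (i \<notin> S \<union> Y) * w j else 0)"
    by (intro sum.cong) auto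
  also have "\<dots> = of_bool (i \<notin> S \<union> Y) * w i" using i by simp
  also have "(\<Sum>j<n. of_bool (j \<in> Y) * w j) = (\<Sum>j\<in>Y. of_bool (j \<in> Y) * w j)"
    using Y by (intro sum.mono_neutral_right) auto
  also have "\<dots> = (\<Sum>y\<in>Y. w y)" by (intro sum.cong) auto
  finally show ?thesis .
qed

lemma schur_mat_row_S: "i \<in> S \<Longrightarrow> (\<Sum>j<n. schur_mat $$ (i, j) * w j) = row_value i w"
  using schur_mat_row[of i w] in_S[of i] by (simp add: sum_row_fun_S)

lemma schur_mat_row_Y: "i \<in> Y \<Longrightarrow> (\<Sum>j<n. schur_mat $$ (i, j) * w j) = (\<Sum>t\<in>S. Q t i * row_value t w) - c * (\<Sum>y\<in>Y. w y)"
  using schur_mat_row[of i w] in_Y[of i] by (simp add: sum_row_fun_Y)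

lemma schur_mat_row_out: "i \<notin> S \<union> Y \<Longrightarrow> i < n \<Longrightarrow> (\<Sum>j<n. schur_mat $$ (i, j) * w j) = w i"
  using schur_mat_row[of i w] by (auto simp: sum_row_fun_out)

lemma qform_ge:
  "- c * (\<Sum>y\<in>Y. w y)\<^sup>2 \<le> (\<Sum>i<n. w i * (\<Sum>j<n. schur_mat $$ (i, j) * w j))"
proof -
  have "(\<Sum>i<n. w i * (\<Sum>j<n. schur_mat $$ (i, j) * w j)) = (\<Sum>i<n. (\<Sum>t\<in>S. row_value t w * (row_fun t i * w i))
    + of_bool (i \<notin> S \<union> Y) * (w i * w i) - c * (\<Sum>y\<in>Y. w y) * (of_bool (i \<in> Y) * w i))"
  proof (rule sum.cong[OF HOL.refl])
    fix i assume "i \<in> {..<n}"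
    have "w i * (\<Sum>t\<in>S. row_fun t i * row_value t w) = (\<Sum>t\<in>S. row_value t w * (row_fun t i * w i))"
      by (simp add: sum_distrib_left mult_ac)
    moreover have "w i * (p + x * w i - c * y * z) = w i * p + x * (w i * w i) - c * z * (y * w i)"
      for p x y z by (simp add: algebra_simps)
    ultimately show "w i * (\<Sum>j<n. schur_mat $$ (i, j) * w j) = (\<Sum>t\<in>S. row_value t w * (row_fun t i * w i))
      + of_bool (i \<notin> S \<union> Y) * (w i * w i) - c * (\<Sum>y\<in>Y. w y) * (of_bool (i \<in> Y) * w i)"
      using schur_mat_row[of i w] \<open>i \<in> {..<n}\<close> by simp
  qed
  also have "\<dots> = (\<Sum>i<n. \<Sum>t\<in>S. row_value t w * (row_fun t i * w i))
    + (\<Sum>i<n. of_bool (i \<notin> S \<union> Y) * (w i * w i)) - c * (\<Sum>y\<in>Y. w y) * (\<Sum>i<n. of_bool (i \<in> Y) * w i)"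
    by (simp only: sum.distrib sum_subtractf sum_distrib_left)
  also have "(\<Sum>i<n. \<Sum>t\<in>S. row_value t w * (row_fun t i * w i)) = (\<Sum>t\<in>S. row_value t w * row_value t w)"
    by (subst sum.swap) (simp add: sum_distrib_left[symmetric] row_value_def)
  also have "(\<Sum>i<n. of_bool (i \<in> Y) * w i) = (\<Sum>i\<in>Y. of_bool (i \<in> Y) * w i)"
    using Y by (intro sum.mono_neutral_right) auto
  also have "\<dots> = (\<Sum>y\<in>Y. w y)" by (intro sum.cong) auto
  finally have "(\<Sum>i<n. w i * (\<Sum>j<n. schur_mat $$ (i, j) * w j)) = (\<Sum>t\<in>S. row_value t w * row_value t w)
    + (\<Sum>i<n. of_bool (i \<notin> S \<union> Y) * (w i * w i)) - c * (\<Sum>y\<in>Y. w y) * (\<Sum>y\<in>Y. w y)" .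
  moreover have "0 \<le> (\<Sum>t\<in>S. row_value t w * row_value t w)" "0 \<le> (\<Sum>i<n. of_bool (i \<notin> S \<union> Y) * (w i * w i))"
    by (auto intro!: sum_nonneg)
  ultimately show ?thesis by (simp add: power2_eq_square)
qed

text \<open>
  The vectors \<open>b\<close> arise from \<open>e\<^sub>y - e\<^sub>z\<close> on \<open>Y\<close>, for a fixed element \<open>z\<close> of \<open>Y\<close> (called \<open>y0\<close> in the
  proof), by the extension to \<open>S\<close> that the kernel prescribes.
\<close>

lemma kernel_dim_schur_mat: "card Y - 1 \<le> kernel_dim schur_mat"
proof -
  obtain y0 where y0: "y0 \<in> Y" using Yne by auto
  have card: "card (Y - {y0}) = card Y - 1" using y0 finY by simp
  obtain h where h: "bij_betw h {..<card Y - 1} (Y - {y0})"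
    using ex_bij_betw_nat_finite[of "Y - {y0}"] finY card atLeast0LessThan by auto
  have hY: "h a \<in> Y" "h a \<noteq> y0" if "a < card Y - 1" for a
    using h that unfolding bij_betw_def by auto
  define b where "b a i = (if i \<in> Y then of_bool (i = h a) - of_bool (i = y0)
    else if i \<in> S then Q i y0 - Q i (h a) else 0)" for a i
  have pick: "(\<Sum>y\<in>Y. f y * b a y) = f (h a) - f y0" if "a < card Y - 1" for f a
  proof -
    have "(\<Sum>y\<in>Y. f y * b a y) = (\<Sum>y\<in>Y. (if y = h a then f y else 0) - (if y = y0 then f y else 0))"
      by (intro sum.cong) (auto simp: b_def)
    then show ?thesis using hY[OF that] y0 finY by (simp add: sum_subtractf)
  qed
  show ?thesis
  proof (rule kernel_dim_ge[OF schur_mat_carrier])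
    fix a i assume a: "a < card Y - 1" and i: "i < n"
    have L0: "row_value t (b a) = 0" if "t \<in> S" for t
      unfolding row_value_eq[OF that] pick[OF a] using that disj by (auto simp: b_def)
    have s0: "(\<Sum>y\<in>Y. b a y) = 0" using pick[OF a, of "\<lambda>_. 1"] by simp
    show "(\<Sum>j<n. schur_mat $$ (i, j) * b a j) = 0"
    proof -
      have "of_bool (i \<notin> S \<union> Y) * b a i = 0" by (simp add: b_def)
      then show ?thesis unfolding schur_mat_row[OF i] s0 using L0 by simp
    qed
  next
    fix e a assume z: "\<And>i. i < n \<Longrightarrow> (\<Sum>a<card Y - 1. e a * b a i) = 0" and a: "a < card Y - 1"
    have "h a < n" using hY[OF a] Y by auto
    have "(\<Sum>a'<card Y - 1. e a' * b a' (h a)) = (\<Sum>a'<card Y - 1. if a' = a then e a' else 0)"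
    proof (rule sum.cong[OF HOL.refl])
      fix a' assume "a' \<in> {..<card Y - 1}"
      then have "h a = h a' \<longleftrightarrow> a = a'" using h a unfolding bij_betw_def inj_on_def by auto
      then show "e a' * b a' (h a) = (if a' = a then e a' else 0)"
        using hY[OF a] by (auto simp: b_def)
    qed
    also have "\<dots> = e a" using a by simp
    finally show "e a = 0" using z[OF \<open>h a < n\<close>] by simp
  qed
qed

lemma schur_mat_sym_mats: "schur_mat \<in> sym_mats n (split_graph S Y (g \<noteq> c))"
proof -
  have "transpose_mat schur_mat = schur_mat" using schur_mat_carrier schur_mat_sym by (intro eq_matI) auto
  moreover have "schur_mat $$ (i, j) \<noteq> 0 \<longleftrightarrow> {i, j} \<in> split_graph S Y (g \<noteq> c)"
    if ij: "i < n" "j < n" "i \<noteq> j" for i j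
  proof -
    have edge: "{i, j} \<in> split_graph S Y (g \<noteq> c) \<longleftrightarrow>
      i \<in> S \<and> j \<in> Y \<or> i \<in> Y \<and> j \<in> S \<or> (g \<noteq> c \<and> i \<in> Y \<and> j \<in> Y)"
      using ij unfolding split_graph_def by (auto simp: doubleton_eq_iff)
    consider "i \<in> S" | "j \<in> S" | "i \<in> Y" "j \<in> Y" | "i \<notin> S \<union> Y" | "j \<notin> S \<union> Y" by auto
    then show ?thesis
    proof cases
      case 1 then show ?thesis unfolding edge entry_S[OF 1 ij(2)] using ij disj nz by (auto simp: row_fun_def)
    next
      case 2 then show ?thesis unfolding edge schur_mat_sym[OF ij(1,2)] entry_S[OF 2 ij(1)]
        using ij disj nz by (auto simp: row_fun_def)
    next
      case 3 then show ?thesis unfolding edge entry_YY[OF 3] using ij disj by auto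
    next
      case 4 then show ?thesis unfolding edge entry_out[OF 4 ij(1,2)] using ij by auto
    next
      case 5 then show ?thesis unfolding edge schur_mat_sym[OF ij(1,2)] entry_out[OF 5 ij(2,1)] using ij by auto
    qed
  qed
  ultimately show ?thesis using schur_mat_carrier unfolding sym_mats_def by blast
qed

text \<open>
  Expanding \<open>0 = |Q f|\<^sup>2\<close> gives \<open>0 = g (\<Sum>f)\<^sup>2 + d |f|\<^sup>2\<close>.
\<close>

lemma gram_injective:
  assumes d: "d > 0" and z: "\<And>s. s \<in> S \<Longrightarrow> (\<Sum>y\<in>Y. Q s y * f y) = 0" and y: "y \<in> Y"
  shows "f y = 0"
proof -
  have "0 = (\<Sum>s\<in>S. (\<Sum>y\<in>Y. Q s y * f y) * (\<Sum>y\<in>Y. Q s y * f y))" using z by simp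
  also have "\<dots> = (\<Sum>s\<in>S. \<Sum>y\<in>Y. \<Sum>y'\<in>Y. f y * f y' * (Q s y * Q s y'))"
    by (simp add: sum_product mult_ac)
  also have "\<dots> = (\<Sum>y\<in>Y. \<Sum>s\<in>S. \<Sum>y'\<in>Y. f y * f y' * (Q s y * Q s y'))" by (rule sum.swap)
  also have "\<dots> = (\<Sum>y\<in>Y. \<Sum>y'\<in>Y. \<Sum>s\<in>S. f y * f y' * (Q s y * Q s y'))"
    by (rule sum.cong[OF HOL.refl]) (rule sum.swap)
  also have "\<dots> = (\<Sum>y\<in>Y. \<Sum>y'\<in>Y. f y * f y' * (g + d * of_bool (y = y')))"
    using gram by (intro sum.cong) (auto simp flip: sum_distrib_left)
  also have "\<dots> = (\<Sum>y\<in>Y. \<Sum>y'\<in>Y. g * (f y * f y') + (if y' = y then d * (f y * f y) else 0))"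
    by (intro sum.cong) (auto simp: algebra_simps)
  also have "\<dots> = g * ((\<Sum>y\<in>Y. f y) * (\<Sum>y\<in>Y. f y)) + d * (\<Sum>y\<in>Y. f y * f y)"
  proof -
    have "(\<Sum>y\<in>Y. f y) * (\<Sum>y\<in>Y. f y) = (\<Sum>y\<in>Y. \<Sum>y'\<in>Y. f y * f y')" by (rule sum_product)
    then have "(\<Sum>y\<in>Y. \<Sum>y'\<in>Y. g * (f y * f y')) = g * ((\<Sum>y\<in>Y. f y) * (\<Sum>y\<in>Y. f y))"
      by (simp only: sum_distrib_left)
    moreover have "(\<Sum>y\<in>Y. \<Sum>y'\<in>Y. if y' = y then d * (f y * f y) else 0) = d * (\<Sum>y\<in>Y. f y * f y)"
      using finY by (simp add: sum_distrib_left)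
    ultimately show ?thesis by (simp only: sum.distrib)
  qed
  finally have "g * ((\<Sum>y\<in>Y. f y) * (\<Sum>y\<in>Y. f y)) + d * (\<Sum>y\<in>Y. f y * f y) = 0" by simp
  moreover have "0 \<le> g * ((\<Sum>y\<in>Y. f y) * (\<Sum>y\<in>Y. f y))" using g0 by simp
  moreover have "0 \<le> d * (\<Sum>y\<in>Y. f y * f y)" using d by (simp add: sum_nonneg)
  ultimately have "d * (\<Sum>y\<in>Y. f y * f y) = 0" by linarith
  then have "(\<Sum>y\<in>Y. f y * f y) = 0" using d by simp
  then have "\<forall>y\<in>Y. f y * f y = 0" using finY by (subst (asm) sum_nonneg_eq_0_iff) auto
  then show ?thesis using y by simp
qed

text \<open>
  Let \<open>X\<close> be as in the definition of the property. The rows outside \<open>S\<close> and \<open>Y\<close> of \<open>A X = 0\<close> say that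
  \<open>X\<close> is zero there; the rows in \<open>S\<close> say \<open>X\<^sub>S = - Q X\<^sub>Y\<close>. As \<open>X\<close> is zero on the edges between \<open>S\<close> and \<open>Y\<close>,
  this gives \<open>X\<^sub>S\<^sub>S = 0\<close> and \<open>Q X\<^sub>Y\<^sub>Y = 0\<close>. Finally \<open>X\<^sub>Y\<^sub>Y = 0\<close>, because \<open>Y\<close> is a clique or \<open>Q\<close> is injective.
\<close>

lemma schur_mat_strong_arnold: "strong_arnold n schur_mat"
  unfolding strong_arnold_def
proof
  let ?E = "split_graph S Y (g \<noteq> c)"
  assume "\<exists>X\<in>carrier_mat n n. transpose_mat X = X \<and> X \<noteq> 0\<^sub>m n n \<and> schur_mat * X = 0\<^sub>m n n \<and>
    hadamard_mult schur_mat X = 0\<^sub>m n n \<and> hadamard_mult (1\<^sub>m n) X = 0\<^sub>m n n"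
  then obtain X where cX: "X \<in> carrier_mat n n" and tX: "transpose_mat X = X" and X0: "X \<noteq> 0\<^sub>m n n"
    and MX: "schur_mat * X = 0\<^sub>m n n" and HM: "hadamard_mult schur_mat X = 0\<^sub>m n n"
    and H1: "hadamard_mult (1\<^sub>m n) X = 0\<^sub>m n n" by auto
  define x where "x i j = X $$ (i, j)" for i j
  have xsym: "x i j = x j i" if "i < n" "j < n" for i j
    using arg_cong[OF tX, of "\<lambda>X. X $$ (i, j)"] that cX unfolding x_def by simp
  have diag: "x i i = 0" if "i < n" for i
    using arg_cong[OF H1, of "\<lambda>X. X $$ (i, i)"] that cX unfolding x_def hadamard_mult_def by simp
  have edge: "x i j = 0" if "i < n" "j < n" "schur_mat $$ (i, j) \<noteq> 0" for i j
    using arg_cong[OF HM, of "\<lambda>X. X $$ (i, j)"] that schur_mat_carrier unfolding x_def hadamard_mult_def by simp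
  have row: "(\<Sum>k<n. schur_mat $$ (i, k) * x k j) = 0" if "i < n" "j < n" for i j
  proof -
    have "(schur_mat * X) $$ (i, j) = (\<Sum>k<n. schur_mat $$ (i, k) * x k j)"
      using that cX schur_mat_carrier
      by (auto simp: x_def scalar_prod_def row_def col_def atLeast0LessThan intro!: sum.cong)
    then show ?thesis using MX that by simp
  qed
  have SY: "x s y = 0" if "s \<in> S" "y \<in> Y" for s y
  proof -
    have "s < n" "y < n" "y \<notin> S" using that S Y disj by auto
    then show ?thesis using that nz entry_S[of s y] by (intro edge) (auto simp: row_fun_def)
  qed
  have YY: "x y y' = 0" if yy: "y \<in> Y" "y' \<in> Y" for y y'
  proof (cases "y = y'")
    case True
    then show ?thesis using diag yy Y by auto
  next
    case False
    have lt: "y < n" "y' < n" using yy Y by auto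
    from sep show ?thesis
    proof
      assume "g \<noteq> c"
      then show ?thesis using entry_YY[OF yy] False lt by (intro edge) auto
    next
      assume d: "d > 0"
      show ?thesis
      proof (rule gram_injective[OF d _ yy(1), where f = "\<lambda>y. x y y'"])
        fix s assume s: "s \<in> S"
        have "row_value s (\<lambda>k. x k y') = 0" using row[of s y'] schur_mat_row_S[OF s] s S lt by auto
        then show "(\<Sum>y\<in>Y. Q s y * x y y') = 0" using row_value_eq[OF s] SY[OF s yy(2)] by simp
      qed
    qed
  qed
  have SS: "x s s' = 0" if s: "s \<in> S" "s' \<in> S" for s s'
  proof -
    have lt: "s < n" "s' < n" using s S by auto
    have "row_value s (\<lambda>k. x k s') = 0" using row[OF lt] schur_mat_row_S[OF s(1)] by simp
    moreover have "x y s' = 0" if "y \<in> Y" for y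
      using SY[OF s(2) that] xsym[of y s'] lt that Y by auto
    ultimately show ?thesis using row_value_eq[OF s(1), of "\<lambda>k. x k s'"] by simp
  qed
  have out: "x i j = 0" if "i \<notin> S \<union> Y" "i < n" "j < n" for i j
    using row[OF that(2,3)] schur_mat_row_out[OF that(1,2)] by simp
  have "x i j = 0" if "i < n" "j < n" for i j
  proof (cases "i \<in> S \<union> Y \<and> j \<in> S \<union> Y")
    case True
    then show ?thesis using SY SS YY xsym[OF that] by auto
  next
    case False
    then show ?thesis using out[of i j] out[of j i] xsym[OF that] that by auto
  qed
  then have "X = 0\<^sub>m n n" using cX unfolding x_def by (intro eq_matI) auto
  then show False using X0 by simp
qed

lemma schur_mat_pos_semidef:
  assumes "c = 0"
  shows "pos_semidef n schur_mat"
proof (rule pos_semidefI[OF schur_mat_carrier])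
  fix w show "0 \<le> (\<Sum>i<n. w i * (\<Sum>j<n. schur_mat $$ (i, j) * w j))" using qform_ge[of w] assms by simp
qed

text \<open>
  The form is nonnegative on the vectors with sum \<open>0\<close> on \<open>Y\<close>. A negative eigenvalue is found with an
  eigenvector that is \<open>1\<close> on \<open>Y\<close> and a multiple of \<open>Q 1\<close> on \<open>S\<close>; it works since \<open>1\<close> is an
  eigenvector of \<open>Q\<^sup>T Q\<close>.
\<close>

lemma schur_mat_one_negative:
  assumes c: "c > 0"
  shows "num_neg_eigenvalues schur_mat = 1"
proof -
  define q where "q = real (card Y)"
  define k where "k = g * q + d"
  define r where "r s = (\<Sum>y\<in>Y. Q s y)" for s
  have q: "q > 0" unfolding q_def using finY Yne by (simp add: card_gt_0_iff)
  have kr: "(\<Sum>s\<in>S. Q s y * r s) = k" if y: "y \<in> Y" for y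
  proof -
    have "(\<Sum>s\<in>S. Q s y * r s) = (\<Sum>s\<in>S. \<Sum>y'\<in>Y. Q s y * Q s y')"
      unfolding r_def by (simp add: sum_distrib_left)
    also have "\<dots> = (\<Sum>y'\<in>Y. \<Sum>s\<in>S. Q s y * Q s y')" by (rule sum.swap)
    also have "\<dots> = (\<Sum>y'\<in>Y. g + (if y' = y then d else 0))"
      using gram y by (intro sum.cong) auto
    also have "\<dots> = k" unfolding k_def q_def using y finY by (simp add: sum.distrib mult.commute)
    finally show ?thesis .
  qed
  define \<beta> where "\<beta> = 1 + k - c * q"
  \<comment> \<open>The eigenvalue equation on \<open>Y\<close> reads \<open>a\<^sup>2 = \<beta> a + c q\<close>. The product of its roots is \<open>- c q < 0\<close>,
  and \<open>a\<close> is its negative root.\<close>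
  define D where "D = sqrt (\<beta>\<^sup>2 + 4 * (c * q))"
  define a where "a = (\<beta> - D) / 2"
  have cq: "c * q > 0" using c q by simp
  have D2: "D * D = \<beta>\<^sup>2 + 4 * (c * q)" unfolding D_def using cq by simp
  have "\<bar>\<beta>\<bar> < D" unfolding D_def using cq by (intro real_less_rsqrt) simp
  then have a: "a < 0" unfolding a_def by (simp add: abs_less_iff)
  have root: "a * a = \<beta> * a + c * q"
    using D2 unfolding a_def by (simp add: field_simps power2_eq_square)
  define u where "u i = (if i \<in> Y then 1 else if i \<in> S then r i / (a - 1) else 0)" for i
  have uS: "u i = r i / (a - 1)" if "i \<in> S" for i using that disj unfolding u_def by auto
  have Lu: "row_value t u = a * (r t / (a - 1))" if t: "t \<in> S" for t
  proof -
    have "(\<Sum>y\<in>Y. Q t y * u y) = r t" unfolding r_def by (intro sum.cong) (auto simp: u_def)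
    then have "row_value t u = r t / (a - 1) + r t" unfolding row_value_eq[OF t] uS[OF t] by simp
    then show ?thesis using a by (simp add: field_simps)
  qed
  have su: "(\<Sum>y\<in>Y. u y) = q" unfolding q_def by (simp add: u_def)
  have "(\<Sum>j<n. schur_mat $$ (i, j) * u j) = a * u i" if i: "i < n" for i
  proof -
    consider "i \<in> S" | "i \<in> Y" | "i \<notin> S \<union> Y" by auto
    then show ?thesis
    proof cases
      case 1 then show ?thesis by (simp add: schur_mat_row_S Lu uS)
    next
      case 2
      have "(\<Sum>t\<in>S. Q t i * row_value t u) = (\<Sum>t\<in>S. (a / (a - 1)) * (Q t i * r t))"
        by (intro sum.cong) (auto simp: Lu)
      also have "\<dots> = a / (a - 1) * k" unfolding sum_distrib_left[symmetric] kr[OF 2] ..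
      finally have "(\<Sum>j<n. schur_mat $$ (i, j) * u j) = a / (a - 1) * k - c * q"
        unfolding schur_mat_row_Y[OF 2] su by simp
      also have "\<dots> = a" using root a unfolding \<beta>_def by (simp add: field_simps)
      finally show ?thesis using 2 by (simp add: u_def)
    next
      case 3 then show ?thesis using schur_mat_row_out[OF 3 i, of u] by (simp add: u_def)
    qed
  qed
  moreover have "\<exists>i<n. u i \<noteq> 0" using Yne Y unfolding u_def by auto
  ultimately have ev: "eigenvalue schur_mat a" unfolding eigenvalue_iff[OF schur_mat_carrier] by blast
  show ?thesis
  proof (rule num_neg_eigenvalues_eq_1[OF schur_mat_carrier schur_mat_sym _ a ev])
    fix w :: "nat \<Rightarrow> real" assume z: "(\<Sum>i<n. of_bool (i \<in> Y) * w i) = 0"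
    have "(\<Sum>i<n. of_bool (i \<in> Y) * w i) = (\<Sum>i\<in>Y. of_bool (i \<in> Y) * w i)"
      using Y by (intro sum.mono_neutral_right) auto
    also have "\<dots> = (\<Sum>y\<in>Y. w y)" by (intro sum.cong) auto
    finally have "(\<Sum>y\<in>Y. w y) = 0" using z by simp
    then show "0 \<le> (\<Sum>i<n. w i * (\<Sum>j<n. schur_mat $$ (i, j) * w j))" using qform_ge[of w] by simp
  qed
qed

lemma schur_mat_off_diagonal_nonpos:
  assumes neg: "\<And>s y. s \<in> S \<Longrightarrow> y \<in> Y \<Longrightarrow> Q s y \<le> 0" and gc: "g \<le> c"
    and ij: "i < n" "j < n" "i \<noteq> j"
  shows "schur_mat $$ (i, j) \<le> 0"
proof -
  consider "i \<in> S" | "j \<in> S" | "i \<in> Y" "j \<in> Y" | "i \<notin> S \<union> Y" | "j \<notin> S \<union> Y" by auto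
  then show ?thesis
  proof cases
    case 1 then show ?thesis unfolding entry_S[OF 1 ij(2)] using ij neg by (auto simp: row_fun_def)
  next
    case 2 then show ?thesis unfolding schur_mat_sym[OF ij(1,2)] entry_S[OF 2 ij(1)] using ij neg by (auto simp: row_fun_def)
  next
    case 3 then show ?thesis unfolding entry_YY[OF 3] using ij gc by auto
  next
    case 4 then show ?thesis unfolding entry_out[OF 4 ij(1,2)] using ij by auto
  next
    case 5 then show ?thesis unfolding schur_mat_sym[OF ij(1,2)] entry_out[OF 5 ij(2,1)] using ij by auto
  qed
qed

end

lemma cdv_nu_ge_schur:
  assumes "schur_form n S Y Q g d 0"
  shows "card Y - 1 \<le> cdv_nu n (split_graph S Y (g \<noteq> 0))"
proof -
  interpret schur_form n S Y Q g d 0 by fact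
  show ?thesis
    using kernel_dim_schur_mat cdv_nu_ge[OF schur_mat_sym_mats schur_mat_strong_arnold schur_mat_pos_semidef] by simp
qed

lemma cdv_mu_ge_schur:
  assumes "schur_form n S Y Q g d c" and c: "c > 0" "g \<le> c"
    and neg: "\<And>s y. s \<in> S \<Longrightarrow> y \<in> Y \<Longrightarrow> Q s y \<le> 0"
  shows "card Y - 1 \<le> cdv_mu n (split_graph S Y (g \<noteq> c))"
proof -
  interpret schur_form n S Y Q g d c by fact
  have "\<forall>i<n. \<forall>j<n. i \<noteq> j \<longrightarrow> schur_mat $$ (i, j) \<le> 0"
    using schur_mat_off_diagonal_nonpos[OF neg c(2)] by blast
  then show ?thesis
    using kernel_dim_schur_mat cdv_mu_ge[OF schur_mat_sym_mats schur_mat_strong_arnold schur_mat_one_negative[OF c(1)]] by simp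
qed

lemma cdv_ge_complete_split:
  assumes "S \<subseteq> {..<n}" "Y \<subseteq> {..<n}" "S \<inter> Y = {}" "S \<noteq> {}" "Y \<noteq> {}"
  shows "card Y - 1 \<le> cdv_nu n (split_graph S Y True)" (is ?nu)
    and "card Y - 1 \<le> cdv_mu n (split_graph S Y True)" (is ?mu)
proof -
  have p: "real (card S) > 0" using assms finite_subset[of S "{..<n}"] by (simp add: card_gt_0_iff)
  have "schur_form n S Y (\<lambda>_ _. 1) (real (card S)) 0 0"
    using assms p by unfold_locales auto
  from cdv_nu_ge_schur[OF this] p show ?nu by simp
  \<comment> \<open>With \<open>c = |S| + 1\<close> the entries on \<open>Y\<close> are \<open>-1\<close>, the sign that \<open>\<mu>\<close> demands.\<close>
  have "schur_form n S Y (\<lambda>_ _. -1) (real (card S)) 0 (real (card S) + 1)"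
    using assms p by unfold_locales auto
  from cdv_mu_ge_schur[OF this] p show ?mu by simp
qed

text \<open>
  For \<open>|S| = |Y| = q\<close> this is the reflection \<open>I - (2/q) J\<close>. Otherwise the rows that \<open>\<phi>\<close> misses are
  filled with a constant \<open>e\<close>, and \<open>q t\<^sup>2 - 2 t + l e\<^sup>2 = 0\<close> is the condition for orthonormal
  columns, \<open>l\<close> being the number of such rows. From \<open>q \<ge> 3\<close> on, \<open>t \<noteq> 1\<close>, so that no entry vanishes.
\<close>

lemma orthonormal_columns_without_zeros:
  assumes fin: "finite S" "finite Y" and q: "card Y \<ge> 3"
    and \<phi>: "inj_on \<phi> Y" "\<phi> ` Y \<subseteq> S"
  shows "\<exists>Q :: 'a \<Rightarrow> 'b \<Rightarrow> real. (\<forall>s\<in>S. \<forall>y\<in>Y. Q s y \<noteq> 0) \<and>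
    (\<forall>y\<in>Y. \<forall>y'\<in>Y. (\<Sum>s\<in>S. Q s y * Q s y') = of_bool (y = y'))"
proof -
  define q l where "q = real (card Y)" and "l = real (card (S - \<phi> ` Y))"
  have q3: "q \<ge> 3" using assms(3) unfolding q_def by simp
  have l0: "l \<ge> 0" unfolding l_def by simp
  define t where "t = (if l = 0 then 2 / q else 1 / q)"
  define e where "e = (if l = 0 then 1 else 1 / sqrt (q * l))"
  have te: "q * t\<^sup>2 - 2 * t + l * e\<^sup>2 = 0"
  proof (cases "l = 0")
    case True
    then show ?thesis using q3 by (simp add: t_def power2_eq_square)
  next
    case False
    then have "l * e\<^sup>2 = 1 / q" using q3 l0 by (simp add: e_def power_divide)
    then show ?thesis using False q3 by (simp add: t_def power2_eq_square)
  qed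
  define Q where "Q s y = (if s \<in> \<phi> ` Y then of_bool (s = \<phi> y) - t else e)" for s y
  have "Q s y \<noteq> 0" for s y
  proof -
    have "t \<noteq> 0" "t \<noteq> 1" using q3 unfolding t_def by (auto simp: field_simps)
    moreover have "e \<noteq> 0" using q3 l0 unfolding e_def by auto
    ultimately show ?thesis unfolding Q_def by auto
  qed
  moreover have "(\<Sum>s\<in>S. Q s y * Q s y') = of_bool (y = y')" if y: "y \<in> Y" "y' \<in> Y" for y y'
  proof -
    have inj: "\<phi> u = \<phi> v \<longleftrightarrow> u = v" if "u \<in> Y" "v \<in> Y" for u v
      using \<phi>(1) that unfolding inj_on_def by auto
    have "(\<Sum>s\<in>S. Q s y * Q s y') = (\<Sum>s\<in>S - \<phi> ` Y. Q s y * Q s y') + (\<Sum>s\<in>\<phi> ` Y. Q s y * Q s y')"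
      using \<phi>(2) fin(1) by (rule sum.subset_diff)
    also have "(\<Sum>s\<in>S - \<phi> ` Y. Q s y * Q s y') = l * e\<^sup>2"
      unfolding l_def by (simp add: Q_def power2_eq_square)
    also have "(\<Sum>s\<in>\<phi> ` Y. Q s y * Q s y') = (\<Sum>u\<in>Y. (of_bool (u = y) - t) * (of_bool (u = y') - t))"
      unfolding sum.reindex[OF \<phi>(1)] using y inj by (intro sum.cong) (auto simp: Q_def)
    also have "\<dots> = (\<Sum>u\<in>Y. (if u = y then of_bool (y = y') else 0) - (if u = y then t else 0)
        - (if u = y' then t else 0) + t\<^sup>2)"
      by (intro sum.cong) (auto simp: algebra_simps power2_eq_square)
    also have "\<dots> = of_bool (y = y') - 2 * t + q * t\<^sup>2"
      unfolding q_def using fin(2) y by (simp add: sum.distrib sum_subtractf)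
    finally show ?thesis using te by simp
  qed
  ultimately show ?thesis by (intro exI[of _ Q]) blast
qed

lemma cdv_ge_complete_bipartite:
  assumes S: "S \<subseteq> {..<n}" "Y \<subseteq> {..<n}" "S \<inter> Y = {}" and q: "card Y \<ge> 3"
    and \<phi>: "inj_on \<phi> Y" "\<phi> ` Y \<subseteq> S"
  shows "card Y - 1 \<le> cdv_nu n (split_graph S Y False)" (is ?nu)
    and "card Y - 1 \<le> cdv_mu n (split_graph S Y False)" (is ?mu)
proof -
  have fin: "finite S" "finite Y" using S by (auto intro: finite_subset)
  have Y: "Y \<noteq> {}" using q by auto
  obtain Q :: "nat \<Rightarrow> nat \<Rightarrow> real" where "\<forall>s\<in>S. \<forall>y\<in>Y. Q s y \<noteq> 0"
    "\<forall>y\<in>Y. \<forall>y'\<in>Y. (\<Sum>s\<in>S. Q s y * Q s y') = of_bool (y = y')"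
    using orthonormal_columns_without_zeros[OF fin q \<phi>] by blast
  then have "schur_form n S Y Q 0 1 0" using S Y by unfold_locales auto
  from cdv_nu_ge_schur[OF this] show ?nu by simp
  \<comment> \<open>For \<open>\<mu>\<close> the columns cannot be orthogonal, as all entries must be negative. The matrix \<open>-(I + J)\<close>,
  with rows of \<open>-1\<close> added, has a Gram matrix of the form \<open>I + g J\<close>, and \<open>c = g\<close> removes the multiple of \<open>J\<close>.\<close>
  define P :: "nat \<Rightarrow> nat \<Rightarrow> real" where "P s y = - (1 + of_bool (s = \<phi> y))" for s y
  have "schur_form n S Y P (real (card S) + 2) 1 (real (card S) + 2)"
  proof unfold_locales
    fix y y' assume y: "y \<in> Y" "y' \<in> Y"
    have inj: "\<phi> y = \<phi> y' \<longleftrightarrow> y = y'" using \<phi>(1) y unfolding inj_on_def by auto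
    have "(\<Sum>s\<in>S. P s y * P s y') = (\<Sum>s\<in>S. 1 + (if s = \<phi> y then 1 else 0) + (if s = \<phi> y' then 1 else 0)
      + (if s = \<phi> y then of_bool (y = y') else 0))"
      using inj by (intro sum.cong) (auto simp: P_def)
    then show "(\<Sum>s\<in>S. P s y * P s y') = real (card S) + 2 + 1 * of_bool (y = y')"
      using \<phi>(2) y fin by (auto simp: sum.distrib)
  qed (use S Y in \<open>auto simp: P_def\<close>)
  from cdv_mu_ge_schur[OF this] show ?mu by (simp add: P_def)
qed

section \<open>Hadwiger number\<close>

text \<open>
  Contracting \<open>{x, y}\<close> keeps the graph simple: only that edge could collapse to a single vertex.
\<close>

lemma minor_card_edges:
  assumes "minor V E V' E'" "finite V" "E \<subseteq> nsets V 2"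
  shows "V' \<subseteq> V \<and> E' \<subseteq> nsets V' 2 \<and> card E' \<le> card E"
  using assms
proof (induction rule: minor.induct)
  case refl
  then show ?case by simp
next
  case (delete_edge V' E' e)
  then show ?case using card_Diff1_le[of E' e] by auto
next
  case (delete_vertex V' E' x)
  then have IH: "V' \<subseteq> V" "E' \<subseteq> nsets V' 2" "card E' \<le> card E" by auto
  have "finite V'" using IH(1) delete_vertex.prems(1) finite_subset by auto
  then have "finite E'" using IH(2) finite_imp_finite_nsets finite_subset by metis
  then have "card {e \<in> E'. x \<notin> e} \<le> card E'" by (intro card_mono) auto
  then show ?case using IH by (auto simp: nsets_def)
next
  case (contract_edge V' E' x y)
  then have IH: "V' \<subseteq> V" "E' \<subseteq> nsets V' 2" "card E' \<le> card E" by auto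
  have "finite V'" using IH(1) contract_edge.prems(1) finite_subset by auto
  then have fin: "finite E'" using IH(2) finite_imp_finite_nsets finite_subset by metis
  have xy: "x \<in> V'" "y \<in> V'" using IH(2) contract_edge.hyps(3) by auto
  let ?f = "id(y := x)"
  have "?f ` e \<in> nsets (V' - {y}) 2" if e: "e \<in> E' - {{x, y}}" for e
  proof -
    have "e \<in> nsets V' 2" using e IH(2) by auto
    then obtain a b where ab: "e = {a, b}" "a \<in> V'" "b \<in> V'" "a \<noteq> b" by (rule nsets2_E)
    then have "?f a \<noteq> ?f b" using e by (auto simp: insert_commute)
    moreover have "?f a \<in> V' - {y}" "?f b \<in> V' - {y}" using ab xy \<open>x \<noteq> y\<close> by auto
    ultimately show ?thesis unfolding ab(1) by (simp del: fun_upd_apply)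
  qed
  moreover have "card ((\<lambda>e. ?f ` e) ` (E' - {{x, y}})) \<le> card E'"
    using card_image_le[of "E' - {{x, y}}"] fin card_Diff1_le[of E' "{x, y}"] by (meson finite_Diff le_trans)
  ultimately show ?case using IH by auto
qed

lemma minor_delete_vertices:
  assumes "minor V E V' E'" "finite D" "D \<subseteq> V'"
  shows "minor V E (V' - D) {e \<in> E'. e \<inter> D = {}}"
  using assms(2,3)
proof (induction D rule: finite_induct)
  case empty
  then show ?case using assms(1) by simp
next
  case (insert x D)
  then have "minor V E (V' - D - {x}) {e \<in> {e \<in> E'. e \<inter> D = {}}. x \<notin> e}"
    by (intro minor.delete_vertex) auto
  moreover have "{e \<in> {e \<in> E'. e \<inter> D = {}}. x \<notin> e} = {e \<in> E'. e \<inter> insert x D = {}}" by auto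
  moreover have "V' - D - {x} = V' - insert x D" by auto
  ultimately show ?case by simp
qed

lemma minor_clique:
  assumes m: "minor V E V' E'" "finite V" "E \<subseteq> nsets V 2" and W: "W \<subseteq> V'" "nsets W 2 \<subseteq> E'"
  shows "minor V E W (nsets W 2)"
proof -
  have E': "E' \<subseteq> nsets V' 2" and V': "V' \<subseteq> V" using minor_card_edges[OF m] by auto
  have "finite V'" using V' m(2) finite_subset by auto
  then have "minor V E (V' - (V' - W)) {e \<in> E'. e \<inter> (V' - W) = {}}"
    by (intro minor_delete_vertices[OF m(1)]) auto
  moreover have "V' - (V' - W) = W" using W by auto
  moreover have "{e \<in> E'. e \<inter> (V' - W) = {}} = nsets W 2"
  proof
    show "{e \<in> E'. e \<inter> (V' - W) = {}} \<subseteq> nsets W 2" using E' by (fastforce simp: nsets_def)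
    show "nsets W 2 \<subseteq> {e \<in> E'. e \<inter> (V' - W) = {}}" using W(2) by (fastforce simp: nsets_def)
  qed
  ultimately show ?thesis by simp
qed

lemma finite_minor_cliques:
  fixes E :: "nat set set"
  assumes "E \<subseteq> nsets {..<n} 2"
  shows "finite {card W | W. minor {..<n} E W (nsets W 2)}"
proof (rule finite_subset)
  show "{card W | W. minor {..<n} E W (nsets W 2)} \<subseteq> {..n}"
    using minor_card_edges[OF _ _ assms] card_mono[of "{..<n}"] by fastforce
qed simp

lemma hadwiger_ge:
  assumes "E \<subseteq> nsets {..<n} 2" "minor {..<n} E W (nsets W 2)"
  shows "card W \<le> hadwiger_number n E"
  unfolding hadwiger_number_def using assms by (intro Max_ge finite_minor_cliques) auto

lemma hadwiger_bound:
  assumes E: "E \<subseteq> nsets {..<n} 2"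
  shows "hadwiger_number n E * (hadwiger_number n E - 1) \<le> 2 * card E"
proof -
  let ?S = "{card W | W. minor {..<n} E W (nsets W 2)}"
  have "minor {..<n} E {} (nsets {} 2)"
    by (rule minor_clique[OF minor.refl _ E]) (auto simp: nsets_def)
  then have "?S \<noteq> {}" by blast
  then have "hadwiger_number n E \<in> ?S"
    unfolding hadwiger_number_def using finite_minor_cliques[OF E] by (intro Max_in)
  then obtain W where W: "hadwiger_number n E = card W" "minor {..<n} E W (nsets W 2)" by auto
  have "card W choose 2 \<le> card E"
    using minor_card_edges[OF W(2) _ E] by simp
  then show ?thesis unfolding W(1) twice_choose_two[symmetric] by simp
qed

lemma hadwiger_ge_clique:
  assumes "E \<subseteq> nsets {..<n} 2" "Y \<subseteq> {..<n}" "nsets Y 2 \<subseteq> E"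
  shows "card Y \<le> hadwiger_number n E"
  using assms by (intro hadwiger_ge minor_clique[OF minor.refl]) auto

text \<open>
  Contracting the matching edge between \<open>y\<close> and \<open>\<phi> y\<close> gives \<open>y\<close> all the neighbours of \<open>\<phi> y\<close>, hence all of
  \<open>Y\<close>. After all these contractions \<open>Y\<close> is a clique.
\<close>

lemma hadwiger_ge_matched_bipartite:
  assumes E: "E \<subseteq> nsets {..<n} 2" and S: "S \<subseteq> {..<n}" "Y \<subseteq> {..<n}" "S \<inter> Y = {}"
    and bip: "\<And>s y. s \<in> S \<Longrightarrow> y \<in> Y \<Longrightarrow> {s, y} \<in> E"
    and \<phi>: "inj_on \<phi> Y" "\<phi> ` Y \<subseteq> S"
  shows "card Y \<le> hadwiger_number n E"
proof -
  have inj: "\<phi> u = \<phi> v \<longleftrightarrow> u = v" if "u \<in> Y" "v \<in> Y" for u v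
    using \<phi>(1) that unfolding inj_on_def by auto
  \<comment> \<open>The state after contracting the matching edges at \<open>Z\<close>.\<close>
  have contract: "\<exists>E'. minor {..<n} E ({..<n} - \<phi> ` Z) E' \<and>
    (\<forall>s \<in> S - \<phi> ` Z. \<forall>y\<in>Y. {s, y} \<in> E') \<and> (\<forall>z\<in>Z. \<forall>y\<in>Y. z \<noteq> y \<longrightarrow> {z, y} \<in> E')"
    if "finite Z" "Z \<subseteq> Y" for Z
    using that
  proof (induction Z rule: finite_induct)
    case empty
    then show ?case using minor.refl[of "{..<n}" E] bip by auto
  next
    case (insert z Z)
    then obtain E' where m: "minor {..<n} E ({..<n} - \<phi> ` Z) E'"
      and old: "\<And>s y. s \<in> S - \<phi> ` Z \<Longrightarrow> y \<in> Y \<Longrightarrow> {s, y} \<in> E'"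
      and new: "\<And>u y. u \<in> Z \<Longrightarrow> y \<in> Y \<Longrightarrow> u \<noteq> y \<Longrightarrow> {u, y} \<in> E'" by auto
    have z: "z \<in> Y" "z \<notin> S" "\<phi> z \<in> S" "\<phi> z \<notin> Y" using insert.prems S \<phi>(2) by auto
    have zZ: "\<phi> z \<notin> \<phi> ` Z" using insert.hyps insert.prems inj by auto
    let ?f = "id(\<phi> z := z)"
    let ?E = "(\<lambda>e. ?f ` e) ` (E' - {{z, \<phi> z}})"
    have e: "{z, \<phi> z} \<in> E'" using old[of "\<phi> z" z] z zZ by (simp add: insert_commute)
    have "z \<noteq> \<phi> z" using z by auto
    from minor.contract_edge[OF m this e]
    have "minor {..<n} E ({..<n} - \<phi> ` Z - {\<phi> z}) ?E" .
    moreover have "{..<n} - \<phi> ` Z - {\<phi> z} = {..<n} - \<phi> ` insert z Z" by auto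
    moreover have keep: "{a, b} \<in> ?E" if "{a, b} \<in> E'" "a \<noteq> \<phi> z" "b \<noteq> \<phi> z" for a b
    proof -
      have "{a, b} \<in> E' - {{z, \<phi> z}}" using that by (auto simp: doubleton_eq_iff)
      moreover have "?f ` {a, b} = {a, b}" using that by auto
      ultimately show ?thesis by (metis (no_types, lifting) image_eqI)
    qed
    moreover have "{s, y} \<in> ?E" if "s \<in> S - \<phi> ` insert z Z" "y \<in> Y" for s y
      using that old z by (intro keep) auto
    moreover have "{u, y} \<in> ?E" if u: "u \<in> insert z Z" and y: "y \<in> Y" "u \<noteq> y" for u y
    proof (cases "u = z")
      case True
      have "{\<phi> z, y} \<in> E' - {{z, \<phi> z}}"
        using old[of "\<phi> z" y] z zZ y True by (auto simp: doubleton_eq_iff)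
      moreover have "?f ` {\<phi> z, y} = {z, y}" using z y by auto
      ultimately show ?thesis using True by (metis (no_types, lifting) image_eqI)
    next
      case False
      then have "u \<in> Z" using u by simp
      then show ?thesis using new[of u y] y z insert.prems by (intro keep) auto
    qed
    ultimately show ?case by (intro exI[of _ ?E]) auto
  qed
  have finY: "finite Y" using S by (auto intro: finite_subset)
  obtain E' where m: "minor {..<n} E ({..<n} - \<phi> ` Y) E'"
    and cl: "\<And>z y. z \<in> Y \<Longrightarrow> y \<in> Y \<Longrightarrow> z \<noteq> y \<Longrightarrow> {z, y} \<in> E'"
    using contract[OF finY] by auto
  have "minor {..<n} E Y (nsets Y 2)"
  proof (rule minor_clique[OF m _ E])
    show "Y \<subseteq> {..<n} - \<phi> ` Y" using S \<phi>(2) by auto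
    show "nsets Y 2 \<subseteq> E'" using cl by (auto elim!: nsets2_E)
  qed simp
  then show ?thesis by (rule hadwiger_ge[OF E])
qed

section \<open>Decomposing the complete graph along residue classes\<close>

definition residue_part :: "nat \<Rightarrow> nat \<Rightarrow> nat \<Rightarrow> nat set" where
  "residue_part n k a = {v. v < n \<and> v mod k = a}"

lemma card_residue_part: "a < k \<Longrightarrow> n div k \<le> card (residue_part n k a)"
proof -
  assume a: "a < k"
  have "(\<lambda>j. k * j + a) ` {..<n div k} \<subseteq> residue_part n k a"
  proof
    fix v assume "v \<in> (\<lambda>j. k * j + a) ` {..<n div k}"
    then obtain j where "v = k * j + a" "j < n div k" by blast
    then have j: "v = k * j + a" "Suc j \<le> n div k" by simp_all
    have "k * j + a < k * Suc j" using a by simp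
    also have "\<dots> \<le> k * (n div k)" using j(2) by (rule mult_le_mono2)
    also have "\<dots> \<le> n" by simp
    finally show "v \<in> residue_part n k a" using j a by (simp add: residue_part_def)
  qed
  moreover have "finite (residue_part n k a)" unfolding residue_part_def by simp
  ultimately have "card ((\<lambda>j. k * j + a) ` {..<n div k}) \<le> card (residue_part n k a)" by (rule card_mono[rotated])
  moreover have "inj_on (\<lambda>j. k * j + a) {..<n div k}" using a by (auto simp: inj_on_def)
  ultimately show ?thesis by (simp add: card_image)
qed

text \<open>
  An injection of a residue part into one with a smaller residue: the matching for the complete
  bipartite graph between the two.
\<close>

lemma residue_part_shift:
  assumes "a < b" "b < k"
  defines "\<phi> \<equiv> \<lambda>y. k * (y div k) + a"
  shows "inj_on \<phi> (residue_part n k b)" "\<phi> ` residue_part n k b \<subseteq> residue_part n k a"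
proof -
  have y: "y = k * (y div k) + b" if "y \<in> residue_part n k b" for y
    using that mult_div_mod_eq[of k y] unfolding residue_part_def by simp
  show "inj_on \<phi> (residue_part n k b)"
  proof (rule inj_onI)
    fix x z assume "x \<in> residue_part n k b" "z \<in> residue_part n k b" "\<phi> x = \<phi> z"
    then show "x = z" using y[of x] y[of z] unfolding \<phi>_def by linarith
  qed
  show "\<phi> ` residue_part n k b \<subseteq> residue_part n k a"
  proof
    fix v assume "v \<in> \<phi> ` residue_part n k b"
    then obtain x where x: "x \<in> residue_part n k b" "v = \<phi> x" by auto
    have "x < n" using x(1) unfolding residue_part_def by simp
    then have "v < n" using y[OF x(1)] x(2) assms(1) unfolding \<phi>_def by linarith
    then show "v \<in> residue_part n k a" using x(2) assms unfolding residue_part_def by simp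
  qed
qed

text \<open>
  The set of the residues of the two ends of an edge, except that an edge inside a part \<open>a < d\<close>
  counts as an edge between the parts \<open>a\<close> and \<open>a + 1\<close>.
\<close>

definition edge_class :: "nat \<Rightarrow> nat \<Rightarrow> nat set \<Rightarrow> nat set" where
  "edge_class k d e =
     (let A = (\<lambda>v. v mod k) ` e in if card A = 1 \<and> Min A < d then insert (Min A + 1) A else A)"

lemma edge_class_doubleton:
  "edge_class k d {u, v} = (if u mod k = v mod k then
     if u mod k < d then {u mod k, u mod k + 1} else {u mod k}
   else {u mod k, v mod k})"
  unfolding edge_class_def by (auto simp: Let_def)

definition residue_classes :: "nat \<Rightarrow> nat \<Rightarrow> nat set set" where
  "residue_classes k d = nsets {..<k} 2 \<union> (\<lambda>a. {a}) ` {d..<k}"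

lemma residue_classesE:
  assumes "K \<in> residue_classes k d"
  obtains a b where "K = {a, b}" "a < b" "b < k" | a where "K = {a}" "d \<le> a" "a < k"
proof -
  from assms consider "K \<in> nsets {..<k} 2" | a where "K = {a}" "d \<le> a" "a < k"
    unfolding residue_classes_def by auto
  then show thesis
  proof cases
    case 1
    then obtain x y where xy: "K = {x, y}" "x < k" "y < k" "x \<noteq> y" by (auto elim: nsets2_E)
    then show thesis using that(1)[of x y] that(1)[of y x] by (cases x y rule: linorder_cases) auto
  next
    case 2
    then show thesis by (rule that(2))
  qed
qed

lemma finite_classes: "finite (residue_classes k d)"
  unfolding residue_classes_def by (simp add: finite_imp_finite_nsets)

text \<open>
  The merging removes \<open>d\<close> of the \<open>k(k + 1)/2\<close> pairs.
\<close>

lemma card_classes: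
  assumes d: "d < k" and r: "k * (k + 1) = 2 * (r + d)"
  shows "card (residue_classes k d) = r"
proof -
  have "card (residue_classes k d) = card (nsets {..<k} 2) + card ((\<lambda>a. {a}) ` {d..<k})"
    unfolding residue_classes_def by (intro card_Un_disjoint) (auto simp: finite_imp_finite_nsets nsets_def)
  also have "card ((\<lambda>a. {a}) ` {d..<k}) = k - d" by (subst card_image) auto
  also have "card (nsets {..<k} 2) = k choose 2" by simp
  finally have "2 * card (residue_classes k d) = 2 * (k choose 2) + 2 * (k - d)" by simp
  then have "2 * card (residue_classes k d) = k * (k - 1) + 2 * (k - d)" unfolding twice_choose_two .
  moreover have "k * (k - 1) + 2 * k = k * (k + 1)" by (cases k) auto
  ultimately have "2 * card (residue_classes k d) + 2 * d = 2 * (r + d)" using d r by simp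
  then show ?thesis by simp
qed

lemma edge_class_in_classes:
  assumes "e \<in> nsets {..<n} 2" "d < k"
  shows "edge_class k d e \<in> residue_classes k d"
proof -
  obtain u v where "e = {u, v}" using assms(1) by (rule nsets2_E)
  moreover have "u mod k < k" "v mod k < k" using assms(2) by auto
  ultimately show ?thesis using assms(2) unfolding residue_classes_def by (auto simp: edge_class_doubleton)
qed

definition class_graph :: "nat \<Rightarrow> nat \<Rightarrow> nat \<Rightarrow> nat set \<Rightarrow> nat set set" where
  "class_graph n k d K = {e \<in> nsets {..<n} 2. edge_class k d e = K}"

lemma residue_part_subset: "residue_part n k a \<subseteq> {..<n}"
  unfolding residue_part_def by auto

lemma residue_part_disjoint: "a \<noteq> b \<Longrightarrow> residue_part n k a \<inter> residue_part n k b = {}"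
  unfolding residue_part_def by auto

lemma class_graph_pair:
  assumes "a < b"
  shows "class_graph n k d {a, b}
    = split_graph (residue_part n k b) (residue_part n k a) (b = a + 1 \<and> a < d)" (is "?E = ?F")
proof (rule edge_set_eqI[of _ "{..<n}"])
  let ?A = "residue_part n k a" and ?B = "residue_part n k b"
  have disj: "?B \<inter> ?A = {}" using assms residue_part_disjoint[of b a] by simp
  show "?F \<subseteq> nsets {..<n} 2" by (intro split_graph_subset residue_part_subset disj)
  fix u v assume uv: "u \<in> {..<n}" "v \<in> {..<n}" "u \<noteq> v"
  have "{u, v} \<in> ?E \<longleftrightarrow> edge_class k d {u, v} = {a, b}" using uv by (simp add: class_graph_def)
  also have "\<dots> \<longleftrightarrow> u mod k = b \<and> v mod k = a \<or> u mod k = a \<and> v mod k = b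
    \<or> (b = a + 1 \<and> a < d) \<and> u mod k = a \<and> v mod k = a"
    using assms unfolding edge_class_doubleton by (auto simp: doubleton_eq_iff)
  also have "\<dots> \<longleftrightarrow> {u, v} \<in> ?F"
    using doubleton_in_split_graph[OF disj uv(3)] uv by (simp add: residue_part_def)
  finally show "{u, v} \<in> ?E \<longleftrightarrow> {u, v} \<in> ?F" .
qed (auto simp: class_graph_def)

text \<open>
  A clique is the join of one of its vertices and the rest, so that the results on split graphs
  also cover the edges inside one part.
\<close>

lemma class_graph_loop:
  assumes "d \<le> a" and x: "x \<in> residue_part n k a"
  shows "class_graph n k d {a} = split_graph {x} (residue_part n k a - {x}) True" (is "?E = ?F")
proof (rule edge_set_eqI[of _ "{..<n}"])
  let ?A = "residue_part n k a"
  have disj: "{x} \<inter> (?A - {x}) = {}" by simp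
  show "?F \<subseteq> nsets {..<n} 2"
    using x residue_part_subset[of n k a] by (intro split_graph_subset disj) auto
  fix u v assume uv: "u \<in> {..<n}" "v \<in> {..<n}" "u \<noteq> v"
  have "{u, v} \<in> ?E \<longleftrightarrow> edge_class k d {u, v} = {a}" using uv by (simp add: class_graph_def)
  also have "\<dots> \<longleftrightarrow> u mod k = a \<and> v mod k = a"
    using assms(1) unfolding edge_class_doubleton by auto
  also have "\<dots> \<longleftrightarrow> {u, v} \<in> ?F"
    using doubleton_in_split_graph[OF disj uv(3)] uv x by (auto simp: residue_part_def)
  finally show "{u, v} \<in> ?E \<longleftrightarrow> {u, v} \<in> ?F" .
qed (auto simp: class_graph_def)

section \<open>Growth of the parameters\<close>

text \<open>
  What the Hadwiger number and the three spectral parameters have in common, as far as their growth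
  is concerned: lower bounds on the two kinds of split graphs, and an upper bound by the number
  of edges.
\<close>

definition split_bounded :: "graph_param \<Rightarrow> bool" where
  "split_bounded \<beta> \<longleftrightarrow>
     (\<forall>n S Y. S \<subseteq> {..<n} \<longrightarrow> Y \<subseteq> {..<n} \<longrightarrow> S \<inter> Y = {} \<longrightarrow> S \<noteq> {} \<longrightarrow> Y \<noteq> {} \<longrightarrow>
        card Y - 1 \<le> \<beta> n (split_graph S Y True)) \<and>
     (\<forall>n S Y \<phi>. S \<subseteq> {..<n} \<longrightarrow> Y \<subseteq> {..<n} \<longrightarrow> S \<inter> Y = {} \<longrightarrow> 3 \<le> card Y \<longrightarrow>
        inj_on \<phi> Y \<longrightarrow> \<phi> ` Y \<subseteq> S \<longrightarrow> card Y - 1 \<le> \<beta> n (split_graph S Y False)) \<and>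
     (\<forall>n E. n \<ge> 1 \<longrightarrow> E \<subseteq> nsets {..<n} 2 \<longrightarrow> \<beta> n E * (\<beta> n E - 1) \<le> 2 * (n + card E))"

lemma split_boundedD:
  assumes "split_bounded \<beta>"
  shows "S \<subseteq> {..<n} \<Longrightarrow> Y \<subseteq> {..<n} \<Longrightarrow> S \<inter> Y = {} \<Longrightarrow> S \<noteq> {} \<Longrightarrow> Y \<noteq> {} \<Longrightarrow>
      card Y - 1 \<le> \<beta> n (split_graph S Y True)"
    and "S \<subseteq> {..<n} \<Longrightarrow> Y \<subseteq> {..<n} \<Longrightarrow> S \<inter> Y = {} \<Longrightarrow> 3 \<le> card Y \<Longrightarrow>
      inj_on \<phi> Y \<Longrightarrow> \<phi> ` Y \<subseteq> S \<Longrightarrow> card Y - 1 \<le> \<beta> n (split_graph S Y False)"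
    and "n \<ge> 1 \<Longrightarrow> E \<subseteq> nsets {..<n} 2 \<Longrightarrow> \<beta> n E * (\<beta> n E - 1) \<le> 2 * (n + card E)"
proof -
  note d = assms[unfolded split_bounded_def]
  show "S \<subseteq> {..<n} \<Longrightarrow> Y \<subseteq> {..<n} \<Longrightarrow> S \<inter> Y = {} \<Longrightarrow> S \<noteq> {} \<Longrightarrow> Y \<noteq> {} \<Longrightarrow>
      card Y - 1 \<le> \<beta> n (split_graph S Y True)"
    by (rule d[THEN conjunct1, rule_format])
  show "S \<subseteq> {..<n} \<Longrightarrow> Y \<subseteq> {..<n} \<Longrightarrow> S \<inter> Y = {} \<Longrightarrow> 3 \<le> card Y \<Longrightarrow>
      inj_on \<phi> Y \<Longrightarrow> \<phi> ` Y \<subseteq> S \<Longrightarrow> card Y - 1 \<le> \<beta> n (split_graph S Y False)"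
    by (rule d[THEN conjunct2, THEN conjunct1, rule_format])
  show "n \<ge> 1 \<Longrightarrow> E \<subseteq> nsets {..<n} 2 \<Longrightarrow> \<beta> n E * (\<beta> n E - 1) \<le> 2 * (n + card E)"
    by (rule d[THEN conjunct2, THEN conjunct2, rule_format])
qed

lemma class_graph_value_ge:
  assumes \<beta>: "split_bounded \<beta>" and K: "K \<in> residue_classes k d" and nk: "n div k \<ge> 3"
  shows "n div k - 2 \<le> \<beta> n (class_graph n k d K)"
proof -
  note full = split_boundedD(1)[OF \<beta>] and bip = split_boundedD(2)[OF \<beta>]
  have size: "n div k \<le> card (residue_part n k a)" "residue_part n k a \<noteq> {}" if "a < k" for a
  proof -
    show "n div k \<le> card (residue_part n k a)" by (rule card_residue_part[OF that])
    then show "residue_part n k a \<noteq> {}" using nk by (intro notI) simp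
  qed
  from K consider a b where "K = {a, b}" "a < b" "b < k" | a where "K = {a}" "d \<le> a" "a < k"
    by (rule residue_classesE)
  then show ?thesis
  proof cases
    case 1
    let ?A = "residue_part n k a" and ?B = "residue_part n k b"
    have ak: "a < k" using 1 by simp
    have disj: "?B \<inter> ?A = {}" using residue_part_disjoint[of b a] 1 by simp
    show ?thesis
    proof (cases "b = a + 1 \<and> a < d")
      case True
      then have "class_graph n k d K = split_graph ?B ?A True" using class_graph_pair[OF 1(2)] 1(1) by simp
      then have "card ?A - 1 \<le> \<beta> n (class_graph n k d K)"
        using full[OF residue_part_subset residue_part_subset disj] size(2)[OF ak] size(2)[OF 1(3)] by simp
      then show ?thesis using size(1)[OF ak] by linarith
    next
      case False
      then have "(b = a + 1 \<and> a < d) = False" by simp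
      then have "class_graph n k d K = split_graph ?A ?B False"
        unfolding 1(1) class_graph_pair[OF 1(2)] by (simp only: split_graph_sym[of ?A])
      moreover have "3 \<le> card ?B" using size(1)[OF 1(3)] nk by linarith
      ultimately have "card ?B - 1 \<le> \<beta> n (class_graph n k d K)"
        using bip[OF residue_part_subset residue_part_subset _ _ residue_part_shift[OF 1(2,3)]] disj
        by (simp add: Int_commute)
      then show ?thesis using size(1)[OF 1(3)] by linarith
    qed
  next
    case 2
    obtain x where x: "x \<in> residue_part n k a" using size(2)[OF 2(3)] by auto
    have fin: "finite (residue_part n k a)" unfolding residue_part_def by simp
    have card: "card (residue_part n k a - {x}) = card (residue_part n k a) - 1" using x fin by simp
    have "card (residue_part n k a - {x}) - 1 \<le> \<beta> n (split_graph {x} (residue_part n k a - {x}) True)"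
    proof (rule full)
      have "card (residue_part n k a - {x}) > 0" using card size(1)[OF 2(3)] nk by linarith
      then show "residue_part n k a - {x} \<noteq> {}" by (metis card.empty less_irrefl)
    qed (use x residue_part_subset[of n k a] in auto)
    then have "card (residue_part n k a) - 1 - 1 \<le> \<beta> n (class_graph n k d K)"
      unfolding 2(1) class_graph_loop[OF 2(2) x] card .
    then show ?thesis using size(1)[OF 2(3)] by linarith
  qed
qed

lemma decomp_max_lower:
  assumes \<beta>: "split_bounded \<beta>" and d: "d < k" and r: "k * (k + 1) = 2 * (r + d)" and nk: "n div k \<ge> 3"
  shows "r * (n div k - 2) \<le> decomp_max \<beta> r n"
proof -
  obtain h where h: "bij_betw h {..<r} (residue_classes k d)"
    using ex_bij_betw_nat_finite[OF finite_classes[of k d]] card_classes[OF d r] atLeast0LessThan by metis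
  define Es where "Es i = class_graph n k d (h i)" for i
  have "decomposition r n Es"
    unfolding decomposition_def
  proof
    show "disjoint_family_on Es {..<r}"
      using h unfolding disjoint_family_on_def Es_def class_graph_def bij_betw_def inj_on_def by auto
    show "(\<Union>i<r. Es i) = nsets {..<n} 2"
    proof
      show "nsets {..<n} 2 \<subseteq> (\<Union>i<r. Es i)"
      proof
        fix e assume e: "e \<in> nsets {..<n} 2"
        then obtain i where "i < r" "edge_class k d e = h i"
          using edge_class_in_classes[OF e d] h unfolding bij_betw_def by (metis imageE lessThan_iff)
        then show "e \<in> (\<Union>i<r. Es i)" using e unfolding Es_def class_graph_def by auto
      qed
    qed (auto simp: Es_def class_graph_def)
  qed
  then have "(\<Sum>i<r. \<beta> n (Es i)) \<le> decomp_max \<beta> r n" by (rule decomp_max_ge)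
  moreover have "(\<Sum>i<r. n div k - 2) \<le> (\<Sum>i<r. \<beta> n (Es i))"
  proof (rule sum_mono)
    fix i assume "i \<in> {..<r}"
    then have "h i \<in> residue_classes k d" using h unfolding bij_betw_def by auto
    then show "n div k - 2 \<le> \<beta> n (Es i)" unfolding Es_def by (rule class_graph_value_ge[OF \<beta> _ nk])
  qed
  ultimately show ?thesis by simp
qed

text \<open>
  The values \<open>x i\<close> satisfy \<open>\<Sum>(x i)\<^sup>2 - \<Sum>x i \<le> n\<^sup>2 + 2 r n\<close>, and \<open>(\<Sum>x i)\<^sup>2 \<le> r \<Sum>(x i)\<^sup>2\<close> by the
  Cauchy-Schwarz inequality. Completing the square in the sum \<open>s\<close> gives
  \<open>(s - r/2)\<^sup>2 \<le> r (n + r)\<^sup>2\<close>.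
\<close>

lemma decomp_max_upper:
  assumes \<beta>: "split_bounded \<beta>" and r: "r \<ge> 1" and n: "n \<ge> 1"
  shows "real (decomp_max \<beta> r n) \<le> real r / 2 + sqrt (real r) * (real n + real r)"
proof -
  obtain Es where Es: "decomposition r n Es" and eq: "decomp_max \<beta> r n = (\<Sum>i<r. \<beta> n (Es i))"
    by (rule decomp_max_attained[OF r, of n \<beta>])
  define x where "x i = real (\<beta> n (Es i))" for i
  define s where "s = (\<Sum>i<r. x i)"
  have s: "real (decomp_max \<beta> r n) = s" unfolding eq s_def x_def by simp
  have fin: "finite (Es i)" if "i < r" for i
    using decomposition_subset[OF Es that] finite_imp_finite_nsets[of "{..<n}" 2] finite_subset by auto
  have "(\<Sum>i<r. card (Es i)) = card (\<Union>i<r. Es i)"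
    using Es fin unfolding decomposition_def disjoint_family_on_def by (subst card_UN_disjoint) auto
  also have "\<dots> = n choose 2" using Es unfolding decomposition_def by simp
  finally have "2 * (\<Sum>i<r. card (Es i)) = n * (n - 1)" by (simp only: twice_choose_two)
  then have edges: "(\<Sum>i<r. 2 * card (Es i)) = n * (n - 1)" by (simp only: sum_distrib_left)
  have one: "(x i)\<^sup>2 - x i \<le> real (2 * n + 2 * card (Es i))" if "i < r" for i
  proof -
    have "\<beta> n (Es i) * (\<beta> n (Es i) - 1) \<le> 2 * n + 2 * card (Es i)"
    proof -
      have "\<beta> n (Es i) * (\<beta> n (Es i) - 1) \<le> 2 * (n + card (Es i))"
        by (rule split_boundedD(3)[OF \<beta> n decomposition_subset[OF Es that]])
      then show ?thesis by simp
    qed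
    then have "real (\<beta> n (Es i) * (\<beta> n (Es i) - 1)) \<le> real (2 * n + 2 * card (Es i))" by (rule of_nat_mono)
    moreover have "real (\<beta> n (Es i) * (\<beta> n (Es i) - 1)) = (x i)\<^sup>2 - x i"
      unfolding x_def by (cases "\<beta> n (Es i)") (auto simp: power2_eq_square algebra_simps)
    ultimately show ?thesis by simp
  qed
  have "(\<Sum>i<r. (x i)\<^sup>2 - x i) \<le> (\<Sum>i<r. real (2 * n + 2 * card (Es i)))"
    using one by (intro sum_mono) auto
  also have "\<dots> = real (\<Sum>i<r. 2 * n + 2 * card (Es i))" by simp
  also have "(\<Sum>i<r. 2 * n + 2 * card (Es i)) = 2 * r * n + n * (n - 1)"
    unfolding sum.distrib edges by simp
  also have "real (2 * r * n + n * (n - 1)) \<le> real (2 * r * n + n * n)" unfolding of_nat_le_iff by simp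
  also have "\<dots> = 2 * real r * real n + (real n)\<^sup>2" by (simp add: power2_eq_square)
  finally have sq: "(\<Sum>i<r. (x i)\<^sup>2) \<le> s + 2 * real r * real n + (real n)\<^sup>2"
    unfolding s_def by (simp add: sum_subtractf)
  \<comment> \<open>The Cauchy-Schwarz inequality, from the sum of the squared deviations from the mean.\<close>
  have "0 \<le> (\<Sum>i<r. (real r * x i - s)\<^sup>2)" by (intro sum_nonneg) auto
  also have "\<dots> = (\<Sum>i<r. (real r)\<^sup>2 * (x i)\<^sup>2 - 2 * real r * s * x i + s\<^sup>2)"
    by (intro sum.cong) (auto simp: power2_eq_square algebra_simps)
  also have "\<dots> = (real r)\<^sup>2 * (\<Sum>i<r. (x i)\<^sup>2) - 2 * real r * s * s + real r * s\<^sup>2"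
    unfolding sum.distrib sum_subtractf s_def by (simp add: sum_distrib_left)
  also have "\<dots> = real r * (real r * (\<Sum>i<r. (x i)\<^sup>2) - s\<^sup>2)"
    by (simp add: power2_eq_square algebra_simps)
  finally have "s\<^sup>2 \<le> real r * (\<Sum>i<r. (x i)\<^sup>2)" using r by (simp add: zero_le_mult_iff)
  also have "\<dots> \<le> real r * (s + 2 * real r * real n + (real n)\<^sup>2)" using sq by (intro mult_left_mono) auto
  finally have "(s - real r / 2)\<^sup>2 \<le> real r * ((real n)\<^sup>2 + 2 * real r * real n) + (real r)\<^sup>2 / 4"
    by (simp add: power2_eq_square algebra_simps)
  also have "(real r)\<^sup>2 / 4 \<le> real r * (real r)\<^sup>2"
  proof -
    have "1 * (real r)\<^sup>2 \<le> real r * (real r)\<^sup>2" using r by (intro mult_right_mono) auto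
    then show ?thesis using zero_le_power2[of "real r"] by linarith
  qed
  also have "real r * ((real n)\<^sup>2 + 2 * real r * real n) + real r * (real r)\<^sup>2 = real r * (real n + real r)\<^sup>2"
    by (simp add: power2_eq_square algebra_simps)
  finally have "s - real r / 2 \<le> sqrt (real r * (real n + real r)\<^sup>2)" by (simp add: real_le_rsqrt)
  also have "\<dots> = sqrt (real r) * (real n + real r)" by (simp add: real_sqrt_mult)
  finally show ?thesis unfolding s by simp
qed

text \<open>
  The rounded up root is the least \<open>k\<close> with \<open>k(k + 1)/2 \<ge> r\<close>. Minimality bounds the excess \<open>d\<close> by
  \<open>k - 1\<close>.
\<close>

lemma ceiling_triangular:
  fixes r :: nat
  assumes r: "r \<ge> 1"
  obtains k d :: nat where "d < k" "k * (k + 1) = 2 * (r + d)"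
    "real_of_int \<lceil>sqrt (2 * real r + 1 / 4) - 1 / 2\<rceil> = real k"
proof -
  define z where "z = sqrt (2 * real r + 1 / 4) - 1 / 2"
  have z2: "(z + 1 / 2)\<^sup>2 = 2 * real r + 1 / 4" unfolding z_def by simp
  have "1 / 2 < sqrt (2 * real r + 1 / 4)" using r by (intro real_less_rsqrt) (simp add: power2_eq_square)
  then have z0: "z > 0" unfolding z_def by simp
  define k where "k = nat \<lceil>z\<rceil>"
  have kz: "real_of_int \<lceil>z\<rceil> = real k" using z0 unfolding k_def by simp
  have k1: "k \<ge> 1" using z0 unfolding k_def by linarith
  have le: "z \<le> real k" and gt: "real k - 1 < z" using ceiling_correct[of z] kz by auto
  have "(z + 1 / 2)\<^sup>2 \<le> (real k + 1 / 2)\<^sup>2" using le z0 by (intro power_mono) auto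
  then have "2 * real r \<le> real k * (real k + 1)" unfolding z2 by (simp add: power2_eq_square algebra_simps)
  then have "real (2 * r) \<le> real (k * (k + 1))"
    by (simp only: of_nat_mult of_nat_add of_nat_1 of_nat_numeral)
  then have lo: "2 * r \<le> k * (k + 1)" by (simp only: of_nat_le_iff)
  have "(real k - 1 + 1 / 2)\<^sup>2 < (z + 1 / 2)\<^sup>2" using gt k1 by (intro power_strict_mono) auto
  then have "real k * (real k - 1) < 2 * real r" unfolding z2 by (simp add: power2_eq_square algebra_simps)
  then have "real (k * (k - 1)) < real (2 * r)" using k1 by simp
  then have hi: "k * (k - 1) < 2 * r" by (rule of_nat_less_imp_less)
  have "even (k * (k + 1))" by auto
  then obtain m where m: "k * (k + 1) = 2 * m" by (rule evenE)
  have "k * (k + 1) = k * (k - 1) + 2 * k" using k1 by (cases k) auto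
  then have "m < r + k" using m hi by linarith
  moreover have "r \<le> m" using m lo by linarith
  ultimately have "m - r < k" "k * (k + 1) = 2 * (r + (m - r))" using m by auto
  then show ?thesis using that kz unfolding z_def by blast
qed

theorem split_bounded_growth:
  assumes \<beta>: "split_bounded \<beta>" and r: "r \<ge> 1"
  shows "(\<lambda>n. real (decomp_max \<beta> r n)) \<in> \<Theta>(\<lambda>n. real n) \<and>
    (\<exists>f g :: nat \<Rightarrow> real. f \<longlonglongrightarrow> 0 \<and> g \<longlonglongrightarrow> 0 \<and>
       (\<forall>n\<ge>3. real r / real_of_int \<lceil>sqrt (2 * real r + 1 / 4) - 1 / 2\<rceil> - f n
            \<le> real (decomp_max \<beta> r n) / real n \<and>
          real (decomp_max \<beta> r n) / real n \<le> sqrt (real r) + g n))"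
proof -
  obtain k d :: nat where d: "d < k" and kr: "k * (k + 1) = 2 * (r + d)"
    and ck: "real_of_int \<lceil>sqrt (2 * real r + 1 / 4) - 1 / 2\<rceil> = real k"
    using ceiling_triangular[OF r] .
  have k: "real k > 0" using d by simp
  let ?b = "\<lambda>n. real (decomp_max \<beta> r n)"
  have lower: "real r / real k * real n - 3 * real r \<le> ?b n" if n: "n \<ge> 3 * k" for n
  proof -
    have nk: "n div k \<ge> 3" using n d by (simp add: less_eq_div_iff_mult_less_eq)
    have "real n / real k - 1 \<le> real (n div k)"
    proof -
      have "real n / real k < real_of_int \<lfloor>real n / real k\<rfloor> + 1" by linarith
      then show ?thesis unfolding floor_divide_of_nat_eq by simp
    qed
    then have "real n / real k - 3 \<le> real (n div k - 2)" using nk by simp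
    then have "real r * (real n / real k - 3) \<le> real r * real (n div k - 2)" by (intro mult_left_mono) auto
    also have "\<dots> \<le> ?b n" using decomp_max_lower[OF \<beta> d kr nk] by (simp flip: of_nat_mult)
    finally show ?thesis by (simp add: algebra_simps)
  qed
  define C where "C = real r / 2 + sqrt (real r) * real r"
  have upper: "?b n \<le> sqrt (real r) * real n + C" if "n \<ge> 1" for n
    using decomp_max_upper[OF \<beta> r that] unfolding C_def by (simp add: algebra_simps)
  have C0: "C \<ge> 0" unfolding C_def by simp
  \<comment> \<open>The least error terms that make the two bounds true for every \<open>n\<close>; only large \<open>n\<close> matter for
  their limits.\<close>
  define f where "f n = max 0 (real r / real k - ?b n / real n)" for n
  define g where "g n = max 0 (?b n / real n - sqrt (real r))" for n
  have "f \<longlonglongrightarrow> 0"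
  proof (rule tendsto_sandwich[OF _ _ tendsto_const])
    show "\<forall>\<^sub>F n in sequentially. 0 \<le> f n" unfolding f_def by simp
    show "\<forall>\<^sub>F n in sequentially. f n \<le> 3 * real r / real n"
      unfolding eventually_at_top_linorder
    proof (intro exI allI impI)
      fix n assume n: "n \<ge> 3 * k"
      then have "real n > 0" using d by simp
      then have "(real r / real k - 3 * real r / real n) * real n = real r / real k * real n - 3 * real r"
        by (simp add: left_diff_distrib)
      then have "real r / real k - 3 * real r / real n \<le> ?b n / real n"
        using lower[OF n] \<open>real n > 0\<close> by (simp add: pos_le_divide_eq)
      then show "f n \<le> 3 * real r / real n" unfolding f_def by simp
    qed
    show "(\<lambda>n. 3 * real r / real n) \<longlonglongrightarrow> 0" by real_asymp
  qed
  moreover have "g \<longlonglongrightarrow> 0"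
  proof (rule tendsto_sandwich[OF _ _ tendsto_const])
    show "\<forall>\<^sub>F n in sequentially. 0 \<le> g n" unfolding g_def by simp
    show "\<forall>\<^sub>F n in sequentially. g n \<le> C / real n"
      unfolding eventually_at_top_linorder
    proof (intro exI allI impI)
      fix n :: nat assume n: "n \<ge> 1"
      then have "?b n / real n \<le> sqrt (real r) + C / real n"
        using upper[OF n] by (simp add: field_simps)
      then show "g n \<le> C / real n" unfolding g_def using C0 by simp
    qed
    show "(\<lambda>n. C / real n) \<longlonglongrightarrow> 0" by real_asymp
  qed
  moreover have "\<forall>n\<ge>3. real r / real_of_int \<lceil>sqrt (2 * real r + 1 / 4) - 1 / 2\<rceil> - f n
      \<le> ?b n / real n \<and> ?b n / real n \<le> sqrt (real r) + g n"
    unfolding ck f_def g_def by auto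
  moreover have "(\<lambda>n. ?b n) \<in> \<Theta>(\<lambda>n. real n)"
  proof (rule bigthetaI)
    show "?b \<in> O(\<lambda>n. real n)"
    proof (rule bigoI)
      show "\<forall>\<^sub>F n in sequentially. norm (?b n) \<le> (sqrt (real r) + C) * norm (real n)"
        unfolding eventually_at_top_linorder
      proof (intro exI allI impI)
        fix n :: nat assume n: "n \<ge> 1"
        then have "C * 1 \<le> C * real n" using C0 by (intro mult_left_mono) auto
        then show "norm (?b n) \<le> (sqrt (real r) + C) * norm (real n)"
          using upper[OF n] by (simp add: algebra_simps)
      qed
    qed
    show "?b \<in> \<Omega>(\<lambda>n. real n)"
    proof (rule landau_omega.bigI)
      show "real r / (2 * real k) > 0" using r k by simp
      show "\<forall>\<^sub>F n in sequentially. real r / (2 * real k) * norm (real n) \<le> norm (?b n)"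
        unfolding eventually_at_top_linorder
      proof (intro exI allI impI)
        fix n assume n: "n \<ge> 6 * k"
        have "6 * real k \<le> real n" using n by (metis of_nat_le_iff of_nat_mult of_nat_numeral)
        then have "real r / (2 * real k) * (6 * real k) \<le> real r / (2 * real k) * real n"
          by (intro mult_left_mono) auto
        then have "3 * real r \<le> real r / (2 * real k) * real n" using k by simp
        moreover have "real r / real k * real n = 2 * (real r / (2 * real k) * real n)" using k by simp
        moreover have "real r / real k * real n - 3 * real r \<le> ?b n" using n by (intro lower) simp
        moreover have "u \<le> y" if "3 * q \<le> u" "x = 2 * u" "x - 3 * q \<le> y" for q u x y :: real
          using that by linarith
        ultimately show "real r / (2 * real k) * norm (real n) \<le> norm (?b n)"
          unfolding real_norm_def abs_of_nat by blast
      qed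
    qed
  qed
  ultimately show ?thesis by blast
qed

lemma cdv_nu_split_bounded: "split_bounded cdv_nu"
proof -
  have "cdv_nu n E * (cdv_nu n E - 1) \<le> 2 * (n + card E)" if "E \<subseteq> nsets {..<n} 2" for n E
    using cdv_nu_bound[OF that] by (rule le_trans[rotated]) (intro mult_le_mono; simp)
  then show ?thesis
    unfolding split_bounded_def using cdv_ge_complete_split(1) cdv_ge_complete_bipartite(1) by simp
qed

lemma cdv_mu_split_bounded: "split_bounded cdv_mu"
proof -
  have "cdv_mu n E * (cdv_mu n E - 1) \<le> 2 * (n + card E)" if "n \<ge> 1" "E \<subseteq> nsets {..<n} 2" for n E
    using cdv_mu_bound[OF that(2,1)] by (rule le_trans[rotated]) (intro mult_le_mono; simp)
  then show ?thesis
    unfolding split_bounded_def using cdv_ge_complete_split(2) cdv_ge_complete_bipartite(2) by simp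
qed

lemma cdv_xi_split_bounded: "split_bounded cdv_xi"
proof -
  have "cdv_xi n E * (cdv_xi n E - 1) \<le> 2 * (n + card E)" if "E \<subseteq> nsets {..<n} 2" for n E
    using cdv_xi_bound[OF that] by (rule le_trans[rotated]) (intro mult_le_mono; simp)
  then show ?thesis
    unfolding split_bounded_def
    using cdv_ge_complete_split(1)[THEN le_trans[OF _ cdv_nu_le_xi]]
      cdv_ge_complete_bipartite(1)[THEN le_trans[OF _ cdv_nu_le_xi]] by simp
qed

lemma hadwiger_split_bounded: "split_bounded hadwiger_number"
proof -
  have "card Y - 1 \<le> hadwiger_number n (split_graph S Y True)"
    if "S \<subseteq> {..<n}" "Y \<subseteq> {..<n}" "S \<inter> Y = {}" for n S Y
    using hadwiger_ge_clique[OF split_graph_subset[OF that] that(2), of True]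
    by (simp add: split_graph_def)
  moreover have "card Y - 1 \<le> hadwiger_number n (split_graph S Y False)"
    if "S \<subseteq> {..<n}" "Y \<subseteq> {..<n}" "S \<inter> Y = {}" "inj_on \<phi> Y" "\<phi> ` Y \<subseteq> S" for n S Y \<phi>
  proof -
    have "card Y \<le> hadwiger_number n (split_graph S Y False)"
      using that by (intro hadwiger_ge_matched_bipartite[of _ n S Y \<phi>] split_graph_subset)
        (auto simp: split_graph_def)
    then show ?thesis by simp
  qed
  moreover have "hadwiger_number n E * (hadwiger_number n E - 1) \<le> 2 * (n + card E)"
    if "E \<subseteq> nsets {..<n} 2" for n E
    using hadwiger_bound[OF that] by simp
  ultimately show ?thesis unfolding split_bounded_def by simp
qed

theorem theorem1p1:
  fixes r :: nat
  assumes "r \<ge> 2"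
  shows "(\<forall>\<beta> \<in> {tree_width, largeur_arborescence, path_width, proper_path_width}.
            (\<lambda>n. real (decomp_max \<beta> r n) / real n) \<longlonglongrightarrow> real r) \<and>
         (\<forall>\<beta> \<in> {hadwiger_number, cdv_mu, cdv_nu, cdv_xi}.
            (\<lambda>n. real (decomp_max \<beta> r n)) \<in> \<Theta>(\<lambda>n. real n) \<and>
            (\<exists>f g :: nat \<Rightarrow> real. f \<longlonglongrightarrow> 0 \<and> g \<longlonglongrightarrow> 0 \<and>
               (\<forall>n\<ge>3.
                  real r / real_of_int \<lceil>sqrt (2 * real r + 1 / 4) - 1 / 2\<rceil> - f n
                    \<le> real (decomp_max \<beta> r n) / real n \<and>
                  real (decomp_max \<beta> r n) / real n \<le> sqrt (real r) + g n)))"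
proof (intro conjI ballI)
  fix \<beta> assume "\<beta> \<in> {tree_width, largeur_arborescence, path_width, proper_path_width}"
  then obtain P where \<beta>: "\<beta> = least_width P"
    and start: "\<And>k V. card V = k + 1 \<Longrightarrow> P k V (nsets V 2)"
    and tree: "\<And>k V F. P k V F \<Longrightarrow> k_tree k V F"
  proof (elim insertE emptyE, goal_cases)
    case 1
    show ?case by (rule 1(1)[of k_tree]) (use 1(2) k_tree.start in \<open>auto simp: tree_width_def\<close>)
  next
    case 2
    show ?case
      by (rule 2(1)[of two_sided_k_tree])
        (use 2(2) two_sided_k_tree_used.start two_sided_k_tree_imp_k_tree in
          \<open>auto simp: largeur_arborescence_def two_sided_k_tree_def\<close>)
  next
    case 3
    show ?case
      by (rule 3(1)[of k_caterpillar])
        (use 3(2) k_caterpillar_last.start k_caterpillar_imp_k_tree in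
          \<open>auto simp: path_width_def k_caterpillar_def\<close>)
  next
    case 4
    show ?case
      by (rule 4(1)[of linear_k_tree])
        (use 4(2) linear_k_tree_last.start linear_k_tree_imp_k_tree in
          \<open>auto simp: proper_path_width_def linear_k_tree_def\<close>)
  qed
  show "(\<lambda>n. real (decomp_max \<beta> r n) / real n) \<longlonglongrightarrow> real r"
    unfolding \<beta> using start tree assms by (rule width_decomp_max_limit)
next
  fix \<beta> assume "\<beta> \<in> {hadwiger_number, cdv_mu, cdv_nu, cdv_xi}"
  then have "split_bounded \<beta>"
    using hadwiger_split_bounded cdv_mu_split_bounded cdv_nu_split_bounded cdv_xi_split_bounded by blast
  note growth = split_bounded_growth[OF this, of r]
  show "(\<lambda>n. real (decomp_max \<beta> r n)) \<in> \<Theta>(\<lambda>n. real n)"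
    using growth assms by simp
  show "\<exists>f g :: nat \<Rightarrow> real. f \<longlonglongrightarrow> 0 \<and> g \<longlonglongrightarrow> 0 \<and>
       (\<forall>n\<ge>3. real r / real_of_int \<lceil>sqrt (2 * real r + 1 / 4) - 1 / 2\<rceil> - f n
            \<le> real (decomp_max \<beta> r n) / real n \<and>
          real (decomp_max \<beta> r n) / real n \<le> sqrt (real r) + g n)"
    using growth assms by simp
qed

end
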